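(* Let $\mathcal{A}$ and $\mathcal{B}$ be CSL algebras acting on Hilbert spaces $H_1$ and $H_2$ respectively. Then $\mathcal{A}$ and $\mathcal{B}$ are spatially Morita equivalent if and only if the lattices $\mathrm{Lat}(\mathcal{A})$ and $\mathrm{Lat}(\mathcal{B})$ are isomorphic.
   Context: For an algebra $\mathcal{A}\subset B(H)$, $\mathrm{Lat}(\mathcal{A})$ is the set of orthogonal projections $L\in B(H)$ with $L^\perp\mathcal{A}L=0$, where $L^\perp=I-L$. For a set $\mathcal{L}$ of projections, $\mathrm{Alg}(\mathcal{L})=\{A\in B(H):L^\perp AL=0\ \forall L\in\mathcal{L}\}$. A lattice of projections on $H$ is a set of projections containing $0$ and $I$ and closed under arbitrary suprema and infima; a commutative subspace lattice (CSL) is such a lattice whose elements commute, and a CSL algebra is an algebra of the form $\mathrm{Alg}(\mathcal{L})$ with $\mathcal{L}$ a CSL. Two lattices are isomorphic if there is a lattice isomorphism, i.e. an order isomorphism (a bijection preserving order in both directions), between them. For sets of operators, $\mathcal{X}\mathcal{Y}=\{XY: X\in\mathcal{X},Y\in\mathcal{Y}\}$, and $\mathrm{span}(\mathcal{X})^{-w^*}$ is the weak-$*$ closure of the linear span. Two $w^*$-closed algebras $\mathcal{A}\subset B(H_1)$, $\mathcal{B}\subset B(H_2)$ are spatially Morita equivalent if there exist linear spaces $\mathcal{U}\subset B(H_1,H_2)$ and $\mathcal{V}\subset B(H_2,H_1)$ such that $\mathcal{B}\mathcal{U}\mathcal{A}\subset\mathcal{U}$, $\mathcal{A}\mathcal{V}\mathcal{B}\subset\mathcal{V}$,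 $\mathrm{span}(\mathcal{V}\mathcal{U})^{-w^*}=\mathcal{A}$ and $\mathrm{span}(\mathcal{U}\mathcal{V})^{-w^*}=\mathcal{B}$. *)

theory Defs
  imports "HOL-Analysis.Analysis"
begin

section \<open>Complex Hilbert spaces\<close>

class complex_vector = real_vector +
  fixes scaleC :: "complex \<Rightarrow> 'a \<Rightarrow> 'a" (infixr "*\<^sub>C" 75)
  assumes scaleC_add_right: "c *\<^sub>C (x + y) = c *\<^sub>C x + c *\<^sub>C y"
    and scaleC_add_left: "(c + d) *\<^sub>C x = c *\<^sub>C x + d *\<^sub>C x"
    and scaleC_scaleC: "c *\<^sub>C d *\<^sub>C x = (c * d) *\<^sub>C x"
    and scaleC_of_real: "complex_of_real r *\<^sub>C x = r *\<^sub>R x"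

lemma scaleC_one: "1 *\<^sub>C x = (x :: 'a :: complex_vector)"
  using scaleC_of_real[of 1 x] by simp

global_interpretation complex_vector: vector_space "scaleC :: complex \<Rightarrow> 'a \<Rightarrow> 'a :: complex_vector"
  defines csubspace = complex_vector.subspace
    and cspan = complex_vector.span
  by unfold_locales (simp_all add: scaleC_add_right scaleC_add_left scaleC_scaleC scaleC_one)

class complex_normed_vector = complex_vector + real_normed_vector +
  assumes norm_scaleC: "norm (c *\<^sub>C x) = cmod c * norm x"

text \<open>The inner product is linear in the first argument. Positive definiteness follows
  from \<open>cinner_self\<close> and the norm axioms.\<close>

class complex_hilbert = complex_normed_vector + complete_space +
  fixes cinner :: "'a \<Rightarrow> 'a \<Rightarrow> complex"
  assumes cinner_commute: "cinner x y = cnj (cinner y x)"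
    and cinner_add_left: "cinner (x + y) z = cinner x z + cinner y z"
    and cinner_scaleC_left: "cinner (c *\<^sub>C x) y = c * cinner x y"
    and cinner_self: "cinner x x = complex_of_real ((norm x)\<^sup>2)"

section \<open>Bounded operators\<close>

text \<open>The library type \<open>'a \<Rightarrow>\<^sub>L 'b\<close> consists of the bounded real-linear maps; 
  \<open>bounded_ops\<close> singles out the complex-linear ones, i.e. $B(H_1,H_2)$.\<close>

instantiation blinfun :: (real_normed_vector, complex_normed_vector) complex_vector
begin

lift_definition scaleC_blinfun :: "complex \<Rightarrow> ('a \<Rightarrow>\<^sub>L 'b) \<Rightarrow> ('a \<Rightarrow>\<^sub>L 'b)"
  is "\<lambda>c T x. c *\<^sub>C T x"
proof -
  fix c :: complex and T :: "'a \<Rightarrow> 'b"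
  assume "bounded_linear T"
  then interpret T: bounded_linear T .
  obtain K where K: "\<And>x. norm (T x) \<le> norm x * K"
    using T.bounded by blast
  show "bounded_linear (\<lambda>x. c *\<^sub>C T x)"
  proof (rule bounded_linear_intro[where K = "cmod c * K"])
    fix x y :: 'a and r :: real
    show "c *\<^sub>C T (x + y) = c *\<^sub>C T x + c *\<^sub>C T y"
      by (simp add: T.add scaleC_add_right)
    have "c *\<^sub>C r *\<^sub>R T x = r *\<^sub>R c *\<^sub>C T x"
      by (simp only: scaleC_of_real[symmetric] scaleC_scaleC mult.commute)
    then show "c *\<^sub>C T (r *\<^sub>R x) = r *\<^sub>R c *\<^sub>C T x"
      by (simp add: T.scaleR)
    show "norm (c *\<^sub>C T x) \<le> norm x * (cmod c * K)"
      using mult_left_mono[OF K[of x] norm_ge_zero[of c]] by (simp add: norm_scaleC mult_ac)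
  qed
qed

instance
  by standard
    (transfer; simp add: scaleC_add_right scaleC_add_left scaleC_scaleC scaleC_of_real fun_eq_iff)+

end

definition bounded_ops :: "('a::complex_hilbert \<Rightarrow>\<^sub>L 'b::complex_hilbert) set" where
  "bounded_ops = {T. \<forall>c x. blinfun_apply T (c *\<^sub>C x) = c *\<^sub>C blinfun_apply T x}"

definition op_prod ::
  "('b::complex_hilbert \<Rightarrow>\<^sub>L 'c::complex_hilbert) set \<Rightarrow> ('a::complex_hilbert \<Rightarrow>\<^sub>L 'b) set \<Rightarrow> ('a \<Rightarrow>\<^sub>L 'c) set"
where
  "op_prod X Y = {S o\<^sub>L T | S T. S \<in> X \<and> T \<in> Y}"

text \<open>$B(H_1,H_2)$ is the dual of the trace class operators from $H_2$ to $H_1$. Every such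
  operator is a sum of rank one operators built from two square-summable sequences,
  so the weak-* continuous functionals are the maps
  $T \mapsto \sum_n \langle T x_n, y_n\rangle$ below.\<close>

definition weak_star_functionals :: "(('a::complex_hilbert \<Rightarrow>\<^sub>L 'b::complex_hilbert) \<Rightarrow> complex) set" where
  "weak_star_functionals =
     {\<lambda>T. \<Sum>n. cinner (blinfun_apply T (x n)) (y n) | (x :: nat \<Rightarrow> 'a) (y :: nat \<Rightarrow> 'b).
        summable (\<lambda>n. (norm (x n))\<^sup>2) \<and> summable (\<lambda>n. (norm (y n))\<^sup>2)}"

definition weak_star_topology :: "('a::complex_hilbert \<Rightarrow>\<^sub>L 'b::complex_hilbert) topology" where
  "weak_star_topology = topology_generated_by
     {{T \<in> bounded_ops. \<phi> T \<in> W} | \<phi> W. \<phi> \<in> weak_star_functionals \<and> open W}"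

section \<open>Projections, lattices and algebras\<close>

definition projections :: "('a::complex_hilbert \<Rightarrow>\<^sub>L 'a) set" where
  "projections = {P \<in> bounded_ops. P o\<^sub>L P = P \<and>
     (\<forall>x y. cinner (blinfun_apply P x) y = cinner x (blinfun_apply P y))}"

definition proj_le :: "('a::complex_hilbert \<Rightarrow>\<^sub>L 'a) \<Rightarrow> ('a \<Rightarrow>\<^sub>L 'a) \<Rightarrow> bool" where
  "proj_le P Q \<longleftrightarrow> range (blinfun_apply P) \<subseteq> range (blinfun_apply Q)"

text \<open>Suprema and infima are taken among all projections on the space, not relative to a
  given set of projections.\<close>

definition is_proj_sup :: "('a::complex_hilbert \<Rightarrow>\<^sub>L 'a) set \<Rightarrow> ('a \<Rightarrow>\<^sub>L 'a) \<Rightarrow> bool" where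
  "is_proj_sup S P \<longleftrightarrow> P \<in> projections \<and> (\<forall>Q\<in>S. proj_le Q P) \<and>
     (\<forall>R\<in>projections. (\<forall>Q\<in>S. proj_le Q R) \<longrightarrow> proj_le P R)"

definition is_proj_inf :: "('a::complex_hilbert \<Rightarrow>\<^sub>L 'a) set \<Rightarrow> ('a \<Rightarrow>\<^sub>L 'a) \<Rightarrow> bool" where
  "is_proj_inf S P \<longleftrightarrow> P \<in> projections \<and> (\<forall>Q\<in>S. proj_le P Q) \<and>
     (\<forall>R\<in>projections. (\<forall>Q\<in>S. proj_le R Q) \<longrightarrow> proj_le R P)"

definition projection_lattice :: "('a::complex_hilbert \<Rightarrow>\<^sub>L 'a) set \<Rightarrow> bool" where
  "projection_lattice \<L> \<longleftrightarrow> \<L> \<subseteq> projections \<and> 0 \<in> \<L> \<and> id_blinfun \<in> \<L> \<and>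
     (\<forall>S\<subseteq>\<L>. (\<exists>P\<in>\<L>. is_proj_sup S P) \<and> (\<exists>P\<in>\<L>. is_proj_inf S P))"

definition csl :: "('a::complex_hilbert \<Rightarrow>\<^sub>L 'a) set \<Rightarrow> bool" where
  "csl \<L> \<longleftrightarrow> projection_lattice \<L> \<and> (\<forall>P\<in>\<L>. \<forall>Q\<in>\<L>. P o\<^sub>L Q = Q o\<^sub>L P)"

definition Lat :: "('a::complex_hilbert \<Rightarrow>\<^sub>L 'a) set \<Rightarrow> ('a \<Rightarrow>\<^sub>L 'a) set" where
  "Lat \<A> = {L \<in> projections. \<forall>A\<in>\<A>. (id_blinfun - L) o\<^sub>L A o\<^sub>L L = 0}"

definition Alg :: "('a::complex_hilbert \<Rightarrow>\<^sub>L 'a) set \<Rightarrow> ('a \<Rightarrow>\<^sub>L 'a) set" where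
  "Alg \<L> = {A \<in> bounded_ops. \<forall>L\<in>\<L>. (id_blinfun - L) o\<^sub>L A o\<^sub>L L = 0}"

definition csl_algebra :: "('a::complex_hilbert \<Rightarrow>\<^sub>L 'a) set \<Rightarrow> bool" where
  "csl_algebra \<A> \<longleftrightarrow> (\<exists>\<L>. csl \<L> \<and> \<A> = Alg \<L>)"

definition lattice_isomorphic ::
  "('a::complex_hilbert \<Rightarrow>\<^sub>L 'a) set \<Rightarrow> ('b::complex_hilbert \<Rightarrow>\<^sub>L 'b) set \<Rightarrow> bool"
where
  "lattice_isomorphic \<L> \<M> \<longleftrightarrow>
     (\<exists>f. bij_betw f \<L> \<M> \<and> (\<forall>P\<in>\<L>. \<forall>Q\<in>\<L>. proj_le P Q \<longleftrightarrow> proj_le (f P) (f Q)))"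

text \<open>Meant for weak-* closed algebras; CSL algebras are of this kind.\<close>

definition spatially_morita_equivalent ::
  "('a::complex_hilbert \<Rightarrow>\<^sub>L 'a) set \<Rightarrow> ('b::complex_hilbert \<Rightarrow>\<^sub>L 'b) set \<Rightarrow> bool"
where
  "spatially_morita_equivalent \<A> \<B> \<longleftrightarrow>
     (\<exists>(\<U> :: ('a \<Rightarrow>\<^sub>L 'b) set) (\<V> :: ('b \<Rightarrow>\<^sub>L 'a) set).
        \<U> \<subseteq> bounded_ops \<and> csubspace \<U> \<and>
        \<V> \<subseteq> bounded_ops \<and> csubspace \<V> \<and>
        op_prod \<B> (op_prod \<U> \<A>) \<subseteq> \<U> \<and>
        op_prod \<A> (op_prod \<V> \<B>) \<subseteq> \<V> \<and>
        weak_star_topology closure_of (cspan (op_prod \<V> \<U>)) = \<A> \<and>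
        weak_star_topology closure_of (cspan (op_prod \<U> \<V>)) = \<B>)"

end

theory Submission
  imports Defs
begin

text \<open>Equivalence to isomorphism: \<open>P \<mapsto> [U P H\<^sub>1]\<close> and \<open>Q \<mapsto> [V Q H\<^sub>2]\<close> are mutually inverse,
  because the identity is a weak-* limit of sums of products \<open>v u\<close>.

  Isomorphism to equivalence: replace the given lattices by \<open>L = Lat \<A>\<close> and \<open>M = Lat \<B>\<close>, which are
  again commutative, let \<open>f : L \<rightarrow> M\<close> be the isomorphism, and take for \<open>U\<close> all operators mapping \<open>P H\<^sub>1\<close>
  into \<open>f P H\<^sub>2\<close> for every \<open>P\<close>, and for \<open>V\<close> those mapping \<open>f P H\<^sub>2\<close> into \<open>P H\<^sub>1\<close>. The span of \<open>V U\<close> is an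
  ideal of \<open>\<A>\<close>, so it suffices to approximate the identity strongly by contractions in it. By cutting
  with the atoms of finite sublattices this reduces to finding, for a single vector \<open>\<xi>\<close>, such a
  contraction that almost fixes \<open>\<xi>\<close>. One transports the measure \<open>P \<mapsto> \<parallel>P \<xi>\<parallel>\<^sup>2\<close> on \<open>L\<close> to vectors \<open>\<zeta>\<close> in
  \<open>H\<^sub>2\<close> with \<open>\<parallel>f P \<zeta>\<parallel>\<^sup>2 \<approx> \<parallel>P \<xi>\<parallel>\<^sup>2\<close> uniformly in \<open>P\<close>: on finite sublattices by a maximal flow through
  stations of bounded capacity, whose cuts are controlled by an order-theoretic minimax argument.
  Then \<open>u \<xi> \<approx> \<zeta>\<close> and \<open>v\<^sup>* \<xi> \<approx> \<zeta>\<close> can be solved with contractions \<open>u \<in> U\<close>, \<open>v \<in> V\<close>, which arise as limits of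
  finite couplings, and \<open>v u\<close> almost fixes \<open>\<xi>\<close>.\<close>

section \<open>Hilbert space geometry\<close>

text \<open>An order isomorphism need not respect null sets: a singular homeomorphism of the unit
  interval induces one between two copies of the continuous nest. Densities cannot be carried over,
  and the measure of \<xi>, moved to \<open>M\<close>, may be singular to every measure that a
  vector of \<open>H\<^sub>2\<close> provides. Domination survives only for differences over nested
  pairs \<open>Q \<le> P\<close>, by finitely many vectors counted with multiplicity and up to a
  small error. The flow is designed to need no more than this. Supplies and demands both carry the
  measure of \<xi>, stations that of the dominating vectors, and mass may only move upward. A cut
  yields two upper sets, one generated at the supplies and one at the exits of the stations, and its
  cost is controlled by domination for the first set and its meet with the second. Upward moves into
  a station bound the new measure on complements of lattice elements, upward moves out of it bound
  it on the elements. Multiplicity is the reason for tuples of vectors and columns of operators, and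
  contractivity is what makes strong approximation on finitely many vectors imply weak-*
  approximation.\<close>

notation blinfun_apply (infixr "\<cdot>" 90)

lemma cinner_add_right: "cinner x (y + z) = cinner x y + cinner x (z :: 'a :: complex_hilbert)"
  by (metis cinner_add_left cinner_commute complex_cnj_add)

lemma cinner_scaleC_right: "cinner x (c *\<^sub>C y) = cnj c * cinner x (y :: 'a :: complex_hilbert)"
  by (metis cinner_commute cinner_scaleC_left complex_cnj_mult)

lemma cinner_scaleR_left: "cinner (r *\<^sub>R x) y = r *\<^sub>R cinner x (y :: 'a :: complex_hilbert)"
  by (metis cinner_scaleC_left scaleC_of_real scaleR_conv_of_real)

lemma cinner_scaleR_right: "cinner x (r *\<^sub>R y) = r *\<^sub>R cinner x (y :: 'a :: complex_hilbert)"
  by (metis cinner_scaleC_right complex_cnj_complex_of_real scaleC_of_real scaleR_conv_of_real)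

lemma scaleC_0_left: "0 *\<^sub>C x = (0 :: 'a :: complex_vector)"
  using scaleC_of_real[of 0 x] by simp

lemma Re_cinner_self: "Re (cinner x x) = (norm (x :: 'a :: complex_hilbert))\<^sup>2"
  by (simp add: cinner_self)

lemma norm_add_sq:
  "(norm (x + y))\<^sup>2 = (norm x)\<^sup>2 + (norm y)\<^sup>2 + 2 * Re (cinner x (y :: 'a :: complex_hilbert))"
proof -
  have "Re (cinner y x) = Re (cinner x y)"
    by (subst cinner_commute) simp
  then show ?thesis
    by (simp flip: Re_cinner_self add: cinner_add_left cinner_add_right)
qed

lemma cauchy_schwarz: "cmod (cinner x y) \<le> norm x * norm (y :: 'a :: complex_hilbert)"
proof (cases "y = 0")
  case True
  then show ?thesis
    using cinner_scaleR_right[of x 0 y] by simp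
next
  case False
  define t where "t = - (cinner x y / of_real ((norm y)\<^sup>2))"
  have ny: "(norm y)\<^sup>2 > 0" using False by simp
  have "Re (cinner x (t *\<^sub>C y)) = - (cmod (cinner x y))\<^sup>2 / (norm y)\<^sup>2"
  proof -
    have "cinner x (t *\<^sub>C y) = - (cnj (cinner x y) * cinner x y) / of_real ((norm y)\<^sup>2)"
      unfolding t_def by (simp only: cinner_scaleC_right) simp
    also have "cnj (cinner x y) * cinner x y = of_real ((cmod (cinner x y))\<^sup>2)"
      by (metis complex_norm_square mult.commute)
    finally show ?thesis
      by (metis Re_complex_of_real of_real_divide of_real_minus)
  qed
  moreover have "(norm (t *\<^sub>C y))\<^sup>2 = (cmod (cinner x y))\<^sup>2 / (norm y)\<^sup>2"
  proof -
    have "cmod t = cmod (cinner x y) / (norm y)\<^sup>2"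
      by (simp add: t_def norm_divide norm_power)
    then show ?thesis
      using False by (simp add: norm_scaleC power_mult_distrib power_divide power2_eq_square)
  qed
  ultimately have "0 \<le> (norm x)\<^sup>2 - (cmod (cinner x y))\<^sup>2 / (norm y)\<^sup>2"
    using norm_add_sq[of x "t *\<^sub>C y"] zero_le_power2[of "norm (x + t *\<^sub>C y)"] by linarith
  then have "(cmod (cinner x y))\<^sup>2 \<le> (norm x * norm y)\<^sup>2"
    using ny by (simp add: field_simps power_mult_distrib)
  then show ?thesis
    by (rule power2_le_imp_le) simp
qed

global_interpretation cinner: bounded_bilinear "cinner :: 'a :: complex_hilbert \<Rightarrow> 'a \<Rightarrow> complex"
proof
  show "\<exists>K. \<forall>a b :: 'a. norm (cinner a b) \<le> norm a * norm b * K"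
    using cauchy_schwarz by (intro exI[of _ 1]) auto
qed (simp_all add: cinner_add_left cinner_add_right cinner_scaleR_left cinner_scaleR_right)

lemma norm_diff_sq:
  "(norm (x - y))\<^sup>2 = (norm x)\<^sup>2 + (norm y)\<^sup>2 - 2 * Re (cinner x (y :: 'a :: complex_hilbert))"
  using norm_add_sq[of x "- y"] by (simp add: cinner.minus_right)

lemma parallelogram:
  "(norm (x + y))\<^sup>2 + (norm (x - y))\<^sup>2 = 2 * (norm x)\<^sup>2 + 2 * (norm (y :: 'a :: complex_hilbert))\<^sup>2"
  by (simp add: norm_add_sq norm_diff_sq)

lemma cinner_eq_zero_commute: "cinner x y = 0 \<longleftrightarrow> cinner y (x :: 'a :: complex_hilbert) = 0"
  by (metis cinner_commute complex_cnj_zero)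

lemma cinner_self_eq_zero: "cinner x x = 0 \<longleftrightarrow> x = (0 :: 'a :: complex_hilbert)"
  by (simp add: cinner_self)

lemma eq_zero_if_orthogonal: "(\<And>y. cinner x y = 0) \<Longrightarrow> x = (0 :: 'a :: complex_hilbert)"
  using cinner_self_eq_zero by blast

lemma norm_add_orthogonal:
  "cinner x y = 0 \<Longrightarrow> (norm (x + y))\<^sup>2 = (norm x)\<^sup>2 + (norm (y :: 'a :: complex_hilbert))\<^sup>2"
  by (simp add: norm_add_sq)

lemma norm_sum_orthogonal:
  fixes x :: "'i \<Rightarrow> 'a :: complex_hilbert"
  assumes "finite I" "\<And>i j. i \<in> I \<Longrightarrow> j \<in> I \<Longrightarrow> i \<noteq> j \<Longrightarrow> cinner (x i) (x j) = 0"
  shows "(norm (\<Sum>i\<in>I. x i))\<^sup>2 = (\<Sum>i\<in>I. (norm (x i))\<^sup>2)"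
  using assms
proof (induction I)
  case (insert i I)
  have "cinner (x i) (\<Sum>i\<in>I. x i) = 0"
    using insert by (auto simp: cinner.sum_right intro!: sum.neutral)
  then show ?case
    using insert by (simp add: norm_add_orthogonal)
qed simp

lemma csubspace_add: "csubspace S \<Longrightarrow> x \<in> S \<Longrightarrow> y \<in> S \<Longrightarrow> x + y \<in> S"
  by (rule complex_vector.subspace_add)

lemma csubspace_scaleR: "csubspace S \<Longrightarrow> x \<in> S \<Longrightarrow> r *\<^sub>R x \<in> S"
  by (metis complex_vector.subspace_scale scaleC_of_real)

lemma csubspace_diff: "csubspace S \<Longrightarrow> x \<in> S \<Longrightarrow> y \<in> S \<Longrightarrow> x - y \<in> S"
  by (rule complex_vector.subspace_diff)

lemma bounded_linear_scaleC: "bounded_linear (\<lambda>x. c *\<^sub>C (x :: 'a :: complex_normed_vector))"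
proof (rule bounded_linear_intro[where K = "cmod c"])
  fix x y :: 'a and r :: real
  show "c *\<^sub>C (x + y) = c *\<^sub>C x + c *\<^sub>C y"
    by (rule scaleC_add_right)
  show "c *\<^sub>C r *\<^sub>R x = r *\<^sub>R c *\<^sub>C x"
    by (simp only: scaleC_of_real[symmetric] scaleC_scaleC mult.commute)
qed (simp add: norm_scaleC mult.commute)

lemma csubspace_closure:
  fixes S :: "'a :: complex_normed_vector set"
  assumes "csubspace S"
  shows "csubspace (closure S)"
proof (rule complex_vector.subspaceI)
  show "0 \<in> closure S"
    using assms closure_subset complex_vector.subspace_0 by blast
next
  fix x y assume "x \<in> closure S" "y \<in> closure S"
  then obtain f g where "\<forall>n. f n \<in> S" "f \<longlonglongrightarrow> x" "\<forall>n. g n \<in> S" "g \<longlonglongrightarrow> y"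
    unfolding closure_sequential by blast
  then show "x + y \<in> closure S"
    unfolding closure_sequential
    by (intro exI[of _ "\<lambda>n. f n + g n"]) (auto intro: tendsto_add csubspace_add[OF assms])
next
  fix c x assume "x \<in> closure S"
  then obtain f where "\<forall>n. f n \<in> S" "f \<longlonglongrightarrow> x"
    unfolding closure_sequential by blast
  then show "c *\<^sub>C x \<in> closure S"
    unfolding closure_sequential
    by (intro exI[of _ "\<lambda>n. c *\<^sub>C f n"])
      (auto intro: complex_vector.subspace_scale[OF assms] bounded_linear.tendsto[OF bounded_linear_scaleC])
qed

text \<open>A minimising sequence is Cauchy by the parallelogram law, because midpoints stay in
  \<open>S\<close>. Optimality of the limit against shifts along \<open>s\<close> forces
  orthogonality.\<close>

lemma nearest_point:
  fixes S :: "'a :: complex_hilbert set"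
  assumes S: "csubspace S" "closed S"
  shows "\<exists>y\<in>S. \<forall>s\<in>S. cinner (x - y) s = 0"
proof -
  define D where "D = (\<lambda>y. (norm (x - y))\<^sup>2) ` S"
  define d where "d = Inf D"
  have ne: "D \<noteq> {}" and bd: "bdd_below D"
    using complex_vector.subspace_0[OF S(1)] by (auto simp: D_def intro!: bdd_belowI[of _ 0])
  have le: "d \<le> (norm (x - y))\<^sup>2" if "y \<in> S" for y
    unfolding d_def by (rule cInf_lower) (use that bd in \<open>auto simp: D_def\<close>)
  have "\<exists>y\<in>S. (norm (x - y))\<^sup>2 < d + 1 / real (Suc n)" for n
  proof -
    have "d < d + 1 / real (Suc n)" by simp
    then obtain r where "r \<in> D" "r < d + 1 / real (Suc n)"
      unfolding d_def using cInf_lessD[OF ne] by blast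
    then show ?thesis by (auto simp: D_def)
  qed
  then obtain y where y: "\<And>n. y n \<in> S" "\<And>n. (norm (x - y n))\<^sup>2 < d + 1 / real (Suc n)"
    by metis
  have dist: "(norm (y m - y n))\<^sup>2 \<le> 2 / real (Suc m) + 2 / real (Suc n)" for m n
  proof -
    define z where "z = (1/2) *\<^sub>R (y m + y n)"
    have "z \<in> S"
      unfolding z_def by (intro csubspace_scaleR csubspace_add S y)
    then have "d \<le> (norm (x - z))\<^sup>2" by (rule le)
    moreover have "(x - y m) + (x - y n) = 2 *\<^sub>R (x - z)"
      unfolding z_def by (simp add: algebra_simps scaleR_2)
    then have "(norm ((x - y m) + (x - y n)))\<^sup>2 = 4 * (norm (x - z))\<^sup>2"
      by (simp add: power_mult_distrib)
    moreover have "(norm ((x - y m) - (x - y n)))\<^sup>2 = (norm (y m - y n))\<^sup>2"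
      by (simp add: norm_minus_commute)
    moreover have "2 / real (Suc k) = 2 * (1 / real (Suc k))" for k by simp
    moreover note parallelogram[of "x - y m" "x - y n"] y(2)[of m] y(2)[of n]
    ultimately show ?thesis by smt
  qed
  have "Cauchy y"
  proof (rule CauchyI)
    fix e :: real assume e: "e > 0"
    then obtain N where N: "4 / real (Suc N) < e\<^sup>2"
      using reals_Archimedean[of "e\<^sup>2 / 4"] by (auto simp: field_simps inverse_eq_divide)
    show "\<exists>M. \<forall>m\<ge>M. \<forall>n\<ge>M. norm (y m - y n) < e"
    proof (intro exI[of _ N] allI impI)
      fix m n assume "N \<le> m" "N \<le> n"
      then have "2 / real (Suc m) \<le> 2 / real (Suc N)" "2 / real (Suc n) \<le> 2 / real (Suc N)"
        by (auto intro!: divide_left_mono)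
      then have "(norm (y m - y n))\<^sup>2 < e\<^sup>2"
        using dist[of m n] N by linarith
      then show "norm (y m - y n) < e"
        by (rule power2_less_imp_less) (use e in simp)
    qed
  qed
  then obtain z where z: "y \<longlonglongrightarrow> z"
    using Cauchy_convergent_iff convergent_def by blast
  have zS: "z \<in> S"
    using closed_sequentially[OF S(2) _ z] y(1) by blast
  have "(\<lambda>n. (norm (x - y n))\<^sup>2) \<longlonglongrightarrow> (norm (x - z))\<^sup>2"
    by (intro tendsto_intros z)
  moreover have "(\<lambda>n. d + 1 / real (Suc n)) \<longlonglongrightarrow> d + 0"
    by (intro tendsto_add tendsto_const) (rule LIMSEQ_Suc[OF lim_1_over_n])
  ultimately have zd: "(norm (x - z))\<^sup>2 \<le> d"
    using y(2) by (intro LIMSEQ_le[where X = "\<lambda>n. (norm (x - y n))\<^sup>2"]) (auto intro: less_imp_le)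
  have "cinner (x - z) s = 0" if s: "s \<in> S" for s
  proof (cases "s = 0")
    case False
    define w where "w = x - z"
    \<comment> \<open>The coefficient of the projection of \<open>w\<close> onto \<open>s\<close>;
      this shift would lower the squared distance by \<open>|t|^2 |s|^2\<close>.\<close>
    define t where "t = cinner w s / of_real ((norm s)\<^sup>2)"
    have "z + t *\<^sub>C s \<in> S"
      by (intro csubspace_add complex_vector.subspace_scale S zS s)
    from le[OF this] have "(norm w)\<^sup>2 \<le> (norm (w - t *\<^sub>C s))\<^sup>2"
      using zd unfolding w_def by (metis diff_diff_eq order_trans)
    also have "\<dots> = (norm w)\<^sup>2 + (cmod t * norm s)\<^sup>2 - 2 * Re (cnj t * cinner w s)"
      by (simp add: norm_diff_sq norm_scaleC cinner_scaleC_right)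
    also have "cinner w s = t * of_real ((norm s)\<^sup>2)"
      using False by (simp add: t_def)
    also have "Re (cnj t * (t * of_real ((norm s)\<^sup>2))) = (cmod t)\<^sup>2 * (norm s)\<^sup>2"
    proof -
      have "cnj t * (t * of_real ((norm s)\<^sup>2)) = of_real ((cmod t)\<^sup>2 * (norm s)\<^sup>2)"
        by (metis complex_norm_square mult.assoc mult.commute of_real_mult)
      then show ?thesis by (metis Re_complex_of_real)
    qed
    finally have "(cmod t)\<^sup>2 * (norm s)\<^sup>2 \<le> 0"
      unfolding power_mult_distrib by linarith
    then have "t = 0"
      using False by (simp add: mult_le_0_iff)
    then show ?thesis
      using False by (simp add: t_def w_def)
  qed (simp add: cinner.zero_right)
  then show ?thesis using zS by blast
qed

section \<open>Projections\<close>

lemma bounded_opsD: "T \<in> bounded_ops \<Longrightarrow> T \<cdot> (c *\<^sub>C x) = c *\<^sub>C T \<cdot> x"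
  by (simp add: bounded_ops_def)

lemma projectionsD:
  assumes "P \<in> projections"
  shows "P \<in> bounded_ops" "P \<cdot> P \<cdot> x = P \<cdot> x" "cinner (P \<cdot> x) y = cinner x (P \<cdot> y)"
proof -
  show "P \<in> bounded_ops" "cinner (P \<cdot> x) y = cinner x (P \<cdot> y)"
    using assms by (auto simp: projections_def)
  have "P o\<^sub>L P = P" using assms by (simp add: projections_def)
  then show "P \<cdot> P \<cdot> x = P \<cdot> x" by (metis blinfun_apply_blinfun_compose)
qed

lemma projectionsI:
  assumes "P \<in> bounded_ops" "\<And>x. P \<cdot> P \<cdot> x = P \<cdot> x" "\<And>x y. cinner (P \<cdot> x) y = cinner x (P \<cdot> y)"
  shows "P \<in> projections"
  using assms by (auto simp: projections_def intro!: blinfun_eqI)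

lemma bounded_ops_closed:
  shows "0 \<in> bounded_ops" "id_blinfun \<in> bounded_ops"
    "S \<in> bounded_ops \<Longrightarrow> T \<in> bounded_ops \<Longrightarrow> S + T \<in> bounded_ops"
    "S \<in> bounded_ops \<Longrightarrow> T \<in> bounded_ops \<Longrightarrow> S - T \<in> bounded_ops"
    "S \<in> bounded_ops \<Longrightarrow> c *\<^sub>C S \<in> bounded_ops"
    "S \<in> bounded_ops \<Longrightarrow> U \<in> bounded_ops \<Longrightarrow> S o\<^sub>L U \<in> bounded_ops"
  by (auto simp: bounded_ops_def blinfun.bilinear_simps scaleC_add_right scaleC_blinfun.rep_eq
      complex_vector.scale_right_diff_distrib scaleC_scaleC mult.commute)

lemma csubspace_bounded_ops: "csubspace bounded_ops"
  by (intro complex_vector.subspaceI bounded_ops_closed)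

lemma orthogonal_projection_exists:
  fixes S :: "'a :: complex_hilbert set"
  assumes S: "csubspace S" "closed S"
  shows "\<exists>P\<in>projections. range (blinfun_apply P) = S"
proof -
  obtain p where p: "\<And>x. p x \<in> S" "\<And>x s. s \<in> S \<Longrightarrow> cinner (x - p x) s = 0"
    using nearest_point[OF S] by metis
  \<comment> \<open>Uniqueness of the point with orthogonal remainder is what makes \<open>p\<close>
    linear and idempotent.\<close>
  have uniq: "y = p x" if "y \<in> S" "\<And>s. s \<in> S \<Longrightarrow> cinner (x - y) s = 0" for x y
  proof -
    have d: "p x - y \<in> S" by (intro csubspace_diff S p that)
    have "cinner (p x - y) (p x - y) = cinner (x - y) (p x - y) - cinner (x - p x) (p x - y)"
      by (simp add: cinner.diff_left)
    also have "\<dots> = 0" using that(2)[OF d] p(2)[OF d] by simp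
    finally show ?thesis by (simp add: cinner_self_eq_zero)
  qed
  have add: "p (x + y) = p x + p y" for x y
  proof (rule sym, rule uniq)
    show "p x + p y \<in> S" by (intro csubspace_add S p)
    have "x + y - (p x + p y) = (x - p x) + (y - p y)" by simp
    then show "cinner (x + y - (p x + p y)) s = 0" if "s \<in> S" for s
      by (simp only: cinner_add_left p(2)[OF that]) simp
  qed
  have scale: "p (c *\<^sub>C x) = c *\<^sub>C p x" for c x
  proof (rule sym, rule uniq)
    show "c *\<^sub>C p x \<in> S" by (intro complex_vector.subspace_scale S p)
    have "c *\<^sub>C x - c *\<^sub>C p x = c *\<^sub>C (x - p x)"
      by (simp add: complex_vector.scale_right_diff_distrib)
    then show "cinner (c *\<^sub>C x - c *\<^sub>C p x) s = 0" if "s \<in> S" for s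
      by (simp only: cinner_scaleC_left p(2)[OF that]) simp
  qed
  have sa: "cinner (p x) y = cinner x (p y)" for x y
  proof -
    have "cinner (p x) (y - p y) = 0"
      using p(2)[OF p(1), of y x] cinner_eq_zero_commute by blast
    moreover have "cinner (x - p x) (p y) = 0" by (rule p(2)[OF p(1)])
    ultimately show ?thesis by (simp add: cinner.diff_left cinner.diff_right)
  qed
  have bl: "bounded_linear p"
  proof (rule bounded_linear_intro[where K = 1])
    fix x y :: 'a and r :: real
    show "p (x + y) = p x + p y" by (rule add)
    show "p (r *\<^sub>R x) = r *\<^sub>R p x"
      by (metis scale scaleC_of_real)
    have "(norm x)\<^sup>2 = (norm (p x))\<^sup>2 + (norm (x - p x))\<^sup>2"
      using norm_add_orthogonal[OF p(2)[OF p(1)], of x x] by (simp add: add.commute)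
    then have "(norm (p x))\<^sup>2 \<le> (norm x)\<^sup>2" by simp
    then have "norm (p x) \<le> norm x"
      by (rule power2_le_imp_le) simp
    then show "norm (p x) \<le> norm x * 1" by simp
  qed
  have app: "Blinfun p \<cdot> x = p x" for x
    by (simp add: bounded_linear_Blinfun_apply[OF bl])
  have id: "p x = x" if "x \<in> S" for x
    using uniq[of x x] that by (simp add: cinner.zero_left)
  have "Blinfun p \<in> projections"
    by (rule projectionsI) (auto simp: app sa id p bounded_ops_def scale)
  moreover have "range (blinfun_apply (Blinfun p)) = S"
    using p(1) by (auto simp: app) (metis id rangeI)
  ultimately show ?thesis by blast
qed

section \<open>Riesz representation, operators from bounded forms, adjoints\<close>

lemma riesz:
  fixes \<phi> :: "'a :: complex_hilbert \<Rightarrow> complex"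
  assumes add: "\<And>x y. \<phi> (x + y) = \<phi> x + \<phi> y"
    and hom: "\<And>c x. \<phi> (c *\<^sub>C x) = c * \<phi> x"
    and bd: "\<And>x. cmod (\<phi> x) \<le> C * norm x"
  shows "\<exists>z. \<forall>x. \<phi> x = cinner x z"
proof -
  have bl: "bounded_linear \<phi>"
  proof (rule bounded_linear_intro[where K = C])
    show "\<phi> (r *\<^sub>R x) = r *\<^sub>R \<phi> x" for r x
      by (metis hom scaleC_of_real scaleR_conv_of_real)
  qed (auto simp: add bd mult.commute)
  interpret bounded_linear \<phi> by (rule bl)
  define S where "S = {x. \<phi> x = 0}"
  have "csubspace S"
    by (rule complex_vector.subspaceI) (auto simp: S_def add hom zero)
  moreover have "closed S"
    unfolding S_def using continuous_on_eq_continuous_within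
    by (intro closed_Collect_eq continuous_intros) (simp add: linear_continuous_on bl)
  ultimately have S: "csubspace S" "closed S" by auto
  show ?thesis
  proof (cases "\<forall>x. \<phi> x = 0")
    case True
    then show ?thesis by (intro exI[of _ 0]) (simp add: cinner.zero_right)
  next
    case False
    then obtain x0 where x0: "\<phi> x0 \<noteq> 0" by blast
    obtain y where y: "y \<in> S" "\<And>s. s \<in> S \<Longrightarrow> cinner (x0 - y) s = 0"
      using nearest_point[OF S] by metis
    define w where "w = x0 - y"
    have w0: "\<phi> w \<noteq> 0" using y(1) x0 by (simp add: w_def S_def diff)
    then have nw: "cinner w w \<noteq> 0" using cinner_self_eq_zero zero by metis
    \<comment> \<open>Scaled so that \<open>cinner w z\<close> is the value at \<open>w\<close>; the
      kernel together with \<open>w\<close> spans the space.\<close>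
    define z where "z = cnj (\<phi> w / cinner w w) *\<^sub>C w"
    have "\<phi> x = cinner x z" for x
    proof -
      define c where "c = \<phi> x / \<phi> w"
      have "x - c *\<^sub>C w \<in> S"
        using w0 by (simp add: S_def diff hom c_def)
      then have "cinner w (x - c *\<^sub>C w) = 0" using y(2) by (simp add: w_def)
      then have "cinner (x - c *\<^sub>C w) w = 0" using cinner_eq_zero_commute by blast
      then have "cinner x w = c * cinner w w"
        by (simp add: cinner.diff_left cinner_scaleC_left)
      then show ?thesis
        using nw w0 by (simp add: z_def cinner_scaleC_right c_def)
    qed
    then show ?thesis by blast
  qed
qed

text \<open>Riesz is applied to the conjugate of \<open>B x\<close>, which is linear in the second
  argument. This is how a pointwise limit of forms becomes an operator again.\<close>

lemma operator_of_form:
  fixes B :: "'a :: complex_hilbert \<Rightarrow> 'b :: complex_hilbert \<Rightarrow> complex"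
  assumes "\<And>x x' y. B (x + x') y = B x y + B x' y" "\<And>c x y. B (c *\<^sub>C x) y = c * B x y"
    and "\<And>x y y'. B x (y + y') = B x y + B x y'" "\<And>c x y. B x (c *\<^sub>C y) = cnj c * B x y"
    and "\<And>x y. cmod (B x y) \<le> norm x * norm y"
  shows "\<exists>T\<in>bounded_ops. \<forall>x y. cinner (T \<cdot> x) y = B x y"
proof -
  have "\<exists>z. \<forall>y. cnj (B x y) = cinner y z" for x
    using assms by (intro riesz[of _ "norm x"]) auto
  then obtain t where t: "\<And>x y. cnj (B x y) = cinner y (t x)" by metis
  have tB: "cinner (t x) y = B x y" for x y
    by (metis cinner_commute t complex_cnj_cnj)
  have eqI: "u = v" if "\<And>y. cinner u y = cinner v y" for u v :: 'b
    using eq_zero_if_orthogonal[of "u - v"] that by (simp add: cinner.diff_left)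
  have add: "t (x + y) = t x + t y" for x y
    by (rule eqI) (simp add: tB assms cinner_add_left)
  have scale: "t (c *\<^sub>C x) = c *\<^sub>C t x" for c x
    by (rule eqI) (simp add: tB assms cinner_scaleC_left)
  have "bounded_linear t"
  proof (rule bounded_linear_intro[where K = 1])
    show "t (r *\<^sub>R x) = r *\<^sub>R t x" for r x
      by (metis scale scaleC_of_real)
    fix x
    have "(norm (t x))\<^sup>2 = cmod (cinner (t x) (t x))"
      by (simp add: cinner_self norm_power)
    also have "\<dots> \<le> norm x * norm (t x)"
      by (simp add: tB assms)
    finally have "norm (t x) * norm (t x) \<le> norm x * norm (t x)"
      by (simp add: power2_eq_square)
    then show "norm (t x) \<le> norm x * 1"
      by (cases "t x = 0") simp_all
  qed (rule add)
  then have "Blinfun t \<cdot> x = t x" for x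
    by (simp add: bounded_linear_Blinfun_apply)
  then show ?thesis
    by (intro bexI[of _ "Blinfun t"]) (auto simp: tB bounded_ops_def scale)
qed

lemma adjoint_exists:
  fixes T :: "'a :: complex_hilbert \<Rightarrow>\<^sub>L 'b :: complex_hilbert"
  assumes "T \<in> bounded_ops" and bd: "\<And>x. norm (T \<cdot> x) \<le> norm x"
  shows "\<exists>T'\<in>bounded_ops. \<forall>y x. cinner (T' \<cdot> y) x = cinner y (T \<cdot> x)"
proof (rule operator_of_form[where B = "\<lambda>y x. cinner y (T \<cdot> x)"])
  show "cmod (cinner y (T \<cdot> x)) \<le> norm y * norm x" for x y
    using cauchy_schwarz[of y "T \<cdot> x"] bd[of x]
    by (meson mult_left_mono norm_ge_zero order_trans)
qed (use assms in \<open>auto simp: cinner_add_left cinner_add_right cinner_scaleC_left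
    cinner_scaleC_right bounded_opsD blinfun.add_right\<close>)

lemma norm_proj_sq:
  assumes "P \<in> projections"
  shows "(norm (P \<cdot> x))\<^sup>2 = Re (cinner (P \<cdot> x) x)"
  using projectionsD[OF assms] by (metis Re_cinner_self)

lemma norm_proj_pythagoras:
  assumes "P \<in> projections"
  shows "(norm x)\<^sup>2 = (norm (P \<cdot> x))\<^sup>2 + (norm (x - P \<cdot> x))\<^sup>2"
  using norm_proj_sq[OF assms, of x] norm_diff_sq[of x "P \<cdot> x"] projectionsD(3)[OF assms, of x x]
  by simp

lemma norm_proj_le:
  assumes "P \<in> projections"
  shows "norm (P \<cdot> x) \<le> norm x"
proof (rule power2_le_imp_le)
  show "(norm (P \<cdot> x))\<^sup>2 \<le> (norm x)\<^sup>2"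
    using norm_proj_pythagoras[OF assms, of x] by simp
qed simp

lemma proj_range_iff: "P \<in> projections \<Longrightarrow> x \<in> range (blinfun_apply P) \<longleftrightarrow> P \<cdot> x = x"
  by (metis projectionsD(2) rangeE rangeI)

lemma proj_le_iff:
  assumes "P \<in> projections" "Q \<in> projections"
  shows "proj_le P Q \<longleftrightarrow> (\<forall>x. Q \<cdot> P \<cdot> x = P \<cdot> x)"
  unfolding proj_le_def using proj_range_iff[OF assms(2)] by auto

lemma proj_eqI:
  assumes "P \<in> projections" "Q \<in> projections"
    and "range (blinfun_apply P) = range (blinfun_apply Q)"
  shows "P = Q"
proof (rule blinfun_eqI)
  fix x
  have 1: "Q \<cdot> P \<cdot> x = P \<cdot> x" "P \<cdot> Q \<cdot> y = Q \<cdot> y" for x y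
    using assms proj_range_iff by blast+
  have "cinner (P \<cdot> x - Q \<cdot> x) y = 0" for y
  proof -
    have "cinner (P \<cdot> x) y = cinner x (Q \<cdot> P \<cdot> y)"
      using 1 projectionsD(3)[OF assms(1)] by simp
    also have "\<dots> = cinner (P \<cdot> Q \<cdot> x) y"
      using projectionsD(3)[OF assms(1)] projectionsD(3)[OF assms(2)] by simp
    also have "\<dots> = cinner (Q \<cdot> x) y" by (simp add: 1)
    finally show ?thesis by (simp add: cinner.diff_left)
  qed
  then show "P \<cdot> x = Q \<cdot> x"
    using eq_zero_if_orthogonal[of "P \<cdot> x - Q \<cdot> x"] by simp
qed

lemma proj_le_antisym: "P \<in> projections \<Longrightarrow> Q \<in> projections \<Longrightarrow> proj_le P Q \<Longrightarrow> proj_le Q P \<Longrightarrow> P = Q"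
  using proj_eqI by (auto simp: proj_le_def)

lemma proj_le_trans: "proj_le P Q \<Longrightarrow> proj_le Q R \<Longrightarrow> proj_le P R"
  by (auto simp: proj_le_def)

lemma proj_le_refl: "proj_le P P"
  by (auto simp: proj_le_def)

lemma closed_proj_range:
  assumes "P \<in> projections"
  shows "closed (range (blinfun_apply P))" "csubspace (range (blinfun_apply P))"
proof -
  have eq: "range (blinfun_apply P) = {x. P \<cdot> x = x}"
    using proj_range_iff[OF assms] by blast
  show "closed (range (blinfun_apply P))"
    unfolding eq by (intro closed_Collect_eq continuous_intros)
  show "csubspace (range (blinfun_apply P))"
    unfolding eq using projectionsD(1)[OF assms]
    by (intro complex_vector.subspaceI) (auto simp: blinfun.bilinear_simps bounded_opsD)
qed

lemma proj_compl: "P \<in> projections \<Longrightarrow> id_blinfun - P \<in> projections"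
  by (rule projectionsI)
    (auto simp: blinfun.bilinear_simps projectionsD cinner.diff_left cinner.diff_right
      intro!: bounded_ops_closed)

lemma zero_proj: "0 \<in> projections" and id_proj: "id_blinfun \<in> projections"
  by (auto intro!: projectionsI bounded_ops_closed simp: cinner.zero_left cinner.zero_right)

section \<open>Maximal flows\<close>

text \<open>Tychonoff's theorem for function spaces. Maximal flows and the interpolating families of
  forms are both found inside such compact boxes.\<close>

lemma compact_Pi_UNIV:
  fixes K :: "'i \<Rightarrow> 'b :: topological_space set"
  assumes "\<And>i. compact (K i)"
  shows "compact {f. \<forall>i. f i \<in> K i}"
proof -
  have "compactin (product_topology (\<lambda>_. euclidean) UNIV) (PiE UNIV K)"
    using assms by (simp add: compactin_PiE)
  moreover have "PiE UNIV K = {f. \<forall>i. f i \<in> K i}"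
    by auto
  ultimately show ?thesis
    by (simp add: euclidean_product_topology)
qed

lemma continuous_eval2: "continuous_on UNIV (\<lambda>f. (f :: 'u \<Rightarrow> 'v \<Rightarrow> 'c :: topological_space) x y)"
  by (rule continuous_on_product_then_coordinatewise[OF continuous_on_product_coordinates])

text \<open>Net flow is antisymmetric, so the capacities \<open>c x y\<close> and
  \<open>c y x\<close> bound \<open>f x y\<close> from both sides, and conservation at a node is the
  vanishing of one row sum.\<close>

definition flow :: "'v set \<Rightarrow> 'v \<Rightarrow> 'v \<Rightarrow> ('v \<Rightarrow> 'v \<Rightarrow> real) \<Rightarrow> ('v \<Rightarrow> 'v \<Rightarrow> real) \<Rightarrow> bool" where
  "flow V s t c f \<longleftrightarrow> (\<forall>x y. f x y = - f y x) \<and> (\<forall>x y. f x y \<le> c x y) \<and>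
     (\<forall>x\<in>V - {s, t}. (\<Sum>y\<in>V. f x y) = 0)"

lemma flowD:
  assumes "flow V s t c f"
  shows "f x y = - f y x" "f x y \<le> c x y" "x \<in> V \<Longrightarrow> x \<noteq> s \<Longrightarrow> x \<noteq> t \<Longrightarrow> (\<Sum>y\<in>V. f x y) = 0"
  using assms unfolding flow_def by blast+

text \<open>Flows form a closed subset of a compact box, since antisymmetry gives
  \<open>- c y x \<le> f x y\<close>, and the value is a continuous function of finitely many
  coordinates.\<close>

lemma max_flow_exists:
  assumes "finite V" and c: "\<And>x y. 0 \<le> c x y"
  shows "\<exists>f. flow V s t c f \<and> (\<forall>g. flow V s t c g \<longrightarrow> (\<Sum>y\<in>V. g s y) \<le> (\<Sum>y\<in>V. f s y))"
proof -
  define F where "F = {f. flow V s t c f}"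
  define K where "K = {f :: 'a \<Rightarrow> 'a \<Rightarrow> real. \<forall>x. f x \<in> {g. \<forall>y. g y \<in> {- c y x..c x y}}}"
  have "compact K"
    unfolding K_def by (intro compact_Pi_UNIV compact_Icc)
  moreover have "closed F"
  proof -
    have "F = {f. \<forall>x y. f x y = - f y x} \<inter> {f. \<forall>x y. f x y \<le> c x y} \<inter>
        {f. \<forall>x\<in>V - {s, t}. (\<Sum>y\<in>V. f x y) = 0}"
      by (auto simp: F_def flow_def)
    then show ?thesis
      by (auto intro!: closed_Int closed_Collect_all closed_Collect_imp closed_Collect_eq closed_Collect_le
          continuous_intros continuous_eval2 simp: Ball_def)
  qed
  ultimately have "compact (K \<inter> F)" by (rule compact_Int_closed)
  moreover have "F \<subseteq> K"
  proof
    fix f assume "f \<in> F"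
    then have f: "flow V s t c f" by (simp add: F_def)
    have "- c y x \<le> f x y" for x y
      using flowD(1)[OF f, of x y] flowD(2)[OF f, of y x] by linarith
    then show "f \<in> K" using flowD(2)[OF f] by (simp add: K_def)
  qed
  ultimately have "compact F" by (simp add: Int_absorb1)
  moreover have "(\<lambda>_ _. 0) \<in> F"
    by (auto simp: F_def flow_def c)
  moreover have "continuous_on F (\<lambda>f. \<Sum>y\<in>V. f s y)"
    by (intro continuous_on_sum continuous_on_subset[OF continuous_eval2]) auto
  ultimately obtain f where "f \<in> F" "\<forall>g\<in>F. (\<Sum>y\<in>V. g s y) \<le> (\<Sum>y\<in>V. f s y)"
    using continuous_attains_sup[of F "\<lambda>f. \<Sum>y\<in>V. f s y"] by blast
  then show ?thesis by (auto simp: F_def)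
qed

text \<open>The nodes reachable from \<open>s\<close> along arcs with spare capacity are all
  saturated towards the outside. They do not include \<open>t\<close>, since otherwise a small
  perturbation would raise the value of a maximal flow.\<close>

theorem max_flow_min_cut:
  assumes V: "finite V" "s \<in> V" "s \<noteq> t"
    and c: "\<And>x y. 0 \<le> c x y" "\<And>x y. x \<notin> V \<or> y \<notin> V \<Longrightarrow> c x y = 0"
  shows "\<exists>f S. flow V s t c f \<and> S \<subseteq> V \<and> s \<in> S \<and> t \<notin> S \<and>
    (\<Sum>y\<in>V. f s y) = (\<Sum>x\<in>S. \<Sum>y\<in>V - S. c x y)"
proof -
  obtain f where f: "flow V s t c f"
    and max: "\<And>g. flow V s t c g \<Longrightarrow> (\<Sum>y\<in>V. g s y) \<le> (\<Sum>y\<in>V. f s y)"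
    using max_flow_exists[OF V(1), of c s t] c by blast
  have skew: "f x y = - f y x" and cap: "f x y \<le> c x y" for x y
    by (fact flowD[OF f])+
  have cons: "(\<Sum>y\<in>V. f x y) = 0" if "x \<in> V" "x \<noteq> s" "x \<noteq> t" for x
    using flowD(3)[OF f] that by blast
  \<comment> \<open>Arcs with spare capacity. By antisymmetry the reversal of an arc that carries
    flow is among them.\<close>
  define E where "E = {(x, y). x \<in> V \<and> y \<in> V \<and> f x y < c x y}"
  define S where "S = E\<^sup>* `` {s}"
  \<comment> \<open>The directions in which the flow can be perturbed form a convex cone, so the augmenting
    path need not be simple.\<close>
  define D where "D = (\<lambda>g :: 'a \<Rightarrow> 'a \<Rightarrow> real. (\<forall>x y. g x y = - g y x) \<and>
    (\<forall>x y. x \<notin> V \<or> y \<notin> V \<longrightarrow> g x y = 0) \<and> (\<forall>x\<in>V. \<forall>y\<in>V. f x y = c x y \<longrightarrow> g x y \<le> 0))"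
  have reach: "\<exists>g. D g \<and> (\<forall>x\<in>V. (\<Sum>y\<in>V. g x y) = of_bool (x = s) - of_bool (x = z))"
    if "(s, z) \<in> E\<^sup>*" for z
    using that
  proof induction
    case base
    show ?case by (intro exI[of _ "\<lambda>_ _. 0"]) (auto simp: D_def)
  next
    case (step y z)
    then obtain g where g: "D g" "\<And>x. x \<in> V \<Longrightarrow> (\<Sum>w\<in>V. g x w) = of_bool (x = s) - of_bool (x = y)"
      by blast
    have yz: "y \<in> V" "z \<in> V" "f y z < c y z" using step by (auto simp: E_def)
    \<comment> \<open>One more unit along the arc from \<open>y\<close> to \<open>z\<close> moves
      the endpoint of the perturbation from \<open>y\<close> to \<open>z\<close>.\<close>
    define h where "h = (\<lambda>a b. g a b + (of_bool (a = y \<and> b = z) - of_bool (a = z \<and> b = y)))"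
    have gs: "g a b = - g b a" and g0: "a \<notin> V \<or> b \<notin> V \<Longrightarrow> g a b = 0"
      and gc: "a \<in> V \<Longrightarrow> b \<in> V \<Longrightarrow> f a b = c a b \<Longrightarrow> g a b \<le> 0" for a b
      using g(1) unfolding D_def by blast+
    have "D h"
      unfolding D_def
    proof (intro conjI allI ballI impI)
      fix a b show "h a b = - h b a" unfolding h_def using gs[of a b] by (simp add: conj_commute)
    next
      fix a b assume "a \<notin> V \<or> b \<notin> V"
      then show "h a b = 0" using g0 yz by (auto simp: h_def)
    next
      fix a b assume ab: "a \<in> V" "b \<in> V" "f a b = c a b"
      then have "g a b \<le> 0" by (rule gc)
      moreover have "of_bool (a = y \<and> b = z) = (0 :: real)" using ab yz by auto
      moreover have "(0 :: real) \<le> of_bool (a = z \<and> b = y)" by simp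
      ultimately show "h a b \<le> 0" unfolding h_def by linarith
    qed
    moreover have "(\<Sum>w\<in>V. h x w) = of_bool (x = s) - of_bool (x = z)" if "x \<in> V" for x
    proof -
      have "(\<Sum>w\<in>V. h x w) = (of_bool (x = s) - of_bool (x = y)) +
        ((\<Sum>w\<in>V. of_bool (x = y \<and> w = z)) - (\<Sum>w\<in>V. of_bool (x = z \<and> w = y)))"
        by (simp add: h_def sum.distrib sum_subtractf g(2)[OF that])
      also have "(\<Sum>w\<in>V. of_bool (x = y \<and> w = z)) = (of_bool (x = y) :: real)"
        using V(1) yz by (cases "x = y") (simp_all add: of_bool_def sum.delta)
      also have "(\<Sum>w\<in>V. of_bool (x = z \<and> w = y)) = (of_bool (x = z) :: real)"
        using V(1) yz by (cases "x = z") (simp_all add: of_bool_def sum.delta)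
      finally show ?thesis by simp
    qed
    ultimately show ?case by blast
  qed
  have sub: "S \<subseteq> V"
  proof
    fix z assume "z \<in> S"
    then have "(s, z) \<in> E\<^sup>*" by (simp add: S_def)
    then show "z \<in> V" using V(2) by cases (auto simp: E_def)
  qed
  have "t \<notin> S"
  proof
    assume tS: "t \<in> S"
    then obtain g where g: "D g" "\<And>x. x \<in> V \<Longrightarrow> (\<Sum>w\<in>V. g x w) = of_bool (x = s) - of_bool (x = t)"
      using reach unfolding S_def by blast
    have gs: "g a b = - g b a" and g0: "a \<notin> V \<or> b \<notin> V \<Longrightarrow> g a b = 0"
      and gc: "a \<in> V \<Longrightarrow> b \<in> V \<Longrightarrow> f a b = c a b \<Longrightarrow> g a b \<le> 0" for a b
      using g(1) unfolding D_def by blast+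
    \<comment> \<open>Saturated arcs do not increase in the direction \<open>g\<close> and all
      others have slack. Finitely many arcs allow one positive step size for all of them.\<close>
    have "\<forall>p\<in>V \<times> V. eventually (\<lambda>d. f (fst p) (snd p) + d * g (fst p) (snd p) \<le> c (fst p) (snd p)) (at_right 0)"
    proof
      fix p assume p: "p \<in> V \<times> V"
      obtain x y where xy: "p = (x, y)" by force
      show "eventually (\<lambda>d. f (fst p) (snd p) + d * g (fst p) (snd p) \<le> c (fst p) (snd p)) (at_right 0)"
      proof (cases "f x y = c x y")
        case True
        then have "g x y \<le> 0" using gc p xy by simp
        then show ?thesis
          using True xy eventually_at_right_less[of "0::real"]
          by (auto elim!: eventually_mono simp: mult_nonneg_nonpos)
      next
        case False
        have "((\<lambda>d. f x y + d * g x y) \<longlongrightarrow> f x y + 0 * g x y) (at_right 0)"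
          by (intro tendsto_intros)
        then have "eventually (\<lambda>d. f x y + d * g x y < c x y) (at_right 0)"
          using False cap[of x y] by (intro order_tendstoD) auto
        then show ?thesis using xy by (auto elim!: eventually_mono)
      qed
    qed
    then have "eventually (\<lambda>d. \<forall>p\<in>V \<times> V. f (fst p) (snd p) + d * g (fst p) (snd p) \<le> c (fst p) (snd p)) (at_right 0)"
      using V(1) by (intro eventually_ball_finite) auto
    then have "eventually (\<lambda>d. 0 < d \<and> (\<forall>p\<in>V \<times> V. f (fst p) (snd p) + d * g (fst p) (snd p) \<le> c (fst p) (snd p))) (at_right (0::real))"
      using eventually_at_right_less[of "0::real"] by eventually_elim auto
    then obtain d :: real where d: "d > 0"
      "\<forall>p\<in>V \<times> V. f (fst p) (snd p) + d * g (fst p) (snd p) \<le> c (fst p) (snd p)"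
      using eventually_happens'[OF trivial_limit_at_right_real] by blast
    define h where "h = (\<lambda>x y. f x y + d * g x y)"
    have hs: "(\<Sum>y\<in>V. h x y) = (\<Sum>y\<in>V. f x y) + d * (of_bool (x = s) - of_bool (x = t))" if "x \<in> V" for x
      by (simp add: h_def sum.distrib sum_distrib_left[symmetric] g(2)[OF that])
    have "flow V s t c h"
      unfolding flow_def
    proof (intro conjI allI ballI)
      fix x y
      show "h x y = - h y x" using skew[of x y] gs[of x y] by (simp add: h_def)
      show "h x y \<le> c x y"
      proof (cases "x \<in> V \<and> y \<in> V")
        case False
        then have "g x y = 0" using g0 by blast
        then show ?thesis using cap by (simp add: h_def)
      qed (use d in \<open>auto simp: h_def\<close>)
    qed (use hs cons in auto)
    then have "(\<Sum>y\<in>V. h s y) \<le> (\<Sum>y\<in>V. f s y)" by (rule max)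
    then show False using hs[OF V(2)] d V(3) by simp
  qed
  have sS: "s \<in> S" by (simp add: S_def)
  \<comment> \<open>By conservation only \<open>s\<close> contributes to the net outflow of
    \<open>S\<close>; the flow inside \<open>S\<close> then cancels by antisymmetry.\<close>
  have "(\<Sum>y\<in>V. f s y) = (\<Sum>x\<in>S. \<Sum>y\<in>V. f x y)"
  proof -
    have "(\<Sum>x\<in>S. \<Sum>y\<in>V. f x y) = (\<Sum>x\<in>{s}. \<Sum>y\<in>V. f x y)"
    proof (rule sum.mono_neutral_right)
      show "finite S" using sub V(1) finite_subset by blast
      show "\<forall>i\<in>S - {s}. (\<Sum>y\<in>V. f i y) = 0" using cons sub \<open>t \<notin> S\<close> by blast
    qed (use sS in auto)
    then show ?thesis by simp
  qed
  also have "\<dots> = (\<Sum>x\<in>S. (\<Sum>y\<in>V - S. f x y) + (\<Sum>y\<in>S. f x y))"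
    using sub V(1) by (intro sum.cong refl sum.subset_diff) auto
  also have "\<dots> = (\<Sum>x\<in>S. \<Sum>y\<in>V - S. f x y) + (\<Sum>x\<in>S. \<Sum>y\<in>S. f x y)"
    by (rule sum.distrib)
  also have "(\<Sum>x\<in>S. \<Sum>y\<in>S. f x y) = 0"
  proof -
    have "(\<Sum>x\<in>S. \<Sum>y\<in>S. f x y) = (\<Sum>y\<in>S. \<Sum>x\<in>S. f x y)" by (rule sum.swap)
    also have "\<dots> = (\<Sum>y\<in>S. \<Sum>x\<in>S. - f y x)" by (intro sum.cong refl skew)
    also have "\<dots> = - (\<Sum>x\<in>S. \<Sum>y\<in>S. f x y)" by (simp add: sum_negf)
    finally show ?thesis by simp
  qed
  also have "(\<Sum>x\<in>S. \<Sum>y\<in>V - S. f x y) = (\<Sum>x\<in>S. \<Sum>y\<in>V - S. c x y)"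
  proof (intro sum.cong refl)
    fix x y assume xy: "x \<in> S" "y \<in> V - S"
    show "f x y = c x y"
    proof (rule ccontr)
      assume "f x y \<noteq> c x y"
      then have "(x, y) \<in> E" using xy sub cap[of x y] by (auto simp: E_def)
      then have "y \<in> S" using xy by (auto simp: S_def intro: rtrancl_into_rtrancl)
      then show False using xy by simp
    qed
  qed
  finally show ?thesis
    using f sub sS \<open>t \<notin> S\<close> by (intro exI[of _ f] exI[of _ S]) simp
qed

section \<open>Transport through stations of bounded capacity\<close>

datatype 'i node = Source | Sink | Supply 'i | Entry 'i | Exit 'i | Demand 'i

text \<open>The layers run from \<open>Source\<close> through \<open>Supply\<close>,
  \<open>Entry\<close>, \<open>Exit\<close> and \<open>Demand\<close> to \<open>Sink\<close>. A
  station is split into an entry and an exit so that its capacity becomes that of an arc;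
  \<open>K\<close> plays the role of infinity.\<close>

primrec arc_cap :: "'i set \<Rightarrow> ('i \<Rightarrow> 'i \<Rightarrow> bool) \<Rightarrow> ('i \<Rightarrow> 'i \<Rightarrow> bool) \<Rightarrow> ('i \<Rightarrow> real) \<Rightarrow> ('i \<Rightarrow> real) \<Rightarrow>
    ('i \<Rightarrow> real) \<Rightarrow> real \<Rightarrow> 'i node \<Rightarrow> 'i node \<Rightarrow> real" where
  "arc_cap J r r' a b d K Source y = (case y of Supply i \<Rightarrow> of_bool (i \<in> J) * a i | _ \<Rightarrow> 0)"
| "arc_cap J r r' a b d K Sink y = 0"
| "arc_cap J r r' a b d K (Supply i) y =
     (case y of Entry j \<Rightarrow> of_bool (i \<in> J \<and> j \<in> J \<and> r i j) * K | _ \<Rightarrow> 0)"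
| "arc_cap J r r' a b d K (Entry j) y = (case y of Exit k \<Rightarrow> of_bool (j \<in> J \<and> k = j) * b j | _ \<Rightarrow> 0)"
| "arc_cap J r r' a b d K (Exit j) y =
     (case y of Demand i \<Rightarrow> of_bool (i \<in> J \<and> j \<in> J \<and> r' j i) * K | _ \<Rightarrow> 0)"
| "arc_cap J r r' a b d K (Demand i) y = (case y of Sink \<Rightarrow> of_bool (i \<in> J) * d i | _ \<Rightarrow> 0)"

text \<open>Transport from supplies \<open>a\<close> along \<open>r\<close> through intermediate stations of capacity \<open>b\<close>, and on
  along \<open>r'\<close> to demands \<open>d\<close>.\<close>

lemma layered_transport:
  fixes a b d :: "'i \<Rightarrow> real"
  assumes J: "finite J" and a: "\<And>i. 0 \<le> a i" and b: "\<And>i. 0 \<le> b i" and d: "\<And>i. 0 \<le> d i"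
  obtains p q A B B' C where
    "\<And>i j. 0 \<le> p i j" "\<And>i j. p i j \<noteq> 0 \<Longrightarrow> i \<in> J \<and> j \<in> J \<and> r i j"
    "\<And>j i. 0 \<le> q j i" "\<And>j i. q j i \<noteq> 0 \<Longrightarrow> i \<in> J \<and> j \<in> J \<and> r' j i"
    "\<And>i. i \<in> J \<Longrightarrow> (\<Sum>j\<in>J. p i j) \<le> a i"
    "\<And>j. j \<in> J \<Longrightarrow> (\<Sum>i\<in>J. p i j) = (\<Sum>i\<in>J. q j i)"
    "\<And>j. j \<in> J \<Longrightarrow> (\<Sum>i\<in>J. p i j) \<le> b j"
    "\<And>i. i \<in> J \<Longrightarrow> (\<Sum>j\<in>J. q j i) \<le> d i"
    "A \<subseteq> J" "B \<subseteq> J" "B' \<subseteq> J" "C \<subseteq> J"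
    "\<And>i j. i \<in> A \<Longrightarrow> j \<in> J \<Longrightarrow> r i j \<Longrightarrow> j \<in> B"
    "\<And>j i. j \<in> B' \<Longrightarrow> i \<in> J \<Longrightarrow> r' j i \<Longrightarrow> i \<in> C"
    "sum a (J - A) + sum b (B - B') + sum d C \<le> (\<Sum>i\<in>J. \<Sum>j\<in>J. p i j)"
proof -
  \<comment> \<open>Larger than any flow value, so no arc of capacity \<open>K\<close> crosses the
    cut. This yields the two closure properties of the sets \<open>A\<close>, \<open>B\<close>,
    \<open>B'\<close>, \<open>C\<close>.\<close>
  define K where "K = sum a J + 1"
  have K: "K > 0" "K > sum a J" using a by (auto simp: K_def add_nonneg_pos sum_nonneg)
  define c where "c = arc_cap J r r' a b d K"
  define V where "V = {Source, Sink} \<union> Supply ` J \<union> Entry ` J \<union> Exit ` J \<union> Demand ` J"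
  have sumV: "sum g V = g Source + g Sink + (\<Sum>i\<in>J. g (Supply i)) + (\<Sum>i\<in>J. g (Entry i)) +
      (\<Sum>i\<in>J. g (Exit i)) + (\<Sum>i\<in>J. g (Demand i))" for g :: "'i node \<Rightarrow> real"
  proof -
    have "sum g V = sum g {Source, Sink} + sum g (Supply ` J) + sum g (Entry ` J) + sum g (Exit ` J) +
        sum g (Demand ` J)"
      unfolding V_def using J by (subst sum.union_disjoint, (auto)[3])+ (rule refl)
    then show ?thesis by (simp add: sum.reindex inj_on_def)
  qed
  have cpos: "0 \<le> c x y" for x y
    using a b d K by (cases x; cases y) (auto simp: c_def)
  have c0: "c x y = 0" if "x \<notin> V \<or> y \<notin> V" for x y
    using that by (cases x; cases y) (auto simp: c_def V_def)
  obtain f S where f: "flow V Source Sink c f" and S: "S \<subseteq> V" "Source \<in> S" "Sink \<notin> S"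
    and val: "(\<Sum>y\<in>V. f Source y) = (\<Sum>x\<in>S. \<Sum>y\<in>V - S. c x y)"
    using max_flow_min_cut[of V Source Sink c] cpos c0 J by (auto simp: V_def)
  have skew: "f x y = - f y x" and cap: "f x y \<le> c x y" for x y
    by (fact flowD[OF f])+
  have cons: "(\<Sum>y\<in>V. f x y) = 0" if "x \<in> V" "x \<noteq> Source" "x \<noteq> Sink" for x
    using flowD(3)[OF f] that by blast
  have nn: "0 \<le> f x y" if "c y x = 0" for x y
    using skew[of x y] cap[of y x] that by simp
  \<comment> \<open>A pair of nodes without capacity in either direction carries no flow, which
    reduces every conservation law to the two neighbouring layers.\<close>
  have z: "f x y = 0" if "c x y = 0" "c y x = 0" for x y
    using nn[OF that(2)] cap[of x y] that(1) by simp
  define p where "p = (\<lambda>i j. f (Supply i) (Entry j))"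
  define q where "q = (\<lambda>j i. f (Exit j) (Demand i))"
  have sup_sum: "(\<Sum>j\<in>J. p i j) = f Source (Supply i)" if "i \<in> J" for i
  proof -
    have "(\<Sum>y\<in>V. f (Supply i) y) = 0" using cons that by (auto simp: V_def)
    moreover have "f (Supply i) Sink = 0" "f (Supply i) (Supply j) = 0" "f (Supply i) (Exit j) = 0"
      "f (Supply i) (Demand j) = 0" for j by (auto intro!: z simp: c_def)
    ultimately show ?thesis
      using skew[of Source "Supply i"] by (simp add: sumV p_def)
  qed
  have ent_sum: "(\<Sum>i\<in>J. p i j) = f (Entry j) (Exit j)" if "j \<in> J" for j
  proof -
    have "(\<Sum>y\<in>V. f (Entry j) y) = 0" using cons that by (auto simp: V_def)
    moreover have "f (Entry j) Sink = 0" "f (Entry j) (Entry i) = 0" "f (Entry j) Source = 0"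
      "f (Entry j) (Demand i) = 0" for i by (auto intro!: z simp: c_def)
    moreover have "(\<Sum>i\<in>J. f (Entry j) (Supply i)) = - (\<Sum>i\<in>J. p i j)"
      unfolding p_def sum_negf[symmetric] by (intro sum.cong refl skew)
    moreover have "(\<Sum>i\<in>J. f (Entry j) (Exit i)) = f (Entry j) (Exit j)"
    proof -
      have "(\<Sum>i\<in>J. f (Entry j) (Exit i)) = (\<Sum>i\<in>{j}. f (Entry j) (Exit i))"
        using J that by (intro sum.mono_neutral_right) (auto intro!: z simp: c_def)
      then show ?thesis by simp
    qed
    ultimately show ?thesis by (simp add: sumV)
  qed
  have exi_sum: "(\<Sum>i\<in>J. q j i) = f (Entry j) (Exit j)" if "j \<in> J" for j
  proof -
    have "(\<Sum>y\<in>V. f (Exit j) y) = 0" using cons that by (auto simp: V_def)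
    moreover have "f (Exit j) Sink = 0" "f (Exit j) (Exit i) = 0" "f (Exit j) Source = 0"
      "f (Exit j) (Supply i) = 0" for i by (auto intro!: z simp: c_def)
    moreover have "(\<Sum>i\<in>J. f (Exit j) (Entry i)) = f (Exit j) (Entry j)"
    proof -
      have "(\<Sum>i\<in>J. f (Exit j) (Entry i)) = (\<Sum>i\<in>{j}. f (Exit j) (Entry i))"
        using J that by (intro sum.mono_neutral_right) (auto intro!: z simp: c_def)
      then show ?thesis by simp
    qed
    ultimately show ?thesis using skew[of "Exit j" "Entry j"] by (simp add: sumV q_def)
  qed
  have dem_sum: "(\<Sum>j\<in>J. q j i) = f (Demand i) Sink" if "i \<in> J" for i
  proof -
    have "(\<Sum>y\<in>V. f (Demand i) y) = 0" using cons that by (auto simp: V_def)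
    moreover have "f (Demand i) Source = 0" "f (Demand i) (Supply j) = 0" "f (Demand i) (Entry j) = 0"
      "f (Demand i) (Demand j) = 0" for j by (auto intro!: z simp: c_def)
    moreover have "(\<Sum>j\<in>J. f (Demand i) (Exit j)) = - (\<Sum>j\<in>J. q j i)"
      unfolding q_def sum_negf[symmetric] by (intro sum.cong refl skew)
    ultimately show ?thesis by (simp add: sumV)
  qed
  have total: "(\<Sum>y\<in>V. f Source y) = (\<Sum>i\<in>J. \<Sum>j\<in>J. p i j)"
  proof -
    have "f Source Sink = 0" "f Source Source = 0" "f Source (Entry j) = 0" "f Source (Exit j) = 0"
      "f Source (Demand j) = 0" for j by (auto intro!: z simp: c_def)
    then show ?thesis by (simp add: sumV sup_sum)
  qed
  have finV: "finite V" using J by (simp add: V_def)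
  have finS: "finite S" using S(1) finV finite_subset by blast
  have nocross: "c x y < K" if "x \<in> S" "y \<in> V - S" for x y
  proof -
    have "(\<Sum>i\<in>J. \<Sum>j\<in>J. p i j) \<le> sum a J"
    proof (rule sum_mono)
      fix i assume "i \<in> J"
      then show "(\<Sum>j\<in>J. p i j) \<le> a i"
        using sup_sum cap[of Source "Supply i"] by (simp add: c_def)
    qed
    moreover have "c x y \<le> (\<Sum>y\<in>V - S. c x y)"
      using that finV cpos by (intro member_le_sum) auto
    moreover have "(\<Sum>y\<in>V - S. c x y) \<le> (\<Sum>x\<in>S. \<Sum>y\<in>V - S. c x y)"
      using that finS cpos by (intro member_le_sum[where f = "\<lambda>x. \<Sum>y\<in>V - S. c x y"] sum_nonneg) auto
    ultimately show ?thesis using val total K by linarith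
  qed
  \<comment> \<open>The traces of the source side on the four layers.\<close>
  define A where "A = {i\<in>J. Supply i \<in> S}"
  define B where "B = {i\<in>J. Entry i \<in> S}"
  define B' where "B' = {i\<in>J. Exit i \<in> S}"
  define C where "C = {i\<in>J. Demand i \<in> S}"
  have cut: "sum a (J - A) + sum b (B - B') + sum d C \<le> (\<Sum>i\<in>J. \<Sum>j\<in>J. p i j)"
  proof -
    \<comment> \<open>Three disjoint families of arcs that cross the cut; whatever else crosses it
      has nonnegative capacity.\<close>
    define X :: "('i node \<times> 'i node) set" where "X = (\<lambda>i. (Source, Supply i)) ` (J - A)"
    define Y where "Y = (\<lambda>i. (Entry i, Exit i)) ` (B - B')"
    define Z :: "('i node \<times> 'i node) set" where "Z = (\<lambda>i. (Demand i, Sink)) ` C"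
    have fin: "finite X" "finite Y" "finite Z"
      using J by (auto simp: X_def Y_def Z_def B_def C_def)
    have "sum a (J - A) + sum b (B - B') + sum d C = sum (\<lambda>(x, y). c x y) (X \<union> Y \<union> Z)"
    proof -
      have "sum (\<lambda>(x, y). c x y) (X \<union> Y \<union> Z) =
          sum (\<lambda>(x, y). c x y) X + sum (\<lambda>(x, y). c x y) Y + sum (\<lambda>(x, y). c x y) Z"
        using fin by (subst sum.union_disjoint, (auto simp: X_def Y_def Z_def)[3])+ (rule refl)
      also have "sum (\<lambda>(x, y). c x y) X = sum a (J - A)"
        unfolding X_def by (subst sum.reindex) (auto simp: inj_on_def c_def intro!: sum.cong)
      also have "sum (\<lambda>(x, y). c x y) Y = sum b (B - B')"
        unfolding Y_def by (subst sum.reindex) (auto simp: inj_on_def c_def B_def intro!: sum.cong)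
      also have "sum (\<lambda>(x, y). c x y) Z = sum d C"
        unfolding Z_def by (subst sum.reindex) (auto simp: inj_on_def c_def C_def intro!: sum.cong)
      finally show ?thesis by simp
    qed
    also have "\<dots> \<le> sum (\<lambda>(x, y). c x y) (S \<times> (V - S))"
    proof (rule sum_mono2)
      show "finite (S \<times> (V - S))" using finS finV by simp
      show "X \<union> Y \<union> Z \<subseteq> S \<times> (V - S)"
        using S by (auto simp: X_def Y_def Z_def A_def B_def B'_def C_def V_def)
    qed (use cpos in auto)
    also have "\<dots> = (\<Sum>i\<in>J. \<Sum>j\<in>J. p i j)"
      using val total by (simp add: sum.cartesian_product)
    finally show ?thesis .
  qed
  show ?thesis
  proof (rule that[of p q A B B' C])
    show "i \<in> J \<and> j \<in> J \<and> r i j" if "p i j \<noteq> 0" for i j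
      using that z[of "Supply i" "Entry j"] by (auto simp: p_def c_def)
    show "i \<in> J \<and> j \<in> J \<and> r' j i" if "q j i \<noteq> 0" for i j
      using that z[of "Exit j" "Demand i"] by (auto simp: q_def c_def)
    show "(\<Sum>j\<in>J. p i j) \<le> a i" if "i \<in> J" for i
      using cap[of Source "Supply i"] that by (simp add: sup_sum c_def)
    show "(\<Sum>i\<in>J. p i j) \<le> b j" if "j \<in> J" for j
      using cap[of "Entry j" "Exit j"] that by (simp add: ent_sum c_def)
    show "(\<Sum>j\<in>J. q j i) \<le> d i" if "i \<in> J" for i
      using cap[of "Demand i" Sink] that by (simp add: dem_sum c_def)
    show "j \<in> B" if "i \<in> A" "j \<in> J" "r i j" for i j
      using nocross[of "Supply i" "Entry j"] that by (auto simp: A_def B_def V_def c_def)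
    show "i \<in> C" if "j \<in> B'" "i \<in> J" "r' j i" for i j
      using nocross[of "Exit j" "Demand i"] that by (auto simp: C_def B'_def V_def c_def)
  qed (use cut in \<open>auto simp: p_def q_def c_def A_def B_def B'_def C_def ent_sum[unfolded p_def]
      exi_sum[unfolded q_def] intro!: nn\<close>)
qed

section \<open>Finite families of commuting projections\<close>

definition cproj :: "('a::complex_hilbert \<Rightarrow>\<^sub>L 'a) set \<Rightarrow> bool" where
  "cproj S \<longleftrightarrow> S \<subseteq> projections \<and> (\<forall>P\<in>S. \<forall>Q\<in>S. P o\<^sub>L Q = Q o\<^sub>L P)"

lemma cprojD: "cproj S \<Longrightarrow> P \<in> S \<Longrightarrow> P \<in> projections"
  by (auto simp: cproj_def)

lemma cproj_commute: "cproj S \<Longrightarrow> P \<in> S \<Longrightarrow> Q \<in> S \<Longrightarrow> P \<cdot> Q \<cdot> x = Q \<cdot> P \<cdot> x"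
  by (metis blinfun_apply_blinfun_compose cproj_def)

lemma cproj_subset: "cproj S \<Longrightarrow> T \<subseteq> S \<Longrightarrow> cproj T"
  by (auto simp: cproj_def)

lemma proj_prod:
  assumes "P \<in> projections" "Q \<in> projections" "\<And>x. P \<cdot> Q \<cdot> x = Q \<cdot> P \<cdot> x"
  shows "P o\<^sub>L Q \<in> projections"
  using assms by (intro projectionsI) (auto simp: projectionsD intro!: bounded_ops_closed)

text \<open>The pieces of the Boolean algebra generated by the list, one for each sign pattern; a
  piece may be zero. Since \<open>hd\<close> and \<open>tl\<close> mean nothing on patterns that are
  too short, the index set is always \<open>bits\<close> of the length of the list.\<close>

primrec atom :: "('a::complex_hilbert \<Rightarrow>\<^sub>L 'a) list \<Rightarrow> bool list \<Rightarrow> ('a \<Rightarrow>\<^sub>L 'a)" where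
  "atom [] s = id_blinfun"
| "atom (P # Ps) s = (if hd s then P else id_blinfun - P) o\<^sub>L atom Ps (tl s)"

definition bits :: "nat \<Rightarrow> bool list set" where
  "bits n = {s. length s = n}"

lemma finite_bits [simp]: "finite (bits n)"
  using finite_lists_length_eq[of "UNIV :: bool set" n] by (simp add: bits_def)

lemma bits_0: "bits 0 = {[]}"
  by (auto simp: bits_def)

lemma bits_Suc: "bits (Suc n) = (\<lambda>s. True # s) ` bits n \<union> (\<lambda>s. False # s) ` bits n"
proof -
  have "s \<in> (\<lambda>s. True # s) ` bits n \<union> (\<lambda>s. False # s) ` bits n" if "s \<in> bits (Suc n)" for s
    using that by (cases s; cases "hd s") (auto simp: bits_def)
  then show ?thesis by (auto simp: bits_def)
qed

lemma sum_bits_Suc: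
  assumes "A \<subseteq> bits (Suc n)"
  shows "(\<Sum>s\<in>A. g s) = (\<Sum>s | s \<in> bits n \<and> True # s \<in> A. g (True # s)) +
    (\<Sum>s | s \<in> bits n \<and> False # s \<in> A. g (False # s :: bool list) :: 'c :: comm_monoid_add)"
proof -
  have A: "A = (\<lambda>s. True # s) ` {s \<in> bits n. True # s \<in> A} \<union> (\<lambda>s. False # s) ` {s \<in> bits n. False # s \<in> A}"
    (is "A = ?X \<union> ?Y") using assms by (auto simp: bits_Suc)
  have "sum g A = sum g ?X + sum g ?Y"
    by (subst A, rule sum.union_disjoint) auto
  then show ?thesis by (simp add: sum.reindex inj_on_def)
qed

lemma sum_blinfun_apply: "(\<Sum>i\<in>I. T i) \<cdot> x = (\<Sum>i\<in>I. T i \<cdot> x)"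
  by (induction I rule: infinite_finite_induct) (auto simp: blinfun.bilinear_simps)

lemma atom_commute:
  assumes "\<And>P x. P \<in> set Ps \<Longrightarrow> R \<cdot> P \<cdot> x = P \<cdot> R \<cdot> x"
  shows "R \<cdot> atom Ps s \<cdot> x = atom Ps s \<cdot> R \<cdot> x"
  using assms by (induction Ps arbitrary: s x) (auto simp: blinfun.bilinear_simps)

lemma atom_proj:
  assumes "cproj (set Ps)"
  shows "atom Ps s \<in> projections"
  using assms
proof (induction Ps arbitrary: s)
  case (Cons P Ps)
  have P: "P \<in> projections" using Cons.prems by (auto simp: cproj_def)
  have a: "atom Ps (tl s) \<in> projections"
    using Cons cproj_subset by (metis set_subset_Cons)
  have c: "P \<cdot> atom Ps (tl s) \<cdot> x = atom Ps (tl s) \<cdot> P \<cdot> x" for x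
    by (rule atom_commute) (use cproj_commute[OF Cons.prems] in auto)
  show ?case
    using proj_prod[OF P a c] proj_prod[OF proj_compl[OF P] a]
    by (auto simp: blinfun.bilinear_simps c)
qed (simp add: id_proj)

lemma atom_in:
  assumes "cproj (set Ps)" "i < length Ps" "s \<in> bits (length Ps)"
  shows "(Ps ! i) \<cdot> atom Ps s \<cdot> x = (if s ! i then atom Ps s \<cdot> x else 0)"
  using assms
proof (induction Ps arbitrary: i s x)
  case (Cons P Ps)
  obtain b t where s: "s = b # t" "t \<in> bits (length Ps)"
    using Cons.prems(3) by (cases s) (auto simp: bits_def)
  have P: "P \<in> projections" using Cons.prems by (auto simp: cproj_def)
  have sub: "cproj (set Ps)" using Cons.prems cproj_subset by (metis set_subset_Cons)
  show ?case
  proof (cases i)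
    case 0
    then show ?thesis by (simp add: s blinfun.bilinear_simps projectionsD(2)[OF P])
  next
    case (Suc j)
    have "(Ps ! j) \<cdot> P \<cdot> y = P \<cdot> (Ps ! j) \<cdot> y" for y
      using Cons.prems Suc by (intro cproj_commute[OF Cons.prems(1)]) auto
    then show ?thesis
      using Cons.IH[OF sub, of j t x] Suc s Cons.prems by (auto simp: blinfun.bilinear_simps)
  qed
qed simp

lemma atom_mem:
  assumes "cproj (set Ps)" "P \<in> set Ps" "s \<in> bits (length Ps)"
  shows "P \<cdot> atom Ps s \<cdot> x = atom Ps s \<cdot> x \<or> P \<cdot> atom Ps s \<cdot> x = 0"
  using atom_in[OF assms(1) _ assms(3)] assms(2) by (metis in_set_conv_nth)

text \<open>Where two patterns differ, one atom lies below the projection at that position and the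
  other below its complement.\<close>

lemma atom_orthogonal:
  assumes "cproj (set Ps)" "s \<in> bits (length Ps)" "t \<in> bits (length Ps)" "s \<noteq> t"
  shows "atom Ps s \<cdot> atom Ps t \<cdot> x = 0"
proof -
  obtain i where i: "i < length Ps" "s ! i \<noteq> t ! i"
    using assms nth_equalityI[of s t] by (auto simp: bits_def)
  have P: "Ps ! i \<in> set Ps" using i by simp
  have c: "(Ps ! i) \<cdot> atom Ps s \<cdot> y = atom Ps s \<cdot> (Ps ! i) \<cdot> y" for y
    by (rule atom_commute) (use cproj_commute[OF assms(1)] i in auto)
  have s: "(Ps ! i) \<cdot> atom Ps s \<cdot> y = (if s ! i then atom Ps s \<cdot> y else 0)" for y
    by (rule atom_in[OF assms(1) i(1) assms(2)])
  have t: "(Ps ! i) \<cdot> atom Ps t \<cdot> y = (if t ! i then atom Ps t \<cdot> y else 0)" for y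
    by (rule atom_in[OF assms(1) i(1) assms(3)])
  show ?thesis
    using c[of "atom Ps t \<cdot> x"] s[of "atom Ps t \<cdot> x"] t[of x] i(2)
    by (cases "s ! i"; cases "t ! i") (auto simp: blinfun.bilinear_simps)
qed

lemma sum_atoms: "(\<Sum>s\<in>bits (length Ps). atom Ps s \<cdot> x) = x"
proof (induction Ps arbitrary: x)
  case (Cons P Ps)
  have "(\<Sum>s\<in>bits (length (P # Ps)). atom (P # Ps) s \<cdot> x) =
      (\<Sum>s\<in>bits (length Ps). P \<cdot> atom Ps s \<cdot> x) + (\<Sum>s\<in>bits (length Ps). (id_blinfun - P) \<cdot> atom Ps s \<cdot> x)"
    by (subst sum_bits_Suc[of _ "length Ps"]) (simp_all add: bits_def)
  also have "\<dots> = (\<Sum>s\<in>bits (length Ps). atom Ps s \<cdot> x)"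
    by (simp add: sum.distrib[symmetric] blinfun.bilinear_simps)
  finally show ?case using Cons by simp
qed (simp add: bits_0)

lemma cinner_atoms:
  assumes "cproj (set Ps)" "s \<in> bits (length Ps)" "t \<in> bits (length Ps)" "s \<noteq> t"
  shows "cinner (atom Ps s \<cdot> x) (atom Ps t \<cdot> y) = 0"
  using projectionsD(3)[OF atom_proj[OF assms(1)]] atom_orthogonal[OF assms]
  by (metis cinner.zero_right)

lemma norm_sum_atoms:
  assumes "cproj (set Ps)" "A \<subseteq> bits (length Ps)"
  shows "(norm (\<Sum>s\<in>A. atom Ps s \<cdot> x))\<^sup>2 = (\<Sum>s\<in>A. (norm (atom Ps s \<cdot> x))\<^sup>2)"
  by (rule norm_sum_orthogonal)
    (use assms in \<open>auto intro!: cinner_atoms intro: finite_subset[OF _ finite_bits]\<close>)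

lemma norm_atoms:
  assumes "cproj (set Ps)"
  shows "(\<Sum>s\<in>bits (length Ps). (norm (atom Ps s \<cdot> x))\<^sup>2) = (norm x)\<^sup>2"
  using norm_sum_atoms[OF assms order_refl, of x] by (simp add: sum_atoms)

lemma sum_atoms_mult:
  assumes "cproj (set Ps)" "A \<subseteq> A'" "A' \<subseteq> bits (length Ps)"
  shows "(\<Sum>s\<in>A'. atom Ps s) \<cdot> (\<Sum>s\<in>A. atom Ps s) \<cdot> x = (\<Sum>s\<in>A. atom Ps s) \<cdot> x"
proof -
  have fin: "finite A'" using assms(3) by (rule finite_subset) simp
  have "(\<Sum>s\<in>A'. atom Ps s) \<cdot> atom Ps t \<cdot> x = atom Ps t \<cdot> x" if "t \<in> A" for t
  proof -
    have "(\<Sum>s\<in>A'. atom Ps s \<cdot> atom Ps t \<cdot> x) = (\<Sum>s\<in>{t}. atom Ps s \<cdot> atom Ps t \<cdot> x)"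
      by (rule sum.mono_neutral_right) (use fin that assms in \<open>auto intro!: atom_orthogonal\<close>)
    then show ?thesis
      using projectionsD(2)[OF atom_proj[OF assms(1)]] by (simp add: sum_blinfun_apply)
  qed
  then show ?thesis
    by (simp add: sum_blinfun_apply blinfun.sum_right)
qed

section \<open>Homomorphisms between lattices of commuting projections\<close>

text \<open>For commuting projections the meet is the product and the join is
  \<open>P + Q - (P o\<^sub>L Q)\<close>. Only finite operations occur here, because all
  constructions start on finite sublattices.\<close>

locale lat_hom =
  fixes L :: "('a::complex_hilbert \<Rightarrow>\<^sub>L 'a) set" and f :: "('a \<Rightarrow>\<^sub>L 'a) \<Rightarrow> ('b::complex_hilbert \<Rightarrow>\<^sub>L 'b)"
  assumes cproj_L: "cproj L" and cproj_fL: "cproj (f ` L)"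
    and zero: "0 \<in> L" "f 0 = 0" and one: "id_blinfun \<in> L" "f id_blinfun = id_blinfun"
    and meet: "\<And>P Q. P \<in> L \<Longrightarrow> Q \<in> L \<Longrightarrow> P o\<^sub>L Q \<in> L"
      "\<And>P Q. P \<in> L \<Longrightarrow> Q \<in> L \<Longrightarrow> f (P o\<^sub>L Q) = f P o\<^sub>L f Q"
    and join: "\<And>P Q. P \<in> L \<Longrightarrow> Q \<in> L \<Longrightarrow> P + Q - (P o\<^sub>L Q) \<in> L"
      "\<And>P Q. P \<in> L \<Longrightarrow> Q \<in> L \<Longrightarrow> f (P + Q - (P o\<^sub>L Q)) = f P + f Q - (f P o\<^sub>L f Q)"
begin

lemma lists_cproj:
  assumes "set Ps \<subseteq> L"
  shows "cproj (set Ps)" "cproj (set (map f Ps))"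
  using assms cproj_subset[OF cproj_L] cproj_subset[OF cproj_fL] by (auto simp: image_mono)

text \<open>Patterns are ordered so that a larger one lies below more of the generators. Upper sets
  of patterns are then the elements of the free bounded distributive lattice on the
  generators.\<close>

definition upset :: "bool list set \<Rightarrow> nat \<Rightarrow> bool" where
  "upset A n \<longleftrightarrow> A \<subseteq> bits n \<and> (\<forall>s\<in>A. \<forall>t\<in>bits n. list_all2 (\<longrightarrow>) s t \<longrightarrow> t \<in> A)"

text \<open>Splitting by the first sign gives \<open>P R1 + (1 - P) R0\<close>. Because
  \<open>A\<close> is an upper set, \<open>A0\<close> is contained in \<open>A1\<close>, so
  \<open>R0 \<le> R1\<close> and the expression equals the join of \<open>P R1\<close> and
  \<open>R0\<close>. No complement is left, and \<open>f\<close> carries it along.\<close>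

lemma upset_sum:
  assumes "set Ps \<subseteq> L" "upset A (length Ps)"
  shows "\<exists>P\<in>L. P = (\<Sum>s\<in>A. atom Ps s) \<and> f P = (\<Sum>s\<in>A. atom (map f Ps) s)"
  using assms
proof (induction Ps arbitrary: A)
  case Nil
  then have "A = {} \<or> A = {[]}" by (auto simp: upset_def bits_0)
  then show ?case
    using zero one by (intro bexI[of _ "if A = {} then 0 else id_blinfun"]) auto
next
  case (Cons P Ps)
  define n where "n = length Ps"
  define A1 where "A1 = {s \<in> bits n. True # s \<in> A}"
  define A0 where "A0 = {s \<in> bits n. False # s \<in> A}"
  have le: "list_all2 (\<longrightarrow>) (b # s) (c # t)" if "b \<longrightarrow> c" "list_all2 (\<longrightarrow>) s t" for b c s t
    using that by simp
  have AA: "A \<subseteq> bits (Suc n)" "\<And>s t. s \<in> A \<Longrightarrow> t \<in> bits (Suc n) \<Longrightarrow> list_all2 (\<longrightarrow>) s t \<Longrightarrow> t \<in> A"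
    using Cons.prems(2) by (auto simp: upset_def n_def)
  have Suc: "b # s \<in> bits (Suc n) \<longleftrightarrow> s \<in> bits n" for b s by (auto simp: bits_def)
  have up1: "upset A1 n" and up0: "upset A0 n"
    unfolding upset_def A1_def A0_def using AA(2) Suc le by blast+
  have sub: "A0 \<subseteq> A1"
    using AA(2)[of "False # s" "True # s" for s] Suc by (auto simp: A1_def A0_def list_all2_refl)
  have Ps: "set Ps \<subseteq> L" "P \<in> L" using Cons.prems by auto
  obtain R1 where R1: "R1 \<in> L" "R1 = (\<Sum>s\<in>A1. atom Ps s)" "f R1 = (\<Sum>s\<in>A1. atom (map f Ps) s)"
    using Cons.IH[OF Ps(1) up1[unfolded n_def]] by blast
  obtain R0 where R0: "R0 \<in> L" "R0 = (\<Sum>s\<in>A0. atom Ps s)" "f R0 = (\<Sum>s\<in>A0. atom (map f Ps) s)"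
    using Cons.IH[OF Ps(1) up0[unfolded n_def]] by blast
  have A1n: "A1 \<subseteq> bits (length Ps)" by (auto simp: A1_def n_def)
  define R where "R = (P o\<^sub>L R1) + R0 - ((P o\<^sub>L R1) o\<^sub>L R0)"
  have PR1: "P o\<^sub>L R1 \<in> L" by (intro meet Ps R1)
  have "R \<in> L" unfolding R_def by (intro join PR1 R0)
  moreover have "R = (\<Sum>s\<in>A. atom (P # Ps) s)"
  proof (rule blinfun_eqI)
    fix x
    have "R \<cdot> x = P \<cdot> R1 \<cdot> x + R0 \<cdot> x - P \<cdot> R0 \<cdot> x"
      using sum_atoms_mult[OF lists_cproj(1)[OF Ps(1)] sub A1n, folded R1(2) R0(2)]
      by (simp add: R_def blinfun.diff_left blinfun.add_left)
    also have "\<dots> = (\<Sum>s\<in>A. atom (P # Ps) s) \<cdot> x"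
      by (simp add: sum_bits_Suc[OF AA(1)] A1_def[symmetric] A0_def[symmetric] R1(2) R0(2)
          sum_blinfun_apply blinfun.sum_right blinfun.bilinear_simps sum_subtractf)
    finally show "R \<cdot> x = (\<Sum>s\<in>A. atom (P # Ps) s) \<cdot> x" .
  qed
  moreover have "f R = (\<Sum>s\<in>A. atom (map f (P # Ps)) s)"
  proof (rule blinfun_eqI)
    fix x
    have "f R = (f P o\<^sub>L f R1) + f R0 - ((f P o\<^sub>L f R1) o\<^sub>L f R0)"
      unfolding R_def using PR1 R0 R1 Ps by (simp add: join meet)
    then have "f R \<cdot> x = f P \<cdot> f R1 \<cdot> x + f R0 \<cdot> x - f P \<cdot> f R0 \<cdot> x"
      using sum_atoms_mult[OF lists_cproj(2)[OF Ps(1)] sub, folded R1(3) R0(3)] A1n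
      by (simp add: blinfun.diff_left blinfun.add_left)
    also have "\<dots> = (\<Sum>s\<in>A. atom (map f (P # Ps)) s) \<cdot> x"
      by (simp add: sum_bits_Suc[OF AA(1)] A1_def[symmetric] A0_def[symmetric] R1(3) R0(3)
          sum_blinfun_apply blinfun.sum_right blinfun.bilinear_simps sum_subtractf)
    finally show "f R \<cdot> x = (\<Sum>s\<in>A. atom (map f (P # Ps)) s) \<cdot> x" .
  qed
  ultimately show ?case by blast
qed

lemma upset_closure: "upset {t \<in> bits n. \<exists>s\<in>A. list_all2 (\<longrightarrow>) s t} n"
proof -
  have "list_all2 (\<longrightarrow>) s u" if "list_all2 (\<longrightarrow>) s t" "list_all2 (\<longrightarrow>) t u" for s t u
    by (rule list_all2_trans[OF _ that]) auto
  then show ?thesis unfolding upset_def by blast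
qed

lemma upset_norms:
  assumes "set Ps \<subseteq> L" "upset A (length Ps)"
  obtains P where "P \<in> L"
    "\<And>x. (norm (P \<cdot> x))\<^sup>2 = (\<Sum>s\<in>A. (norm (atom Ps s \<cdot> x))\<^sup>2)"
    "\<And>x. (norm (x - P \<cdot> x))\<^sup>2 = (\<Sum>s\<in>bits (length Ps) - A. (norm (atom Ps s \<cdot> x))\<^sup>2)"
    "\<And>y. (norm (f P \<cdot> y))\<^sup>2 = (\<Sum>s\<in>A. (norm (atom (map f Ps) s \<cdot> y))\<^sup>2)"
    "\<And>y. (norm (y - f P \<cdot> y))\<^sup>2 = (\<Sum>s\<in>bits (length Ps) - A. (norm (atom (map f Ps) s \<cdot> y))\<^sup>2)"
proof -
  obtain P where P: "P \<in> L" "P = (\<Sum>s\<in>A. atom Ps s)" "f P = (\<Sum>s\<in>A. atom (map f Ps) s)"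
    using upset_sum[OF assms] by blast
  have A: "A \<subseteq> bits (length Ps)" using assms(2) by (simp add: upset_def)
  have eq: "x - (\<Sum>s\<in>A. atom Qs s) \<cdot> x = (\<Sum>s\<in>bits (length Qs) - A. atom Qs s \<cdot> x)"
    if "A \<subseteq> bits (length Qs)" for Qs :: "('c::complex_hilbert \<Rightarrow>\<^sub>L 'c) list" and x
  proof -
    have "x = (\<Sum>s\<in>bits (length Qs) - A. atom Qs s \<cdot> x) + (\<Sum>s\<in>A. atom Qs s \<cdot> x)"
      using sum.subset_diff[OF that finite_bits, of "\<lambda>s. atom Qs s \<cdot> x"] by (simp add: sum_atoms)
    then show ?thesis by (metis add_diff_cancel_right' sum_blinfun_apply)
  qed
  show ?thesis
  proof (rule that[OF P(1)])
    show "(norm (P \<cdot> x))\<^sup>2 = (\<Sum>s\<in>A. (norm (atom Ps s \<cdot> x))\<^sup>2)" for x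
      using norm_sum_atoms[OF lists_cproj(1)[OF assms(1)] A] by (simp add: P sum_blinfun_apply)
    show "(norm (x - P \<cdot> x))\<^sup>2 = (\<Sum>s\<in>bits (length Ps) - A. (norm (atom Ps s \<cdot> x))\<^sup>2)" for x
      using norm_sum_atoms[OF lists_cproj(1)[OF assms(1)]] eq[of Ps x] A by (simp add: P)
    show "(norm (f P \<cdot> y))\<^sup>2 = (\<Sum>s\<in>A. (norm (atom (map f Ps) s \<cdot> y))\<^sup>2)" for y
      using norm_sum_atoms[OF lists_cproj(2)[OF assms(1)]] A by (simp add: P(3) sum_blinfun_apply)
    show "(norm (y - f P \<cdot> y))\<^sup>2 = (\<Sum>s\<in>bits (length Ps) - A. (norm (atom (map f Ps) s \<cdot> y))\<^sup>2)" for y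
      using norm_sum_atoms[OF lists_cproj(2)[OF assms(1)]] eq[of "map f Ps" y] A by (simp add: P(3))
  qed
qed

text \<open>A criterion of Strassen type: mass moves upward from the measure of \<xi> to that of
  \<zeta>. It is the network with a second layer that never binds, each demand alone being able to
  absorb \<open>tot\<close> from every station. The remaining cuts are upper sets, where the
  hypothesis applies.\<close>

lemma coupling_exists:
  fixes \<xi> :: 'a and \<zeta> :: "nat \<Rightarrow> 'b"
  assumes Ps: "set Ps \<subseteq> L" and e: "0 \<le> e"
    and le: "\<And>P. P \<in> L \<Longrightarrow> (\<Sum>k<n. (norm (\<zeta> k - f P \<cdot> \<zeta> k))\<^sup>2) \<le> (norm (\<xi> - P \<cdot> \<xi>))\<^sup>2 + e"
  defines "W \<equiv> bits (length Ps)"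
  obtains p where "\<And>s t. 0 \<le> p s t"
    "\<And>s t. p s t \<noteq> 0 \<Longrightarrow> s \<in> W \<and> t \<in> W \<and> list_all2 (\<longrightarrow>) s t"
    "\<And>s. s \<in> W \<Longrightarrow> (\<Sum>t\<in>W. p s t) \<le> (norm (atom Ps s \<cdot> \<xi>))\<^sup>2"
    "\<And>t. t \<in> W \<Longrightarrow> (\<Sum>s\<in>W. p s t) \<le> (\<Sum>k<n. (norm (atom (map f Ps) t \<cdot> \<zeta> k))\<^sup>2)"
    "(\<Sum>k<n. (norm (\<zeta> k))\<^sup>2) - e \<le> (\<Sum>s\<in>W. \<Sum>t\<in>W. p s t)"
proof -
  define a where "a = (\<lambda>s. (norm (atom Ps s \<cdot> \<xi>))\<^sup>2)"
  define b where "b = (\<lambda>t. \<Sum>k<n. (norm (atom (map f Ps) t \<cdot> \<zeta> k))\<^sup>2)"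
  define tot where "tot = (\<Sum>k<n. (norm (\<zeta> k))\<^sup>2)"
  have nn: "0 \<le> a s" "0 \<le> b s" "0 \<le> tot" for s by (auto simp: a_def b_def tot_def sum_nonneg)
  have fin: "finite W" by (simp add: W_def)
  show ?thesis
  proof (rule layered_transport[of W a b "\<lambda>_. tot" "list_all2 (\<longrightarrow>)" "\<lambda>_ _. True", OF fin nn])
    fix p q A B B' C
    assume p: "\<And>i j. 0 \<le> p i j" "\<And>i j. p i j \<noteq> 0 \<Longrightarrow> i \<in> W \<and> j \<in> W \<and> list_all2 (\<longrightarrow>) i j"
      "\<And>i. i \<in> W \<Longrightarrow> (\<Sum>j\<in>W. p i j) \<le> a i" "\<And>j. j \<in> W \<Longrightarrow> (\<Sum>i\<in>W. p i j) \<le> b j"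
      and sub: "A \<subseteq> W" "B \<subseteq> W" "B' \<subseteq> W" "C \<subseteq> W"
      and cl: "\<And>i j. i \<in> A \<Longrightarrow> j \<in> W \<Longrightarrow> list_all2 (\<longrightarrow>) i j \<Longrightarrow> j \<in> B"
        "\<And>j i. j \<in> B' \<Longrightarrow> i \<in> W \<Longrightarrow> True \<Longrightarrow> i \<in> C"
      and cut: "sum a (W - A) + sum b (B - B') + (\<Sum>_\<in>C. tot) \<le> (\<Sum>i\<in>W. \<Sum>j\<in>W. p i j)"
    have "tot - e \<le> (\<Sum>i\<in>W. \<Sum>j\<in>W. p i j)"
    proof (cases "B' = {}")
      \<comment> \<open>A single exit on the source side drags all demands with it, and each of them
        costs \<open>tot\<close>.\<close>
      case False
      then have "C = W" using cl(2) sub by blast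
      moreover have "card W \<ge> 1"
        using False sub fin by (metis One_nat_def Suc_leI card_gt_0_iff subset_empty)
      then have "1 * tot \<le> real (card W) * tot" using nn by (intro mult_right_mono) auto
      ultimately have "tot \<le> (\<Sum>_\<in>C. tot)" by simp
      then show ?thesis
        using cut e nn sum_nonneg[of "W - A" a] sum_nonneg[of "B - B'" b] by simp
    next
      case True
      \<comment> \<open>The upper set generated by \<open>A\<close> lies between \<open>A\<close>
        and \<open>B\<close>, so replacing both by \<open>U\<close> does not increase the cost of
        the cut.\<close>
      define U where "U = {t \<in> W. \<exists>s\<in>A. list_all2 (\<longrightarrow>) s t}"
      have "upset U (length Ps)" unfolding U_def W_def by (rule upset_closure)
      from upset_norms[OF Ps this] obtain P where P: "P \<in> L"
        "\<And>x. (norm (x - P \<cdot> x))\<^sup>2 = (\<Sum>s\<in>W - U. (norm (atom Ps s \<cdot> x))\<^sup>2)"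
        "\<And>y. (norm (f P \<cdot> y))\<^sup>2 = (\<Sum>s\<in>U. (norm (atom (map f Ps) s \<cdot> y))\<^sup>2)"
        unfolding W_def by metis
      have "A \<subseteq> U" using sub by (auto simp: U_def intro!: bexI list_all2_refl)
      then have "sum a (W - U) \<le> sum a (W - A)"
        using fin nn by (intro sum_mono2) auto
      moreover have "U \<subseteq> B" using cl(1) by (auto simp: U_def)
      then have "sum b U \<le> sum b (B - B')"
        using fin nn sub finite_subset True by (intro sum_mono2) auto
      moreover have "sum a (W - U) = (norm (\<xi> - P \<cdot> \<xi>))\<^sup>2"
        by (simp add: a_def P)
      moreover have "sum b U = (\<Sum>k<n. (norm (f P \<cdot> \<zeta> k))\<^sup>2)"
        unfolding b_def P(3) by (rule sum.swap)
      moreover have "tot = (\<Sum>k<n. (norm (f P \<cdot> \<zeta> k))\<^sup>2) + (\<Sum>k<n. (norm (\<zeta> k - f P \<cdot> \<zeta> k))\<^sup>2)"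
        unfolding tot_def sum.distrib[symmetric] using P(1) cprojD[OF cproj_fL]
        by (intro sum.cong refl norm_proj_pythagoras) auto
      moreover have "0 \<le> (\<Sum>_\<in>C. tot)" using nn by (intro sum_nonneg)
      ultimately show ?thesis using cut le[OF P(1)] by linarith
    qed
    then show ?thesis
      using p that[of p] by (auto simp: a_def b_def tot_def)
  qed
qed

end

section \<open>Interpolation by operators respecting the lattices\<close>

lemma continuous_eval3:
  "continuous_on UNIV (\<lambda>B. (B :: 'u \<Rightarrow> 'v \<Rightarrow> 'w \<Rightarrow> 'c :: topological_space) k x y)"
  by (rule continuous_on_product_then_coordinatewise[OF continuous_eval2])

lemma cinner_proj_self: "P \<in> projections \<Longrightarrow> cinner (P \<cdot> x) x = of_real ((norm (P \<cdot> x))\<^sup>2)"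
  by (metis cinner_self projectionsD(2,3))

lemma mult_le_mean_squares: "(x :: real) * y \<le> (x\<^sup>2 + y\<^sup>2) / 2"
  using sum_squares_bound[of x y] by (simp add: mult.assoc)

text \<open>The coefficients of a column of \<open>n\<close> operators that is a contraction into
  \<open>n\<close> copies of the target space; indices from \<open>n\<close> on are filled with
  zero. Every clause is closed under pointwise limits, and a bound by the mean of squares is what
  the Schur test delivers.\<close>

definition form_family :: "nat \<Rightarrow> (nat \<Rightarrow> 'a::complex_hilbert \<Rightarrow> 'b::complex_hilbert \<Rightarrow> complex) \<Rightarrow> bool" where
  "form_family n B \<longleftrightarrow>
     (\<forall>k x x' y. B k (x + x') y = B k x y + B k x' y) \<and>
     (\<forall>k c x y. B k (c *\<^sub>C x) y = c * B k x y) \<and>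
     (\<forall>k x y y'. B k x (y + y') = B k x y + B k x y') \<and>
     (\<forall>k c x y. B k x (c *\<^sub>C y) = cnj c * B k x y) \<and>
     (\<forall>k x y. k \<ge> n \<longrightarrow> B k x y = 0) \<and>
     (\<forall>x y. cmod (\<Sum>k<n. B k x (y k)) \<le> ((norm x)\<^sup>2 + (\<Sum>k<n. (norm (y k))\<^sup>2)) / 2)"

lemma form_familyD:
  assumes "form_family n B"
  shows "B k (x + x') y = B k x y + B k x' y" "B k (c *\<^sub>C x) y = c * B k x y"
    "B k x (y + y') = B k x y + B k x y'" "B k x (c *\<^sub>C y) = cnj c * B k x y"
    "k \<ge> n \<Longrightarrow> B k x y = 0"
    "cmod (\<Sum>k<n. B k x (z k)) \<le> ((norm x)\<^sup>2 + (\<Sum>k<n. (norm (z k))\<^sup>2)) / 2"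
  using assms by (simp_all add: form_family_def)

text \<open>The joint bound is tested on a tuple with one nonzero entry. Rescaling both vectors to
  unit length turns the mean into a product.\<close>

lemma form_family_bound:
  assumes B: "form_family n B"
  shows "cmod (B k x y) \<le> ((norm x)\<^sup>2 + (norm y)\<^sup>2) / 2" "cmod (B k x y) \<le> norm x * norm y"
proof -
  have bd: "cmod (B k x y) \<le> ((norm x)\<^sup>2 + (norm y)\<^sup>2) / 2" for x y
  proof (cases "k < n")
    case True
    have "B j x 0 = 0" for j x using form_familyD(4)[OF B, of j x 0 0] by (simp add: scaleC_0_left)
    then have "(\<Sum>j<n. B j x (if j = k then y else 0)) = (\<Sum>j<n. if j = k then B k x y else 0)"
      by (intro sum.cong) auto
    moreover have "(\<Sum>j<n. (norm (if j = k then y else 0))\<^sup>2) = (\<Sum>j<n. if j = k then (norm y)\<^sup>2 else 0)"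
      by (intro sum.cong) auto
    ultimately show ?thesis
      using form_familyD(6)[OF B, of x "\<lambda>j. if j = k then y else 0"] True by simp
  qed (simp add: form_familyD(5)[OF B])
  show "cmod (B k x y) \<le> ((norm x)\<^sup>2 + (norm y)\<^sup>2) / 2" by (rule bd)
  show "cmod (B k x y) \<le> norm x * norm y"
  proof (cases "x = 0 \<or> y = 0")
    case True
    then show ?thesis
      using form_familyD(2)[OF B, of k 0 x y] form_familyD(4)[OF B, of k x 0 y]
      by (auto simp: scaleC_0_left)
  next
    case False
    define x' where "x' = of_real (inverse (norm x)) *\<^sub>C x"
    define y' where "y' = of_real (inverse (norm y)) *\<^sub>C y"
    have n1: "norm x' = 1" "norm y' = 1"
      using False by (auto simp: x'_def y'_def norm_scaleC norm_inverse)
    have "B k x' y' = of_real (inverse (norm x)) * (of_real (inverse (norm y)) * B k x y)"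
      unfolding x'_def y'_def
      by (simp only: form_familyD(2)[OF B] form_familyD(4)[OF B] complex_cnj_complex_of_real mult.left_commute)
    then have "cmod (B k x' y') = cmod (B k x y) / (norm x * norm y)"
      by (simp add: norm_mult norm_inverse divide_inverse)
    moreover have "cmod (B k x' y') \<le> 1" using bd[of x' y'] n1 by simp
    ultimately show ?thesis using False by (simp add: divide_le_eq)
  qed
qed

context lat_hom
begin

text \<open>A coupling \<open>p\<close> of the measures carried by \<open>\<xi>\<close> and \<open>\<zeta>\<close> turns into a contraction, by the
  Schur test.\<close>

lemma finite_form:
  fixes \<xi> :: 'a and \<zeta> :: "nat \<Rightarrow> 'b"
  assumes Ps: "set Ps \<subseteq> L" and e: "0 \<le> e"
    and le: "\<And>P. P \<in> L \<Longrightarrow> (\<Sum>k<n. (norm (\<zeta> k - f P \<cdot> \<zeta> k))\<^sup>2) \<le> (norm (\<xi> - P \<cdot> \<xi>))\<^sup>2 + e"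
  shows "\<exists>B. form_family n B \<and> (\<Sum>k<n. (norm (\<zeta> k))\<^sup>2) - e \<le> Re (\<Sum>k<n. B k \<xi> (\<zeta> k)) \<and>
    (\<forall>P\<in>set Ps. \<forall>k x y. B k (P \<cdot> x) (y - f P \<cdot> y) = 0)"
proof -
  define W where "W = bits (length Ps)"
  have fin: "finite W" by (simp add: W_def)
  define E where "E = (\<lambda>s. atom Ps s)"
  define F where "F = (\<lambda>s. atom (map f Ps) s)"
  define a where "a = (\<lambda>s. (norm (E s \<cdot> \<xi>))\<^sup>2)"
  define b where "b = (\<lambda>t. \<Sum>k<n. (norm (F t \<cdot> \<zeta> k))\<^sup>2)"
  have nn: "0 \<le> a s" "0 \<le> b s" for s by (auto simp: a_def b_def sum_nonneg)
  obtain p where p: "\<And>s t. 0 \<le> p s t"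
    "\<And>s t. p s t \<noteq> 0 \<Longrightarrow> s \<in> W \<and> t \<in> W \<and> list_all2 (\<longrightarrow>) s t"
    "\<And>s. s \<in> W \<Longrightarrow> (\<Sum>t\<in>W. p s t) \<le> a s"
    "\<And>t. t \<in> W \<Longrightarrow> (\<Sum>s\<in>W. p s t) \<le> b t"
    "(\<Sum>k<n. (norm (\<zeta> k))\<^sup>2) - e \<le> (\<Sum>s\<in>W. \<Sum>t\<in>W. p s t)"
    using coupling_exists[OF Ps e le] unfolding W_def E_def F_def a_def b_def by blast
  note cps = lists_cproj[OF Ps]
  have Ep: "E s \<in> projections" and Fp: "F s \<in> projections" for s
    using atom_proj[OF cps(1)] atom_proj[OF cps(2)] by (simp_all add: E_def F_def)
  \<comment> \<open>The coupling as a kernel with respect to both measures. Where a measure vanishes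
    the quotient is zero by convention.\<close>
  define c where "c = (\<lambda>s t. p s t / (a s * b t))"
  define B where "B = (\<lambda>k x y. if k < n
     then \<Sum>s\<in>W. \<Sum>t\<in>W. of_real (c s t) * (cinner x (E s \<cdot> \<xi>) * cinner (F t \<cdot> \<zeta> k) y) else 0)"
  have B_sum: "(\<Sum>k<n. B k x (y k)) =
      (\<Sum>s\<in>W. \<Sum>t\<in>W. of_real (c s t) * (cinner x (E s \<cdot> \<xi>) * (\<Sum>k<n. cinner (F t \<cdot> \<zeta> k) (y k))))" for x y
  proof -
    have "(\<Sum>k<n. B k x (y k)) = (\<Sum>k<n. \<Sum>s\<in>W. \<Sum>t\<in>W. of_real (c s t) * (cinner x (E s \<cdot> \<xi>) * cinner (F t \<cdot> \<zeta> k) (y k)))"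
      by (intro sum.cong) (auto simp: B_def)
    also have "\<dots> = (\<Sum>s\<in>W. \<Sum>t\<in>W. \<Sum>k<n. of_real (c s t) * (cinner x (E s \<cdot> \<xi>) * cinner (F t \<cdot> \<zeta> k) (y k)))"
      by (subst sum.swap, rule sum.cong[OF refl], rule sum.swap)
    finally show ?thesis by (simp add: sum_distrib_left)
  qed
  \<comment> \<open>The marginal bounds make \<open>p\<close> vanish wherever \<open>a\<close> or
    \<open>b\<close> does, so multiplying \<open>c\<close> by both masses recovers \<open>p\<close>.
    This evaluates the form at \<xi> and \<zeta> as the total mass of the coupling.\<close>
  have p0: "p s t = 0 \<or> (a s > 0 \<and> b t > 0)" for s t
  proof (cases "p s t = 0")
    case False
    then have st: "s \<in> W" "t \<in> W" using p(2) by blast+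
    have "p s t \<le> (\<Sum>t\<in>W. p s t)" "p s t \<le> (\<Sum>s\<in>W. p s t)"
      using st fin p(1) member_le_sum[of t W "p s"] member_le_sum[of s W "\<lambda>s. p s t"] by auto
    then show ?thesis using p(1)[of s t] False p(3)[OF st(1)] p(4)[OF st(2)] by linarith
  qed simp
  have bound: "cmod (\<Sum>k<n. B k x (y k)) \<le> ((norm x)\<^sup>2 + (\<Sum>k<n. (norm (y k))\<^sup>2)) / 2" for x y
  proof -
    define X where "X = (\<lambda>s. cmod (cinner x (E s \<cdot> \<xi>)))"
    define Y where "Y = (\<lambda>t. cmod (\<Sum>k<n. cinner (F t \<cdot> \<zeta> k) (y k)))"
    have X: "(X s)\<^sup>2 \<le> (norm (E s \<cdot> x))\<^sup>2 * a s" for s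
    proof -
      have "cinner x (E s \<cdot> \<xi>) = cinner (E s \<cdot> x) (E s \<cdot> \<xi>)"
        using projectionsD(2,3)[OF Ep] by simp
      then have "X s \<le> norm (E s \<cdot> x) * norm (E s \<cdot> \<xi>)"
        using cauchy_schwarz[of "E s \<cdot> x" "E s \<cdot> \<xi>"] by (simp add: X_def)
      then have "(X s)\<^sup>2 \<le> (norm (E s \<cdot> x) * norm (E s \<cdot> \<xi>))\<^sup>2"
        by (rule power_mono) (simp add: X_def)
      then show ?thesis by (simp add: a_def power_mult_distrib)
    qed
    have Y: "(Y t)\<^sup>2 \<le> (\<Sum>k<n. (norm (F t \<cdot> y k))\<^sup>2) * b t" for t
    proof -
      have "Y t \<le> (\<Sum>k<n. norm (F t \<cdot> \<zeta> k) * norm (F t \<cdot> y k))"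
        unfolding Y_def
      proof (rule sum_norm_le)
        fix k
        have "cinner (F t \<cdot> \<zeta> k) (y k) = cinner (F t \<cdot> \<zeta> k) (F t \<cdot> y k)"
          using projectionsD(2,3)[OF Fp] by metis
        then show "cmod (cinner (F t \<cdot> \<zeta> k) (y k)) \<le> norm (F t \<cdot> \<zeta> k) * norm (F t \<cdot> y k)"
          using cauchy_schwarz by metis
      qed
      then have "(Y t)\<^sup>2 \<le> (\<Sum>k<n. norm (F t \<cdot> \<zeta> k) * norm (F t \<cdot> y k))\<^sup>2"
        by (rule power_mono) (simp add: Y_def)
      also have "\<dots> \<le> b t * (\<Sum>k<n. (norm (F t \<cdot> y k))\<^sup>2)"
        unfolding b_def by (rule Cauchy_Schwarz_ineq_sum)
      finally show ?thesis by (simp add: mult.commute)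
    qed
    \<comment> \<open>Each term is split by the mean of squares; in either half one variable is
      summed out with a marginal bound of \<open>p\<close>.\<close>
    have "cmod (\<Sum>k<n. B k x (y k)) \<le> (\<Sum>s\<in>W. \<Sum>t\<in>W. (p s t * (X s / a s)\<^sup>2 + p s t * (Y t / b t)\<^sup>2) / 2)"
      unfolding B_sum
    proof (intro sum_norm_le)
      fix s t
      have "cmod (of_real (c s t) * (cinner x (E s \<cdot> \<xi>) * (\<Sum>k<n. cinner (F t \<cdot> \<zeta> k) (y k)))) =
          p s t * ((X s / a s) * (Y t / b t))"
        using p(1)[of s t] nn[of s] nn[of t] by (simp add: c_def X_def Y_def norm_mult norm_divide)
      also have "(X s / a s) * (Y t / b t) \<le> ((X s / a s)\<^sup>2 + (Y t / b t)\<^sup>2) / 2"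
        by (rule mult_le_mean_squares)
      then have "p s t * ((X s / a s) * (Y t / b t)) \<le> p s t * (((X s / a s)\<^sup>2 + (Y t / b t)\<^sup>2) / 2)"
        using p(1) by (rule mult_left_mono)
      finally show "cmod (of_real (c s t) * (cinner x (E s \<cdot> \<xi>) * (\<Sum>k<n. cinner (F t \<cdot> \<zeta> k) (y k))))
          \<le> (p s t * (X s / a s)\<^sup>2 + p s t * (Y t / b t)\<^sup>2) / 2"
        by (simp add: distrib_left)
    qed
    also have "\<dots> = ((\<Sum>s\<in>W. \<Sum>t\<in>W. p s t * (X s / a s)\<^sup>2) + (\<Sum>s\<in>W. \<Sum>t\<in>W. p s t * (Y t / b t)\<^sup>2)) / 2"
      by (simp add: sum_divide_distrib[symmetric] sum.distrib)
    also have "(\<Sum>s\<in>W. \<Sum>t\<in>W. p s t * (X s / a s)\<^sup>2) \<le> (\<Sum>s\<in>W. (norm (E s \<cdot> x))\<^sup>2)"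
    proof (rule sum_mono)
      fix s assume s: "s \<in> W"
      have "(\<Sum>t\<in>W. p s t * (X s / a s)\<^sup>2) = (\<Sum>t\<in>W. p s t) * (X s / a s)\<^sup>2"
        by (simp add: sum_distrib_right)
      also have "\<dots> \<le> a s * (X s / a s)\<^sup>2"
        by (intro mult_right_mono p s) simp
      also have "\<dots> \<le> (norm (E s \<cdot> x))\<^sup>2"
        using X[of s] nn[of s] by (cases "a s = 0") (simp_all add: power_divide power2_eq_square field_simps)
      finally show "(\<Sum>t\<in>W. p s t * (X s / a s)\<^sup>2) \<le> (norm (E s \<cdot> x))\<^sup>2" .
    qed
    also have "(\<Sum>s\<in>W. \<Sum>t\<in>W. p s t * (Y t / b t)\<^sup>2) \<le> (\<Sum>t\<in>W. \<Sum>k<n. (norm (F t \<cdot> y k))\<^sup>2)"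
    proof (subst sum.swap, rule sum_mono)
      fix t assume t: "t \<in> W"
      have "(\<Sum>s\<in>W. p s t * (Y t / b t)\<^sup>2) = (\<Sum>s\<in>W. p s t) * (Y t / b t)\<^sup>2"
        by (simp add: sum_distrib_right)
      also have "\<dots> \<le> b t * (Y t / b t)\<^sup>2"
        by (intro mult_right_mono p t) simp
      also have "\<dots> \<le> (\<Sum>k<n. (norm (F t \<cdot> y k))\<^sup>2)"
      proof (cases "b t = 0")
        case False
        then have "b t > 0" using nn[of t] by simp
        then have "b t * (Y t / b t)\<^sup>2 = (Y t)\<^sup>2 / b t" by (simp add: power_divide power2_eq_square)
        then show ?thesis using Y[of t] \<open>b t > 0\<close> by (simp add: divide_le_eq)
      qed (simp add: sum_nonneg)
      finally show "(\<Sum>s\<in>W. p s t * (Y t / b t)\<^sup>2) \<le> (\<Sum>k<n. (norm (F t \<cdot> y k))\<^sup>2)" .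
    qed
    also have "(\<Sum>s\<in>W. (norm (E s \<cdot> x))\<^sup>2) = (norm x)\<^sup>2"
      unfolding W_def E_def by (rule norm_atoms[OF cps(1)])
    also have "(\<Sum>t\<in>W. \<Sum>k<n. (norm (F t \<cdot> y k))\<^sup>2) = (\<Sum>k<n. (norm (y k))\<^sup>2)"
      using norm_atoms[OF cps(2)] unfolding W_def F_def by (subst sum.swap) simp
    finally show ?thesis by simp
  qed
  have "form_family n B"
    unfolding form_family_def
  proof (intro conjI allI impI)
    show "B k (x + x') y = B k x y + B k x' y" for k x x' y
      by (simp add: B_def cinner_add_left distrib_left distrib_right sum.distrib)
    show "B k x (y + y') = B k x y + B k x y'" for k x y y'
      by (simp add: B_def cinner_add_right distrib_left distrib_right sum.distrib)
    show "B k (r *\<^sub>C x) y = r * B k x y" for k r x y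
      by (simp add: B_def cinner_scaleC_left sum_distrib_left mult_ac)
    show "B k x (r *\<^sub>C y) = cnj r * B k x y" for k r x y
      by (simp add: B_def cinner_scaleC_right sum_distrib_left mult_ac)
  qed (use bound in \<open>auto simp: B_def\<close>)
  moreover have "(\<Sum>k<n. B k \<xi> (\<zeta> k)) = of_real (\<Sum>s\<in>W. \<Sum>t\<in>W. p s t)"
  proof -
    have "cinner \<xi> (E s \<cdot> \<xi>) = of_real (a s)" for s
      using projectionsD(2,3)[OF Ep] cinner_self[of "E s \<cdot> \<xi>"] by (metis a_def)
    moreover have "(\<Sum>k<n. cinner (F t \<cdot> \<zeta> k) (\<zeta> k)) = of_real (b t)" for t
      by (simp only: b_def cinner_proj_self[OF Fp] of_real_sum)
    ultimately have "(\<Sum>k<n. B k \<xi> (\<zeta> k)) = (\<Sum>s\<in>W. \<Sum>t\<in>W. of_real (c s t * (a s * b t)))"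
      by (simp add: B_sum)
    also have "\<dots> = (\<Sum>s\<in>W. \<Sum>t\<in>W. of_real (p s t))"
      using p0 by (intro sum.cong refl arg_cong[of _ _ of_real]) (fastforce simp: c_def)
    finally show ?thesis by simp
  qed
  moreover have "B k (P \<cdot> x) (y - f P \<cdot> y) = 0" if PPs: "P \<in> set Ps" for P k x y
  proof -
    obtain i where i: "i < length Ps" "P = Ps ! i" using PPs by (metis in_set_conv_nth)
    have PL: "P \<in> projections" "f P \<in> projections"
      using PPs Ps cprojD[OF cproj_L] cprojD[OF cproj_fL] by auto
    \<comment> \<open>Mass only moves from \<open>s\<close> to a larger \<open>t\<close>. If
      \<open>P\<close> contains the atom of \<open>s\<close>, then \<open>f P\<close> contains that
      of \<open>t\<close>, which is orthogonal to the second argument; otherwise the first factor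
      vanishes.\<close>
    have "c s t = 0 \<or> cinner (P \<cdot> x) (E s \<cdot> \<xi>) = 0 \<or> cinner (F t \<cdot> \<zeta> k) (y - f P \<cdot> y) = 0"
      if st: "s \<in> W" "t \<in> W" for s t
    proof (cases "p s t = 0")
      case False
      then have "list_all2 (\<longrightarrow>) s t" using p(2) by blast
      then have imp: "s ! i \<longrightarrow> t ! i" using i st by (auto simp: W_def bits_def list_all2_conv_all_nth)
      have E: "P \<cdot> E s \<cdot> \<xi> = (if s ! i then E s \<cdot> \<xi> else 0)"
        using atom_in[OF cps(1) i(1)] st i by (simp add: W_def E_def)
      have F: "f P \<cdot> F t \<cdot> \<zeta> k = (if t ! i then F t \<cdot> \<zeta> k else 0)"
        using atom_in[OF cps(2), of i t] st i by (simp add: W_def F_def)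
      show ?thesis
      proof (cases "s ! i")
        case True
        then have "cinner (F t \<cdot> \<zeta> k) (y - f P \<cdot> y) = 0"
          using imp F projectionsD(3)[OF PL(2), of "F t \<cdot> \<zeta> k" y] by (simp add: cinner.diff_right)
        then show ?thesis by simp
      next
        case False
        then show ?thesis using E projectionsD(3)[OF PL(1), of x "E s \<cdot> \<xi>"] by (simp add: cinner.zero_right)
      qed
    qed (simp add: c_def)
    then show ?thesis by (auto simp: B_def intro!: sum.neutral)
  qed
  ultimately show ?thesis using p(5) by (intro exI[of _ B]) simp
qed

text \<open>Respecting a single \<open>P\<close> is a closed condition on families of forms and
  finitely many can be met at once, so the finite intersection property gives one family for all of
  \<open>L\<close>. If \<xi> and \<zeta> have nearly the same mass, the last inequality says that
  the contraction \<open>u\<close> almost sends \<xi> to \<zeta>.\<close>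

theorem interpolation:
  fixes \<xi> :: 'a and \<zeta> :: "nat \<Rightarrow> 'b"
  assumes e: "0 \<le> e"
    and le: "\<And>P. P \<in> L \<Longrightarrow> (\<Sum>k<n. (norm (\<zeta> k - f P \<cdot> \<zeta> k))\<^sup>2) \<le> (norm (\<xi> - P \<cdot> \<xi>))\<^sup>2 + e"
  shows "\<exists>u. (\<forall>k. u k \<in> bounded_ops) \<and> (\<forall>k. \<forall>P\<in>L. \<forall>x. f P \<cdot> u k \<cdot> P \<cdot> x = u k \<cdot> P \<cdot> x) \<and>
    (\<forall>x. (\<Sum>k<n. (norm (u k \<cdot> x))\<^sup>2) \<le> (norm x)\<^sup>2) \<and>
    (\<Sum>k<n. (norm (\<zeta> k))\<^sup>2) - e \<le> Re (\<Sum>k<n. cinner (u k \<cdot> \<xi>) (\<zeta> k))"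
proof -
  define K :: "(nat \<Rightarrow> 'a \<Rightarrow> 'b \<Rightarrow> complex) set" where
    "K = {B. \<forall>k. B k \<in> {b. \<forall>x. b x \<in> {c. \<forall>y. c y \<in> cball 0 (((norm x)\<^sup>2 + (norm y)\<^sup>2) / 2)}}}"
  define G :: "(nat \<Rightarrow> 'a \<Rightarrow> 'b \<Rightarrow> complex) set" where "G = {B. form_family n B}"
  define H where "H = {B. (\<Sum>k<n. (norm (\<zeta> k))\<^sup>2) - e \<le> Re (\<Sum>k<n. B k \<xi> (\<zeta> k))}"
  define Z :: "('a \<Rightarrow>\<^sub>L 'a) \<Rightarrow> (nat \<Rightarrow> 'a \<Rightarrow> 'b \<Rightarrow> complex) set" where "Z = (\<lambda>P. {B. \<forall>k x y. B k (P \<cdot> x) (y - f P \<cdot> y) = (0 :: complex)})"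
  have "compact K"
    unfolding K_def by (intro compact_Pi_UNIV compact_cball)
  moreover have "closed G"
    unfolding G_def form_family_def
    by (intro closed_Collect_conj closed_Collect_all closed_Collect_imp closed_Collect_eq closed_Collect_le
        continuous_intros continuous_eval3) auto
  moreover have "closed H"
    unfolding H_def by (intro closed_Collect_le continuous_intros continuous_eval3)
  ultimately have "compact (K \<inter> G \<inter> H)" by (intro compact_Int_closed) auto
  moreover have GK: "G \<subseteq> K"
    using form_family_bound(1) by (auto simp: G_def K_def)
  ultimately have cpt: "compact (G \<inter> H)" by (simp add: Int_absorb1)
  have "(G \<inter> H) \<inter> (\<Inter>P\<in>L. Z P) \<noteq> {}"
  proof (rule compact_imp_fip_image[OF cpt])
    show "closed (Z P)" for P
      unfolding Z_def by (intro closed_Collect_all closed_Collect_eq continuous_intros continuous_eval3)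
    fix I' assume "finite I'" "I' \<subseteq> L"
    then obtain Ps where "set Ps = I'" "set Ps \<subseteq> L" using finite_list by metis
    then show "G \<inter> H \<inter> (\<Inter>P\<in>I'. Z P) \<noteq> {}"
      using finite_form[OF _ e le, of Ps] by (auto simp: G_def H_def Z_def)
  qed
  then obtain B where B: "form_family n B" "B \<in> H" "\<And>P. P \<in> L \<Longrightarrow> B \<in> Z P"
    by (auto simp: G_def)
  have "\<exists>T\<in>bounded_ops. \<forall>x y. cinner (T \<cdot> x) y = B k x y" for k
    using form_familyD[OF B(1)] form_family_bound(2)[OF B(1)] by (intro operator_of_form) auto
  then obtain u where u: "\<And>k. u k \<in> bounded_ops" "\<And>k x y. cinner (u k \<cdot> x) y = B k x y"
    by metis
  have "f P \<cdot> u k \<cdot> P \<cdot> x = u k \<cdot> P \<cdot> x" if P: "P \<in> L" for P k x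
  proof -
    have fP: "f P \<in> projections" using P cprojD[OF cproj_fL] by auto
    have "cinner (u k \<cdot> P \<cdot> x - f P \<cdot> u k \<cdot> P \<cdot> x) y = 0" for y
    proof -
      have "cinner (u k \<cdot> P \<cdot> x - f P \<cdot> u k \<cdot> P \<cdot> x) y = cinner (u k \<cdot> P \<cdot> x) (y - f P \<cdot> y)"
        using projectionsD(3)[OF fP] by (simp add: cinner.diff_left cinner.diff_right)
      also have "\<dots> = 0" using B(3)[OF P] by (simp add: u Z_def)
      finally show ?thesis .
    qed
    from eq_zero_if_orthogonal[OF this] show ?thesis by simp
  qed
  moreover have "(\<Sum>k<n. (norm (u k \<cdot> x))\<^sup>2) \<le> (norm x)\<^sup>2" for x
  proof -
    \<comment> \<open>Testing with the values \<open>u k \<cdot> x\<close> themselves puts their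
      squared norms on both sides, and half of them is absorbed.\<close>
    have "(\<Sum>k<n. B k x (u k \<cdot> x)) = of_real (\<Sum>k<n. (norm (u k \<cdot> x))\<^sup>2)"
      by (simp add: u(2)[symmetric] cinner_self)
    then have "cmod (\<Sum>k<n. B k x (u k \<cdot> x)) = (\<Sum>k<n. (norm (u k \<cdot> x))\<^sup>2)"
      by (simp only: norm_of_real) (simp add: sum_nonneg)
    then show ?thesis using form_familyD(6)[OF B(1), of x "\<lambda>k. u k \<cdot> x"] by simp
  qed
  ultimately show ?thesis
    using u B(2) by (intro exI[of _ u]) (auto simp: H_def)
qed

text \<open>Complements exchange meet and join. The dual homomorphism provides the operators going
  back: if an operator maps \<open>1 - P\<close> into \<open>1 - f P\<close>, its adjoint maps
  \<open>f P\<close> into \<open>P\<close>.\<close>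

lemma dual: "lat_hom ((\<lambda>P. id_blinfun - P) ` L) (\<lambda>X. id_blinfun - f (id_blinfun - X))"
proof -
  have compl: "(id_blinfun - P) o\<^sub>L (id_blinfun - Q) = id_blinfun - (P + Q - (P o\<^sub>L Q))"
    for P Q :: "'c::complex_hilbert \<Rightarrow>\<^sub>L 'c"
    by (rule blinfun_eqI) (simp add: blinfun.bilinear_simps)
  have compl': "(id_blinfun - P) + (id_blinfun - Q) - ((id_blinfun - P) o\<^sub>L (id_blinfun - Q)) = id_blinfun - (P o\<^sub>L Q)"
    for P Q :: "'c::complex_hilbert \<Rightarrow>\<^sub>L 'c"
    by (rule blinfun_eqI) (simp add: blinfun.bilinear_simps)
  have cp: "cproj ((\<lambda>P. id_blinfun - P) ` S)" if "cproj S" for S :: "('c::complex_hilbert \<Rightarrow>\<^sub>L 'c) set"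
    using that by (auto simp: cproj_def proj_compl compl add.commute)
  have im: "(\<lambda>X. id_blinfun - f (id_blinfun - X)) ` (\<lambda>P. id_blinfun - P) ` L = (\<lambda>P. id_blinfun - P) ` f ` L"
    by (auto simp: image_iff)
  show ?thesis
  proof
    show "cproj ((\<lambda>P. id_blinfun - P) ` L)" by (rule cp[OF cproj_L])
    show "cproj ((\<lambda>X. id_blinfun - f (id_blinfun - X)) ` (\<lambda>P. id_blinfun - P) ` L)"
      unfolding im by (rule cp[OF cproj_fL])
    show "0 \<in> (\<lambda>P. id_blinfun - P) ` L" "id_blinfun \<in> (\<lambda>P. id_blinfun - P) ` L"
      using zero one by (auto simp: image_iff intro!: bexI[of _ 0] bexI[of _ id_blinfun])
    show "id_blinfun - f (id_blinfun - 0) = 0" "id_blinfun - f (id_blinfun - id_blinfun) = id_blinfun"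
      by (simp_all add: zero one)
    fix X Y assume "X \<in> (\<lambda>P. id_blinfun - P) ` L" "Y \<in> (\<lambda>P. id_blinfun - P) ` L"
    then obtain P Q where PQ: "P \<in> L" "Q \<in> L" and XY: "X = id_blinfun - P" "Y = id_blinfun - Q"
      by blast
    show "X o\<^sub>L Y \<in> (\<lambda>P. id_blinfun - P) ` L" "X + Y - (X o\<^sub>L Y) \<in> (\<lambda>P. id_blinfun - P) ` L"
      unfolding XY compl' unfolding compl by (intro imageI join meet PQ)+
    show "id_blinfun - f (id_blinfun - (X o\<^sub>L Y)) =
        (id_blinfun - f (id_blinfun - X)) o\<^sub>L (id_blinfun - f (id_blinfun - Y))"
      unfolding XY compl by (simp add: join[OF PQ] compl)
    show "id_blinfun - f (id_blinfun - (X + Y - (X o\<^sub>L Y))) =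
        (id_blinfun - f (id_blinfun - X)) + (id_blinfun - f (id_blinfun - Y)) -
        ((id_blinfun - f (id_blinfun - X)) o\<^sub>L (id_blinfun - f (id_blinfun - Y)))"
      unfolding XY compl' by (simp add: meet[OF PQ] compl')
  qed
qed

text \<open>The bounds \<open>le1\<close> are what interpolation asks of \<open>f\<close>, and
  \<open>le2\<close> what it asks of the dual homomorphism. With \<open>v\<close> adjoint to
  \<open>w\<close>, the coefficient of the sum of products at \<xi> is the sum of the
  \<open>cinner (u k \<cdot> \<xi>) (w k \<cdot> \<xi>)\<close>, both columns being close to
  \<zeta>.\<close>

lemma factorization:
  fixes \<xi> :: 'a and \<zeta> :: "nat \<Rightarrow> 'b"
  assumes e: "0 \<le> e"
    and le1: "\<And>P. P \<in> L \<Longrightarrow> (\<Sum>k<n. (norm (\<zeta> k - f P \<cdot> \<zeta> k))\<^sup>2) \<le> (norm (\<xi> - P \<cdot> \<xi>))\<^sup>2 + e"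
    and le2: "\<And>P. P \<in> L \<Longrightarrow> (\<Sum>k<n. (norm (f P \<cdot> \<zeta> k))\<^sup>2) \<le> (norm (P \<cdot> \<xi>))\<^sup>2 + e"
    and ge: "(norm \<xi>)\<^sup>2 - e \<le> (\<Sum>k<n. (norm (\<zeta> k))\<^sup>2)"
  shows "\<exists>u v. (\<forall>k. u k \<in> bounded_ops \<and> v k \<in> bounded_ops) \<and>
    (\<forall>k. \<forall>P\<in>L. \<forall>x. f P \<cdot> u k \<cdot> P \<cdot> x = u k \<cdot> P \<cdot> x) \<and>
    (\<forall>k. \<forall>P\<in>L. \<forall>y. P \<cdot> v k \<cdot> f P \<cdot> y = v k \<cdot> f P \<cdot> y) \<and>
    (\<forall>x. norm (\<Sum>k<n. v k \<cdot> u k \<cdot> x) \<le> norm x) \<and>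
    (norm \<xi>)\<^sup>2 - 9 * e \<le> Re (cinner (\<Sum>k<n. v k \<cdot> u k \<cdot> \<xi>) \<xi>)"
proof -
  obtain u where u: "\<And>k. u k \<in> bounded_ops" "\<And>k P x. P \<in> L \<Longrightarrow> f P \<cdot> u k \<cdot> P \<cdot> x = u k \<cdot> P \<cdot> x"
    "\<And>x. (\<Sum>k<n. (norm (u k \<cdot> x))\<^sup>2) \<le> (norm x)\<^sup>2"
    "(\<Sum>k<n. (norm (\<zeta> k))\<^sup>2) - e \<le> Re (\<Sum>k<n. cinner (u k \<cdot> \<xi>) (\<zeta> k))"
    using interpolation[OF e le1] by blast
  interpret d: lat_hom "(\<lambda>P. id_blinfun - P) ` L" "\<lambda>X. id_blinfun - f (id_blinfun - X)"
    by (rule dual)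
  have "\<exists>w. (\<forall>k. w k \<in> bounded_ops) \<and>
    (\<forall>k. \<forall>P\<in>(\<lambda>P. id_blinfun - P) ` L. \<forall>x. (id_blinfun - f (id_blinfun - P)) \<cdot> w k \<cdot> P \<cdot> x = w k \<cdot> P \<cdot> x) \<and>
    (\<forall>x. (\<Sum>k<n. (norm (w k \<cdot> x))\<^sup>2) \<le> (norm x)\<^sup>2) \<and>
    (\<Sum>k<n. (norm (\<zeta> k))\<^sup>2) - e \<le> Re (\<Sum>k<n. cinner (w k \<cdot> \<xi>) (\<zeta> k))"
    by (rule d.interpolation[OF e]) (auto simp: blinfun.bilinear_simps le2)
  then obtain w where w: "\<And>k. w k \<in> bounded_ops"
    "\<And>k P x. P \<in> (\<lambda>P. id_blinfun - P) ` L \<Longrightarrow> (id_blinfun - f (id_blinfun - P)) \<cdot> w k \<cdot> P \<cdot> x = w k \<cdot> P \<cdot> x"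
    "\<And>x. (\<Sum>k<n. (norm (w k \<cdot> x))\<^sup>2) \<le> (norm x)\<^sup>2"
    "(\<Sum>k<n. (norm (\<zeta> k))\<^sup>2) - e \<le> Re (\<Sum>k<n. cinner (w k \<cdot> \<xi>) (\<zeta> k))"
    by blast
  have w2: "f P \<cdot> w k \<cdot> (x - P \<cdot> x) = 0" if "P \<in> L" for P k x
    using w(2)[OF imageI[OF that], of k x] by (simp add: blinfun.bilinear_simps)
  have "\<exists>v. (k < n \<longrightarrow> v \<in> bounded_ops \<and> (\<forall>y x. cinner (v \<cdot> y) x = cinner y (w k \<cdot> x)))" for k
  proof (cases "k < n")
    case True
    have "norm (w k \<cdot> x) \<le> norm x" for x
    proof (rule power2_le_imp_le)
      have "(norm (w k \<cdot> x))\<^sup>2 \<le> (\<Sum>k<n. (norm (w k \<cdot> x))\<^sup>2)"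
        using True by (intro member_le_sum) auto
      then show "(norm (w k \<cdot> x))\<^sup>2 \<le> (norm x)\<^sup>2" using w(3)[of x] by linarith
    qed simp
    then show ?thesis using adjoint_exists[OF w(1)] by blast
  qed simp
  then obtain v0 where v0: "\<And>k. k < n \<Longrightarrow> v0 k \<in> bounded_ops"
    "\<And>k y x. k < n \<Longrightarrow> cinner (v0 k \<cdot> y) x = cinner y (w k \<cdot> x)"
    by metis
  define v where "v = (\<lambda>k. if k < n then v0 k else 0)"
  have v: "v k \<in> bounded_ops" for k using v0 by (simp add: v_def bounded_ops_closed)
  have vw: "cinner (v k \<cdot> y) x = cinner y (w k \<cdot> x)" if "k < n" for k y x
    using v0(2) that by (simp add: v_def)
  have v2: "P \<cdot> v k \<cdot> f P \<cdot> y = v k \<cdot> f P \<cdot> y" if P: "P \<in> L" for P k y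
  proof (cases "k < n")
    case True
    have Pp: "P \<in> projections" "f P \<in> projections" using P cprojD[OF cproj_L] cprojD[OF cproj_fL] by auto
    have "cinner (v k \<cdot> f P \<cdot> y - P \<cdot> v k \<cdot> f P \<cdot> y) x = 0" for x
    proof -
      have "cinner (v k \<cdot> f P \<cdot> y - P \<cdot> v k \<cdot> f P \<cdot> y) x = cinner (v k \<cdot> f P \<cdot> y) (x - P \<cdot> x)"
        using projectionsD(3)[OF Pp(1)] by (simp add: cinner.diff_left cinner.diff_right)
      also have "\<dots> = cinner y (f P \<cdot> w k \<cdot> (x - P \<cdot> x))"
        by (simp add: vw[OF True] projectionsD(3)[OF Pp(2)])
      finally show ?thesis by (simp add: w2[OF P] cinner.zero_right)
    qed
    from eq_zero_if_orthogonal[OF this] show ?thesis by simp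
  qed (simp add: v_def)
  have form: "cinner (\<Sum>k<n. v k \<cdot> u k \<cdot> x) y = (\<Sum>k<n. cinner (u k \<cdot> x) (w k \<cdot> y))" for x y
    by (simp add: cinner.sum_left vw)
  have "norm (\<Sum>k<n. v k \<cdot> u k \<cdot> x) \<le> norm x" for x
  proof (rule power2_le_imp_le)
    \<comment> \<open>Pairing the sum with itself moves \<open>v\<close> over to \<open>w\<close>;
      the mean of squares then bounds \<open>|z|^2\<close> by half of
      \<open>|x|^2 + |z|^2\<close>.\<close>
    define z where "z = (\<Sum>k<n. v k \<cdot> u k \<cdot> x)"
    have "(norm z)\<^sup>2 = cmod (cinner z z)" by (simp add: cinner_self norm_power)
    also have "cinner z z = (\<Sum>k<n. cinner (u k \<cdot> x) (w k \<cdot> z))"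
      using form[of x z] by (simp add: z_def)
    also have "cmod \<dots> \<le> (\<Sum>k<n. ((norm (u k \<cdot> x))\<^sup>2 + (norm (w k \<cdot> z))\<^sup>2) / 2)"
    proof (rule sum_norm_le)
      fix k show "cmod (cinner (u k \<cdot> x) (w k \<cdot> z)) \<le> ((norm (u k \<cdot> x))\<^sup>2 + (norm (w k \<cdot> z))\<^sup>2) / 2"
        by (rule order_trans[OF cauchy_schwarz mult_le_mean_squares])
    qed
    also have "\<dots> = ((\<Sum>k<n. (norm (u k \<cdot> x))\<^sup>2) + (\<Sum>k<n. (norm (w k \<cdot> z))\<^sup>2)) / 2"
      by (simp only: sum.distrib sum_divide_distrib[symmetric])
    finally have "(norm z)\<^sup>2 \<le> ((\<Sum>k<n. (norm (u k \<cdot> x))\<^sup>2) + (\<Sum>k<n. (norm (w k \<cdot> z))\<^sup>2)) / 2" .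
    then show "(norm (\<Sum>k<n. v k \<cdot> u k \<cdot> x))\<^sup>2 \<le> (norm x)\<^sup>2"
      using u(3)[of x] w(3)[of z] unfolding z_def[symmetric] by argo
  qed simp
  moreover have "(norm \<xi>)\<^sup>2 - 9 * e \<le> Re (cinner (\<Sum>k<n. v k \<cdot> u k \<cdot> \<xi>) \<xi>)"
  proof -
    \<comment> \<open>The expansion of \<open>|x + y - 2 z|^2 \<ge> 0\<close>. Summed over the
      columns it gives a loss of \<open>6 * e\<close>, which the stated constant covers.\<close>
    have pt: "4 * Re (cinner x z) + 4 * Re (cinner y z) - 4 * (norm z)\<^sup>2 - (norm x)\<^sup>2 - (norm y)\<^sup>2
        \<le> 2 * Re (cinner x y)" for x y z :: 'b
      using zero_le_power2[of "norm ((x + y) - 2 *\<^sub>R z)"] unfolding norm_diff_sq norm_add_sq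
      by (simp add: cinner_scaleR_right cinner_add_left power_mult_distrib)
    have "(\<Sum>k<n. 4 * Re (cinner (u k \<cdot> \<xi>) (\<zeta> k)) + 4 * Re (cinner (w k \<cdot> \<xi>) (\<zeta> k)) - 4 * (norm (\<zeta> k))\<^sup>2
        - (norm (u k \<cdot> \<xi>))\<^sup>2 - (norm (w k \<cdot> \<xi>))\<^sup>2) \<le> (\<Sum>k<n. 2 * Re (cinner (u k \<cdot> \<xi>) (w k \<cdot> \<xi>)))"
      by (intro sum_mono pt)
    then have "4 * Re (\<Sum>k<n. cinner (u k \<cdot> \<xi>) (\<zeta> k)) + 4 * Re (\<Sum>k<n. cinner (w k \<cdot> \<xi>) (\<zeta> k))
        - 4 * (\<Sum>k<n. (norm (\<zeta> k))\<^sup>2) - (\<Sum>k<n. (norm (u k \<cdot> \<xi>))\<^sup>2) - (\<Sum>k<n. (norm (w k \<cdot> \<xi>))\<^sup>2)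
        \<le> 2 * Re (\<Sum>k<n. cinner (u k \<cdot> \<xi>) (w k \<cdot> \<xi>))"
      by (simp add: sum.distrib sum_subtractf sum_distrib_left)
    then show ?thesis
      using u(3)[of \<xi>] w(3)[of \<xi>] u(4) w(4) ge e unfolding form by linarith
  qed
  ultimately show ?thesis
    using u(1,2) v v2 by (intro exI[of _ u] exI[of _ v]) blast
qed

end

section \<open>Approximate transport of a vector along a lattice homomorphism\<close>

definition step :: "('a::complex_hilbert \<Rightarrow>\<^sub>L 'a) list \<Rightarrow> (bool list \<Rightarrow> real) \<Rightarrow> ('a \<Rightarrow>\<^sub>L 'a)" where
  "step Ps h = (\<Sum>s\<in>bits (length Ps). h s *\<^sub>R atom Ps s)"

text \<open>Positive contractions with finitely many values, generated by \<open>M\<close>. They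
  play the part of bounded densities, and their midpoint convexity drives the minimisation
  argument.\<close>

definition steps :: "('a::complex_hilbert \<Rightarrow>\<^sub>L 'a) set \<Rightarrow> ('a \<Rightarrow>\<^sub>L 'a) set" where
  "steps M = {step Ps h | Ps h. set Ps \<subseteq> M \<and> (\<forall>s. 0 \<le> h s \<and> h s \<le> 1)}"

lemma step_apply: "step Ps h \<cdot> x = (\<Sum>s\<in>bits (length Ps). h s *\<^sub>R atom Ps s \<cdot> x)"
  by (simp add: step_def sum_blinfun_apply blinfun.scaleR_left)

lemma norm_step:
  assumes "cproj (set Ps)"
  shows "(norm (step Ps h \<cdot> x))\<^sup>2 = (\<Sum>s\<in>bits (length Ps). (h s)\<^sup>2 * (norm (atom Ps s \<cdot> x))\<^sup>2)"
proof -
  have "(norm (step Ps h \<cdot> x))\<^sup>2 = (\<Sum>s\<in>bits (length Ps). (norm (h s *\<^sub>R atom Ps s \<cdot> x))\<^sup>2)"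
    unfolding step_apply using cinner_atoms[OF assms]
    by (intro norm_sum_orthogonal) (simp_all add: cinner_scaleR_left cinner_scaleR_right)
  then show ?thesis by (simp add: power_mult_distrib)
qed

lemma norm_steps_le:
  assumes "cproj M" "S \<in> steps M"
  shows "norm (S \<cdot> x) \<le> norm x"
proof -
  obtain Ps h where S: "S = step Ps h" "set Ps \<subseteq> M" "\<And>s. 0 \<le> h s" "\<And>s. h s \<le> 1"
    using assms(2) by (auto simp: steps_def)
  have c: "cproj (set Ps)" using cproj_subset[OF assms(1) S(2)] .
  have "(norm (S \<cdot> x))\<^sup>2 \<le> (\<Sum>s\<in>bits (length Ps). (norm (atom Ps s \<cdot> x))\<^sup>2)"
    unfolding S(1) norm_step[OF c]
  proof (rule sum_mono)
    fix s
    have "(h s)\<^sup>2 \<le> 1" using S(3,4) by (simp add: power_le_one)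
    then show "(h s)\<^sup>2 * (norm (atom Ps s \<cdot> x))\<^sup>2 \<le> (norm (atom Ps s \<cdot> x))\<^sup>2"
      using mult_right_mono[of "(h s)\<^sup>2" 1 "(norm (atom Ps s \<cdot> x))\<^sup>2"] by simp
  qed
  then have "(norm (S \<cdot> x))\<^sup>2 \<le> (norm x)\<^sup>2" by (simp add: norm_atoms[OF c])
  then show ?thesis by (rule power2_le_imp_le) simp
qed

lemma sum_bits_append: "(\<Sum>u\<in>bits (m + n). g u) = (\<Sum>s\<in>bits m. \<Sum>t\<in>bits n. g (s @ t) :: 'c :: comm_monoid_add)"
proof -
  have "(\<Sum>u\<in>bits (m + n). g u) = (\<Sum>p\<in>bits m \<times> bits n. g (fst p @ snd p))"
  proof (rule sum.reindex_bij_witness[of _ "\<lambda>p. fst p @ snd p" "\<lambda>u. (take m u, drop m u)"])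
  qed (auto simp: bits_def)
  then show ?thesis by (simp add: sum.cartesian_product split_def)
qed

lemma atom_append: "length s = length Ps \<Longrightarrow> atom (Ps @ Qs) (s @ t) \<cdot> x = atom Ps s \<cdot> atom Qs t \<cdot> x"
proof (induction Ps arbitrary: s)
  case (Cons P Ps)
  then show ?case by (cases s) auto
qed simp

text \<open>Refining the list leaves a step unchanged if its coefficients read only their own
  segment of the pattern. Any two steps thus have a common list.\<close>

lemma step_append1: "step (Ps @ Qs) (\<lambda>u. h (take (length Ps) u)) = step Ps h"
proof (rule blinfun_eqI)
  fix x
  have "step (Ps @ Qs) (\<lambda>u. h (take (length Ps) u)) \<cdot> x =
      (\<Sum>s\<in>bits (length Ps). \<Sum>t\<in>bits (length Qs). h s *\<^sub>R atom Ps s \<cdot> atom Qs t \<cdot> x)"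
    unfolding step_apply length_append sum_bits_append
    by (intro sum.cong refl) (simp add: atom_append bits_def)
  also have "\<dots> = (\<Sum>s\<in>bits (length Ps). h s *\<^sub>R atom Ps s \<cdot> (\<Sum>t\<in>bits (length Qs). atom Qs t \<cdot> x))"
    by (simp add: blinfun.sum_right scaleR_sum_right)
  finally show "step (Ps @ Qs) (\<lambda>u. h (take (length Ps) u)) \<cdot> x = step Ps h \<cdot> x"
    by (simp add: sum_atoms step_apply)
qed

lemma step_append2: "step (Ps @ Qs) (\<lambda>u. h (drop (length Ps) u)) = step Qs h"
proof (rule blinfun_eqI)
  fix x
  have "step (Ps @ Qs) (\<lambda>u. h (drop (length Ps) u)) \<cdot> x =
      (\<Sum>s\<in>bits (length Ps). \<Sum>t\<in>bits (length Qs). h t *\<^sub>R atom Ps s \<cdot> atom Qs t \<cdot> x)"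
    unfolding step_apply length_append sum_bits_append
    by (intro sum.cong refl) (simp add: atom_append bits_def)
  also have "\<dots> = (\<Sum>t\<in>bits (length Qs). h t *\<^sub>R (\<Sum>s\<in>bits (length Ps). atom Ps s \<cdot> atom Qs t \<cdot> x))"
    by (subst sum.swap) (simp add: scaleR_sum_right)
  finally show "step (Ps @ Qs) (\<lambda>u. h (drop (length Ps) u)) \<cdot> x = step Qs h \<cdot> x"
    by (simp add: sum_atoms step_apply)
qed

lemma steps_midpoint:
  assumes "S \<in> steps M" "T \<in> steps M"
  shows "(1/2) *\<^sub>R (S + T) \<in> steps M"
proof -
  obtain Ps h where S: "S = step Ps h" "set Ps \<subseteq> M" "\<And>s. 0 \<le> h s" "\<And>s. h s \<le> 1"
    using assms(1) by (auto simp: steps_def)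
  obtain Qs k where T: "T = step Qs k" "set Qs \<subseteq> M" "\<And>s. 0 \<le> k s" "\<And>s. k s \<le> 1"
    using assms(2) by (auto simp: steps_def)
  define g where "g = (\<lambda>u. (1/2) * (h (take (length Ps) u) + k (drop (length Ps) u)))"
  have "(1/2) *\<^sub>R (S + T) = step (Ps @ Qs) g"
    unfolding S(1) T(1) step_append1[of Ps Qs h, symmetric] step_append2[of Ps Qs k, symmetric]
    by (simp add: step_def g_def sum.distrib[symmetric] scaleR_sum_right scaleR_add_left[symmetric])
  moreover have "0 \<le> g s \<and> g s \<le> 1" for s
    using S(3)[of "take (length Ps) s"] S(4)[of "take (length Ps) s"]
      T(3)[of "drop (length Ps) s"] T(4)[of "drop (length Ps) s"] unfolding g_def by simp
  ultimately show ?thesis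
    unfolding steps_def using S(2) T(2) by (intro CollectI exI[of _ "Ps @ Qs"] exI[of _ g]) auto
qed

text \<open>\<open>R\<close> is the square root of \<open>S\<close>, taken on coefficients. It
  converts a density into vectors: \<open>R \<cdot> y\<close> carries the measure with density
  \<open>S\<close> relative to that of \<open>y\<close>.\<close>

lemma steps_sqrt:
  assumes M: "cproj M" "S \<in> steps M"
  obtains R where "\<And>D y. D \<in> projections \<Longrightarrow> (\<And>Q x. Q \<in> M \<Longrightarrow> D \<cdot> Q \<cdot> x = Q \<cdot> D \<cdot> x) \<Longrightarrow>
    (norm (D \<cdot> R \<cdot> y))\<^sup>2 = Re (cinner (S \<cdot> y) (D \<cdot> y))"
proof -
  obtain Ps h where S: "S = step Ps h" "set Ps \<subseteq> M" "\<And>s. 0 \<le> h s"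
    using M(2) by (auto simp: steps_def)
  have c: "cproj (set Ps)" using cproj_subset[OF M(1) S(2)] .
  show ?thesis
  proof (rule that[of "step Ps (\<lambda>s. sqrt (h s))"])
    fix D y assume D: "D \<in> projections" "\<And>Q x. Q \<in> M \<Longrightarrow> D \<cdot> Q \<cdot> x = Q \<cdot> D \<cdot> x"
    have DA: "D \<cdot> atom Ps s \<cdot> x = atom Ps s \<cdot> D \<cdot> x" for s x
      using D(2) S(2) by (intro atom_commute) auto
    have "(norm (D \<cdot> step Ps (\<lambda>s. sqrt (h s)) \<cdot> y))\<^sup>2 = (norm (step Ps (\<lambda>s. sqrt (h s)) \<cdot> D \<cdot> y))\<^sup>2"
      by (simp add: step_apply blinfun.bilinear_simps DA)
    also have "\<dots> = (\<Sum>s\<in>bits (length Ps). h s * (norm (atom Ps s \<cdot> D \<cdot> y))\<^sup>2)"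
      by (simp add: norm_step[OF c] S(3))
    also have "\<dots> = (\<Sum>s\<in>bits (length Ps). h s * Re (cinner (atom Ps s \<cdot> y) (D \<cdot> y)))"
    proof (intro sum.cong refl arg_cong2[of _ _ _ _ "(*)"])
      fix s
      have "cinner (atom Ps s \<cdot> y) (D \<cdot> y) = cinner (D \<cdot> atom Ps s \<cdot> y) (D \<cdot> y)"
        using projectionsD(2,3)[OF D(1)] by metis
      then show "(norm (atom Ps s \<cdot> D \<cdot> y))\<^sup>2 = Re (cinner (atom Ps s \<cdot> y) (D \<cdot> y))"
        by (simp add: DA norm_proj_sq[OF atom_proj[OF c]])
    qed
    also have "\<dots> = Re (cinner (S \<cdot> y) (D \<cdot> y))"
      by (simp add: S(1) step_apply cinner.sum_left cinner_scaleR_left)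
    finally show "(norm (D \<cdot> step Ps (\<lambda>s. sqrt (h s)) \<cdot> y))\<^sup>2 = Re (cinner (S \<cdot> y) (D \<cdot> y))" .
  qed
qed

section \<open>Densities with prescribed masses on finitely many projections\<close>

context lat_hom
begin

text \<open>The mass given to \<open>D\<close> by the measure of \<eta> with density
  \<open>S\<close>. It is linear in \<open>S\<close>, so the constraints built from it are
  convex.\<close>

definition mass :: "nat \<Rightarrow> (nat \<Rightarrow> 'b) \<Rightarrow> ('b \<Rightarrow>\<^sub>L 'b) \<Rightarrow> ('b \<Rightarrow>\<^sub>L 'b) \<Rightarrow> real" where
  "mass n \<eta> S D = (\<Sum>k<n. Re (cinner (S \<cdot> \<eta> k) (D \<cdot> \<eta> k)))"

text \<open>The upper bounds on \<open>f P\<close> and on its complement are exact, and only the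
  total mass is relaxed. Together they determine the mass of \<open>f P\<close> up to
  \<open>e\<close>.\<close>

definition feasible :: "real \<Rightarrow> 'a \<Rightarrow> nat \<Rightarrow> (nat \<Rightarrow> 'b) \<Rightarrow> ('a \<Rightarrow>\<^sub>L 'a) set \<Rightarrow> ('b \<Rightarrow>\<^sub>L 'b) set" where
  "feasible e \<xi> n \<eta> G = {S \<in> steps (f ` L). (norm \<xi>)\<^sup>2 - e \<le> mass n \<eta> S id_blinfun \<and>
     (\<forall>P\<in>G. mass n \<eta> S (f P) \<le> (norm (P \<cdot> \<xi>))\<^sup>2 \<and>
       mass n \<eta> S (id_blinfun - f P) \<le> (norm (\<xi> - P \<cdot> \<xi>))\<^sup>2)}"

text \<open>The density is the throughput of a station divided by its capacity. A generator
  corresponds to an upper set of patterns, so incoming arcs compare the throughput with the measure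
  of \<xi> on its complement, and outgoing arcs on the generator itself.\<close>

lemma feasible_nonempty:
  fixes \<xi> :: 'a and \<eta> :: "nat \<Rightarrow> 'b"
  assumes Ps: "set Ps \<subseteq> L"
    and le: "\<And>P Q. P \<in> L \<Longrightarrow> Q \<in> L \<Longrightarrow> (\<And>x. P \<cdot> Q \<cdot> x = Q \<cdot> x) \<Longrightarrow>
      (norm (P \<cdot> \<xi>))\<^sup>2 - (norm (Q \<cdot> \<xi>))\<^sup>2
        \<le> (\<Sum>k<n. (norm (f P \<cdot> \<eta> k))\<^sup>2) - (\<Sum>k<n. (norm (f Q \<cdot> \<eta> k))\<^sup>2) + e"
  shows "feasible e \<xi> n \<eta> (set Ps) \<noteq> {}"
proof -
  define W where "W = bits (length Ps)"
  have fin: "finite W" by (simp add: W_def)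
  define F where "F = (\<lambda>s. atom (map f Ps) s)"
  define a where "a = (\<lambda>s. (norm (atom Ps s \<cdot> \<xi>))\<^sup>2)"
  define b where "b = (\<lambda>t. \<Sum>k<n. (norm (F t \<cdot> \<eta> k))\<^sup>2)"
  have nn: "0 \<le> a s" "0 \<le> b s" for s by (auto simp: a_def b_def sum_nonneg)
  note cps = lists_cproj[OF Ps]
  show ?thesis
  proof (rule layered_transport[of W a b a "list_all2 (\<longrightarrow>)" "list_all2 (\<longrightarrow>)", OF fin nn nn(1)])
    fix p q A B B' C
    assume p: "\<And>i j. 0 \<le> p i j" "\<And>i j. p i j \<noteq> 0 \<Longrightarrow> i \<in> W \<and> j \<in> W \<and> list_all2 (\<longrightarrow>) i j"
      and q: "\<And>j i. 0 \<le> q j i" "\<And>j i. q j i \<noteq> 0 \<Longrightarrow> i \<in> W \<and> j \<in> W \<and> list_all2 (\<longrightarrow>) j i"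
      and p1: "\<And>i. i \<in> W \<Longrightarrow> (\<Sum>j\<in>W. p i j) \<le> a i"
      and pq: "\<And>j. j \<in> W \<Longrightarrow> (\<Sum>i\<in>W. p i j) = (\<Sum>i\<in>W. q j i)"
      and p2: "\<And>j. j \<in> W \<Longrightarrow> (\<Sum>i\<in>W. p i j) \<le> b j"
      and q2: "\<And>i. i \<in> W \<Longrightarrow> (\<Sum>j\<in>W. q j i) \<le> a i"
      and sub: "A \<subseteq> W" "B \<subseteq> W" "B' \<subseteq> W" "C \<subseteq> W"
      and cl: "\<And>i j. i \<in> A \<Longrightarrow> j \<in> W \<Longrightarrow> list_all2 (\<longrightarrow>) i j \<Longrightarrow> j \<in> B"
        "\<And>j i. j \<in> B' \<Longrightarrow> i \<in> W \<Longrightarrow> list_all2 (\<longrightarrow>) j i \<Longrightarrow> i \<in> C"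
      and cut: "sum a (W - A) + sum b (B - B') + sum a C \<le> (\<Sum>i\<in>W. \<Sum>j\<in>W. p i j)"
    have total: "(norm \<xi>)\<^sup>2 - e \<le> (\<Sum>i\<in>W. \<Sum>j\<in>W. p i j)"
    proof -
      \<comment> \<open>The closure properties give \<open>U \<subseteq> B\<close> and
        \<open>U' \<subseteq> C\<close>. The cut therefore costs at least \<open>a\<close> on the
        complement of \<open>U\<close>, plus \<open>b\<close> on \<open>U - U'\<close>, plus
        \<open>a\<close> on \<open>U \<inter> U'\<close>, and the hypothesis compares the last two
        with \<open>a\<close> on \<open>U\<close>.\<close>
      define U where "U = {t \<in> W. \<exists>s\<in>A. list_all2 (\<longrightarrow>) s t}"
      define U' where "U' = {t \<in> W. \<exists>s\<in>B'. list_all2 (\<longrightarrow>) s t}"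
      have up: "upset U (length Ps)" "upset U' (length Ps)"
        unfolding U_def U'_def W_def by (rule upset_closure)+
      then have upV: "upset (U \<inter> U') (length Ps)" by (auto simp: upset_def)
      obtain P where P: "P \<in> L" "P = (\<Sum>s\<in>U. atom Ps s)" "f P = (\<Sum>s\<in>U. atom (map f Ps) s)"
        using upset_sum[OF Ps up(1)] by blast
      obtain Q where Q: "Q \<in> L" "Q = (\<Sum>s\<in>U \<inter> U'. atom Ps s)" "f Q = (\<Sum>s\<in>U \<inter> U'. atom (map f Ps) s)"
        using upset_sum[OF Ps upV] by blast
      have UW: "U \<subseteq> W" "U' \<subseteq> W" by (auto simp: U_def U'_def)
      have finU: "finite U" "finite U'" using UW fin finite_subset by blast+
      have PQ: "P \<cdot> Q \<cdot> x = Q \<cdot> x" for x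
        unfolding P(2) Q(2) by (rule sum_atoms_mult[OF cps(1)]) (use UW in \<open>auto simp: W_def\<close>)
      have nP: "(norm (P \<cdot> \<xi>))\<^sup>2 = sum a U" and nQ: "(norm (Q \<cdot> \<xi>))\<^sup>2 = sum a (U \<inter> U')"
        unfolding P(2) Q(2) sum_blinfun_apply a_def
        by (rule norm_sum_atoms[OF cps(1)]; use UW in \<open>auto simp: W_def\<close>)+
      have nfP: "(\<Sum>k<n. (norm (f P \<cdot> \<eta> k))\<^sup>2) = sum b U"
        and nfQ: "(\<Sum>k<n. (norm (f Q \<cdot> \<eta> k))\<^sup>2) = sum b (U \<inter> U')"
      proof -
        have *: "(\<Sum>k<n. (norm ((\<Sum>s\<in>X. atom (map f Ps) s) \<cdot> \<eta> k))\<^sup>2) = sum b X" if "X \<subseteq> W" for X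
        proof -
          have "(\<Sum>k<n. (norm ((\<Sum>s\<in>X. atom (map f Ps) s) \<cdot> \<eta> k))\<^sup>2) =
              (\<Sum>k<n. \<Sum>s\<in>X. (norm (F s \<cdot> \<eta> k))\<^sup>2)"
            unfolding sum_blinfun_apply F_def using that
            by (intro sum.cong refl norm_sum_atoms[OF cps(2)]) (simp add: W_def)
          also have "\<dots> = sum b X" unfolding b_def by (rule sum.swap)
          finally show ?thesis .
        qed
        show "(\<Sum>k<n. (norm (f P \<cdot> \<eta> k))\<^sup>2) = sum b U"
          "(\<Sum>k<n. (norm (f Q \<cdot> \<eta> k))\<^sup>2) = sum b (U \<inter> U')"
          unfolding P(3) Q(3) using UW by (auto intro!: *)
      qed
      have AU: "A \<subseteq> U" "B' \<subseteq> U'"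
        using sub by (auto simp: U_def U'_def intro!: bexI list_all2_refl)
      have "sum a (W - U) \<le> sum a (W - A)"
        using fin nn AU by (intro sum_mono2) auto
      moreover have "sum a (W - U) = (norm \<xi>)\<^sup>2 - sum a U"
        using sum.subset_diff[OF UW(1) fin, of a] norm_atoms[OF cps(1), of \<xi>] by (simp add: a_def W_def)
      moreover have "sum b (U - U') \<le> sum b (B - B')"
      proof (rule sum_mono2)
        show "finite (B - B')" using sub fin finite_subset by blast
        have "U \<subseteq> B" using cl(1) by (auto simp: U_def)
        then show "U - U' \<subseteq> B - B'" using AU by blast
      qed (use nn in auto)
      moreover have "sum b U = sum b (U - U') + sum b (U \<inter> U')"
        using sum.subset_diff[of "U \<inter> U'" U b] finU by (simp add: Diff_Int_distrib2 Diff_Int)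
      moreover have "sum a (U \<inter> U') \<le> sum a C"
      proof (rule sum_mono2)
        show "finite C" using sub fin finite_subset by blast
        show "U \<inter> U' \<subseteq> C" using cl(2) by (auto simp: U'_def)
      qed (use nn in auto)
      moreover have "sum a U - sum a (U \<inter> U') \<le> sum b U - sum b (U \<inter> U') + e"
        using le[OF P(1) Q(1) PQ] by (simp only: nP nQ nfP nfQ)
      ultimately show ?thesis using cut by linarith
    qed
    define l where "l = (\<lambda>t. \<Sum>s\<in>W. p s t)"
    \<comment> \<open>Zero where the capacity vanishes; the throughput vanishes there as well, so
      \<open>h t * b t = l t\<close> holds throughout \<open>W\<close>.\<close>
    define h where "h = (\<lambda>t. if t \<in> W then l t / b t else 0)"
    have l0: "0 \<le> l t" for t using p(1) by (auto simp: l_def sum_nonneg)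
    have lb: "l t \<le> b t" if "t \<in> W" for t using p2[OF that] by (simp add: l_def)
    have h: "0 \<le> h t" "h t \<le> 1" for t
      using l0[of t] lb[of t] nn[of t] by (auto simp: h_def divide_le_eq_1)
    have hb: "h t * b t = l t" if "t \<in> W" for t
      using that l0[of t] lb[of t] by (auto simp: h_def)
    define S where "S = step (map f Ps) h"
    have "S \<in> steps (f ` L)"
      unfolding steps_def S_def using Ps h by (intro CollectI exI[of _ "map f Ps"] exI[of _ h]) auto
    have Fp: "F s \<in> projections" for s using atom_proj[OF cps(2)] by (simp add: F_def)
    have massX: "mass n \<eta> S D = sum l X"
      if X: "X \<subseteq> W" and D: "\<And>s y. s \<in> W \<Longrightarrow> cinner (F s \<cdot> y) (D \<cdot> y) = (if s \<in> X then cinner (F s \<cdot> y) y else 0)" for X D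
    proof -
      have "mass n \<eta> S D = (\<Sum>k<n. \<Sum>s\<in>W. h s * Re (cinner (F s \<cdot> \<eta> k) (D \<cdot> \<eta> k)))"
        by (simp add: mass_def S_def step_apply cinner.sum_left cinner_scaleR_left W_def F_def)
      also have "\<dots> = (\<Sum>k<n. \<Sum>s\<in>X. h s * (norm (F s \<cdot> \<eta> k))\<^sup>2)"
        by (intro sum.cong refl sum.mono_neutral_cong_right)
          (use X fin D in \<open>auto simp: norm_proj_sq[OF Fp]\<close>)
      also have "\<dots> = (\<Sum>s\<in>X. h s * b s)"
        by (subst sum.swap) (simp add: b_def sum_distrib_left)
      also have "\<dots> = sum l X" using X hb by (intro sum.cong) auto
      finally show ?thesis .
    qed
    have "mass n \<eta> S id_blinfun = sum l W" by (rule massX) auto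
    also have "sum l W = (\<Sum>i\<in>W. \<Sum>j\<in>W. p i j)" unfolding l_def by (rule sum.swap)
    finally have m1: "(norm \<xi>)\<^sup>2 - e \<le> mass n \<eta> S id_blinfun" using total by simp
    have m2: "mass n \<eta> S (f P) \<le> (norm (P \<cdot> \<xi>))\<^sup>2 \<and> mass n \<eta> S (id_blinfun - f P) \<le> (norm (\<xi> - P \<cdot> \<xi>))\<^sup>2"
      if PPs: "P \<in> set Ps" for P
    proof -
      obtain i where i: "i < length Ps" "P = Ps ! i" using PPs by (metis in_set_conv_nth)
      have PL: "P \<in> projections" "f P \<in> projections"
        using PPs Ps cprojD[OF cproj_L] cprojD[OF cproj_fL] by auto
      define X where "X = {s \<in> W. s ! i}"
      have XW: "X \<subseteq> W" by (auto simp: X_def)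
      have finX: "finite X" using XW fin finite_subset by blast
      have imp: "s ! i \<longrightarrow> t ! i" if "list_all2 (\<longrightarrow>) s t" "s \<in> W" for s t
        using that i by (auto simp: list_all2_conv_all_nth W_def bits_def)
      have fPF: "cinner (F s \<cdot> y) (f P \<cdot> y) = (if s \<in> X then cinner (F s \<cdot> y) y else 0)" if "s \<in> W" for s y
      proof -
        have "cinner (F s \<cdot> y) (f P \<cdot> y) = cinner (f P \<cdot> F s \<cdot> y) y"
          by (simp add: projectionsD(3)[OF PL(2)])
        then show ?thesis
          using atom_in[OF cps(2), of i s y] i that by (simp add: X_def F_def W_def cinner.zero_left)
      qed
      have "mass n \<eta> S (f P) = sum l X" by (rule massX[OF XW fPF])
      moreover have "mass n \<eta> S (id_blinfun - f P) = sum l (W - X)"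
        by (rule massX) (auto simp: blinfun.bilinear_simps cinner.diff_right fPF)
      moreover have aP: "P \<cdot> \<xi> = (\<Sum>s\<in>X. atom Ps s \<cdot> \<xi>)"
      proof -
        have "P \<cdot> \<xi> = (\<Sum>s\<in>W. P \<cdot> atom Ps s \<cdot> \<xi>)"
          by (simp add: W_def sum_atoms flip: blinfun.sum_right)
        also have "\<dots> = (\<Sum>s\<in>X. atom Ps s \<cdot> \<xi>)"
          using atom_in[OF cps(1) i(1)] i(2) by (intro sum.mono_neutral_cong_right fin XW) (auto simp: X_def W_def)
        finally show ?thesis .
      qed
      then have "(norm (P \<cdot> \<xi>))\<^sup>2 = sum a X"
        using norm_sum_atoms[OF cps(1)] XW by (simp add: a_def W_def)
      moreover have "(norm (\<xi> - P \<cdot> \<xi>))\<^sup>2 = sum a (W - X)"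
      proof -
        have "\<xi> = (\<Sum>s\<in>W - X. atom Ps s \<cdot> \<xi>) + (\<Sum>s\<in>X. atom Ps s \<cdot> \<xi>)"
          using sum.subset_diff[OF XW fin, of "\<lambda>s. atom Ps s \<cdot> \<xi>"] by (simp add: W_def sum_atoms)
        then have "\<xi> - P \<cdot> \<xi> = (\<Sum>s\<in>W - X. atom Ps s \<cdot> \<xi>)" unfolding aP by (metis add_diff_cancel_right')
        then show ?thesis using norm_sum_atoms[OF cps(1), of "W - X"] by (simp add: a_def W_def)
      qed
      moreover have "sum l X \<le> sum a X"
      proof -
        have "sum l X = (\<Sum>t\<in>X. \<Sum>s\<in>W. q t s)"
          unfolding l_def by (rule sum.cong) (use pq XW in auto)
        \<comment> \<open>\<open>X\<close> is an upper set, so outgoing arcs that start in it end in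
          it. Dually, incoming arcs that end outside it start outside it.\<close>
        also have "\<dots> = (\<Sum>t\<in>X. \<Sum>s\<in>X. q t s)"
          using q(2) imp XW fin by (intro sum.cong sum.mono_neutral_right refl) (auto simp: X_def)
        also have "\<dots> = (\<Sum>s\<in>X. \<Sum>t\<in>X. q t s)" by (rule sum.swap)
        also have "\<dots> \<le> (\<Sum>s\<in>X. \<Sum>t\<in>W. q t s)"
          using q(1) XW fin by (intro sum_mono sum_mono2) auto
        also have "\<dots> \<le> sum a X" using q2 XW by (intro sum_mono) auto
        finally show ?thesis .
      qed
      moreover have "sum l (W - X) \<le> sum a (W - X)"
      proof -
        have "sum l (W - X) = (\<Sum>t\<in>W - X. \<Sum>s\<in>W - X. p s t)"
          unfolding l_def using p(2) imp fin by (intro sum.cong sum.mono_neutral_right refl) (auto simp: X_def)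
        also have "\<dots> = (\<Sum>s\<in>W - X. \<Sum>t\<in>W - X. p s t)" by (rule sum.swap)
        also have "\<dots> \<le> (\<Sum>s\<in>W - X. \<Sum>t\<in>W. p s t)"
          using p(1) fin by (intro sum_mono sum_mono2) auto
        also have "\<dots> \<le> sum a (W - X)" using p1 by (intro sum_mono) auto
        finally show ?thesis .
      qed
      ultimately show ?thesis by simp
    qed
    show ?thesis
      using \<open>S \<in> steps (f ` L)\<close> m1 m2 by (auto simp: feasible_def)
  qed
qed

text \<open>Elements of almost minimal norm of the convex sets \<open>feasible\<close> are almost unique, so a
  single one of them almost satisfies the constraints for all \<open>P\<close> at once.\<close>

theorem approximate_transport:
  fixes \<xi> :: 'a and \<eta> :: "nat \<Rightarrow> 'b"
  assumes e: "0 < e"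
    and le: "\<And>P Q. P \<in> L \<Longrightarrow> Q \<in> L \<Longrightarrow> (\<And>x. P \<cdot> Q \<cdot> x = Q \<cdot> x) \<Longrightarrow>
      (norm (P \<cdot> \<xi>))\<^sup>2 - (norm (Q \<cdot> \<xi>))\<^sup>2
        \<le> (\<Sum>k<n. (norm (f P \<cdot> \<eta> k))\<^sup>2) - (\<Sum>k<n. (norm (f Q \<cdot> \<eta> k))\<^sup>2) + e"
  shows "\<exists>\<zeta>. (\<forall>P\<in>L. (\<Sum>k<n. (norm (\<zeta> k - f P \<cdot> \<zeta> k))\<^sup>2) \<le> (norm (\<xi> - P \<cdot> \<xi>))\<^sup>2 + e \<and>
      (\<Sum>k<n. (norm (f P \<cdot> \<zeta> k))\<^sup>2) \<le> (norm (P \<cdot> \<xi>))\<^sup>2 + e) \<and>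
    (norm \<xi>)\<^sup>2 - e \<le> (\<Sum>k<n. (norm (\<zeta> k))\<^sup>2)"
proof -
  define N where "N = (\<lambda>S :: 'b \<Rightarrow>\<^sub>L 'b. \<Sum>k<n. (norm (S \<cdot> \<eta> k))\<^sup>2)"
  define C where "C = (\<lambda>Ps. feasible e \<xi> n \<eta> (set Ps))"
  define d where "d = (\<lambda>Ps. Inf (N ` C Ps))"
  define D where "D = Sup (d ` {Ps. set Ps \<subseteq> L})"
  define K where "K = (\<Sum>k<n. (norm (\<eta> k))\<^sup>2)"
  have K0: "0 \<le> K" by (simp add: K_def sum_nonneg)
  \<comment> \<open>Chosen so that \<open>8 * \<delta> * (K + 1) = e\<^sup>2\<close>: the factor 8
    comes from the parallelogram law and \<open>K\<close> from the Cauchy-Schwarz inequality. The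
    added 1 keeps the denominator positive.\<close>
  define \<delta> where "\<delta> = e\<^sup>2 / (8 * (K + 1))"
  have \<delta>: "\<delta> > 0" using e K0 by (simp add: \<delta>_def)
  have ne: "C Ps \<noteq> {}" if "set Ps \<subseteq> L" for Ps
    unfolding C_def by (rule feasible_nonempty[OF that le])
  have N0: "0 \<le> N S" for S by (simp add: N_def sum_nonneg)
  have bdd: "bdd_below (N ` X)" for X using N0 by (auto intro!: bdd_belowI[of _ 0])
  have dle: "d Ps \<le> N S" if "S \<in> C Ps" for Ps S
    unfolding d_def using that bdd by (auto intro!: cInf_lower)
  have steps: "S \<in> steps (f ` L)" if "S \<in> C Ps" for S Ps
    using that by (simp add: C_def feasible_def)
  have NK: "N S \<le> K" if "S \<in> C Ps" for S Ps
    unfolding N_def K_def using norm_steps_le[OF cproj_fL steps[OF that]]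
    by (intro sum_mono power_mono) auto
  have dK: "d Ps \<le> K" if "set Ps \<subseteq> L" for Ps
    using ne[OF that] dle NK by (metis ex_in_conv order_trans)
  have dD: "d Ps \<le> D" if "set Ps \<subseteq> L" for Ps
    unfolding D_def using that dK by (intro cSup_upper) (auto intro!: bdd_aboveI[of _ K])
  have "D - \<delta> < D" using \<delta> by simp
  then obtain Ps where Ps: "set Ps \<subseteq> L" "D - \<delta> < d Ps"
    using less_cSupD[of "d ` {Ps. set Ps \<subseteq> L}" "D - \<delta>"] exI[of "\<lambda>Ps. set Ps \<subseteq> L" "[]"]
    by (auto simp: D_def)
  have near: "\<exists>S\<in>C Qs. N S < D + \<delta>" if "set Qs \<subseteq> L" for Qs
  proof -
    have "Inf (N ` C Qs) < D + \<delta>" using dD[OF that] \<delta> by (simp add: d_def)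
    then show ?thesis using cInf_lessD[of "N ` C Qs"] ne[OF that] by blast
  qed
  obtain S where S: "S \<in> C Ps" "N S < D + \<delta>" using near[OF Ps(1)] by blast
  have mass_lin: "mass n \<eta> (S + T) X = mass n \<eta> S X + mass n \<eta> T X"
    "mass n \<eta> (r *\<^sub>R T) X = r * mass n \<eta> T X" "mass n \<eta> (S - T) X = mass n \<eta> S X - mass n \<eta> T X" for S T X r
    by (simp_all add: mass_def blinfun.bilinear_simps cinner_add_left cinner.diff_left cinner_scaleR_left
        sum.distrib sum_subtractf sum_distrib_left)
  have close: "\<bar>mass n \<eta> S X - mass n \<eta> T X\<bar> \<le> e" if T: "T \<in> C Ps" "N T < D + \<delta>" and X: "X \<in> projections" for T X
  proof -
    have "(1/2) *\<^sub>R (S + T) \<in> C Ps"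
      unfolding C_def feasible_def mem_Collect_eq mass_lin
    proof (intro conjI ballI)
      have mid: "a \<le> c \<Longrightarrow> b \<le> c \<Longrightarrow> 1 / 2 * (a + b) \<le> c" "c \<le> a \<Longrightarrow> c \<le> b \<Longrightarrow> c \<le> 1 / 2 * (a + b)"
        for a b c :: real by argo+
      show "(norm \<xi>)\<^sup>2 - e \<le> 1 / 2 * (mass n \<eta> S id_blinfun + mass n \<eta> T id_blinfun)"
        using S(1) T(1) by (intro mid) (simp_all add: C_def feasible_def)
      fix P assume "P \<in> set Ps"
      then show "1 / 2 * (mass n \<eta> S (f P) + mass n \<eta> T (f P)) \<le> (norm (P \<cdot> \<xi>))\<^sup>2"
        "1 / 2 * (mass n \<eta> S (id_blinfun - f P) + mass n \<eta> T (id_blinfun - f P)) \<le> (norm (\<xi> - P \<cdot> \<xi>))\<^sup>2"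
        using S(1) T(1) by (intro mid; simp add: C_def feasible_def)+
    qed (rule steps_midpoint[OF steps[OF S(1)] steps[OF T(1)]])
    \<comment> \<open>The midpoint is again feasible, so its squared norm is at least the infimum.
      The parallelogram law leaves less than \<open>8 * \<delta>\<close> for the difference of
      \<open>S\<close> and \<open>T\<close>.\<close>
    from dle[OF this] have "d Ps \<le> N (S + T) / 4"
      by (simp add: N_def blinfun.bilinear_simps power_mult_distrib sum_distrib_left[symmetric] power_divide
          sum_divide_distrib[symmetric])
    moreover have "N (S + T) + N (S - T) = 2 * N S + 2 * N T"
      by (simp add: N_def blinfun.bilinear_simps sum.distrib[symmetric] sum_distrib_left parallelogram)
    ultimately have NST: "N (S - T) < 8 * \<delta>" using S(2) T(2) Ps(2) by argo
    have "\<bar>mass n \<eta> (S - T) X\<bar> \<le> (\<Sum>k<n. norm ((S - T) \<cdot> \<eta> k) * norm (\<eta> k))"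
      unfolding mass_def real_norm_def[symmetric]
    proof (rule sum_norm_le)
      fix k
      have "norm (Re (cinner ((S - T) \<cdot> \<eta> k) (X \<cdot> \<eta> k))) \<le> cmod (cinner ((S - T) \<cdot> \<eta> k) (X \<cdot> \<eta> k))"
        by (simp add: abs_Re_le_cmod)
      also have "\<dots> \<le> norm ((S - T) \<cdot> \<eta> k) * norm (X \<cdot> \<eta> k)" by (rule cauchy_schwarz)
      also have "\<dots> \<le> norm ((S - T) \<cdot> \<eta> k) * norm (\<eta> k)"
        by (intro mult_left_mono norm_proj_le X) simp
      finally show "norm (Re (cinner ((S - T) \<cdot> \<eta> k) (X \<cdot> \<eta> k))) \<le> norm ((S - T) \<cdot> \<eta> k) * norm (\<eta> k)" .
    qed
    then have "(\<bar>mass n \<eta> (S - T) X\<bar>)\<^sup>2 \<le> (\<Sum>k<n. norm ((S - T) \<cdot> \<eta> k) * norm (\<eta> k))\<^sup>2"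
      by (rule power_mono) simp
    also have "\<dots> \<le> N (S - T) * K"
      unfolding N_def K_def by (rule Cauchy_Schwarz_ineq_sum)
    also have "\<dots> \<le> (8 * \<delta>) * (K + 1)"
      using NST K0 N0 \<delta> by (intro mult_mono) auto
    also have "\<dots> = e\<^sup>2"
    proof -
      have "8 * (K + 1) \<noteq> 0" using K0 by simp
      then have "\<delta> * (8 * (K + 1)) = e\<^sup>2" unfolding \<delta>_def by (simp only: times_divide_eq_left nonzero_mult_div_cancel_right not_False_eq_True)
      then show ?thesis by (simp only: mult_ac)
    qed
    finally have "\<bar>mass n \<eta> (S - T) X\<bar> \<le> e" by (rule power2_le_imp_le) (use e in simp)
    then show ?thesis by (simp add: mass_lin)
  qed
  have all: "mass n \<eta> S (f P) \<le> (norm (P \<cdot> \<xi>))\<^sup>2 + e \<and> mass n \<eta> S (id_blinfun - f P) \<le> (norm (\<xi> - P \<cdot> \<xi>))\<^sup>2 + e"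
    if P: "P \<in> L" for P
  proof -
    have "set (P # Ps) \<subseteq> L" using P Ps by simp
    then obtain T where T: "T \<in> C (P # Ps)" "N T < D + \<delta>" using near by blast
    have TC: "T \<in> C Ps" using T(1) by (auto simp: C_def feasible_def)
    have fP: "f P \<in> projections" using P cprojD[OF cproj_fL] by auto
    have "mass n \<eta> T (f P) \<le> (norm (P \<cdot> \<xi>))\<^sup>2" "mass n \<eta> T (id_blinfun - f P) \<le> (norm (\<xi> - P \<cdot> \<xi>))\<^sup>2"
      using T(1) by (auto simp: C_def feasible_def)
    then show ?thesis
      using close[OF TC T(2) fP] close[OF TC T(2) proj_compl[OF fP]] by linarith
  qed
  obtain R where R: "\<And>D y. D \<in> projections \<Longrightarrow> (\<And>Q x. Q \<in> f ` L \<Longrightarrow> D \<cdot> Q \<cdot> x = Q \<cdot> D \<cdot> x) \<Longrightarrow>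
    (norm (D \<cdot> R \<cdot> y))\<^sup>2 = Re (cinner (S \<cdot> y) (D \<cdot> y))"
    using steps_sqrt[OF cproj_fL steps[OF S(1)]] by blast
  have Rm: "(\<Sum>k<n. (norm (X \<cdot> R \<cdot> \<eta> k))\<^sup>2) = mass n \<eta> S X"
    if "X \<in> projections" "\<And>Q x. Q \<in> f ` L \<Longrightarrow> X \<cdot> Q \<cdot> x = Q \<cdot> X \<cdot> x" for X
    using R[OF that] by (simp add: mass_def)
  have comm: "f P \<cdot> Q \<cdot> x = Q \<cdot> f P \<cdot> x" if "P \<in> L" "Q \<in> f ` L" for P Q x
    using cproj_commute[OF cproj_fL] that by blast
  show ?thesis
  proof (intro exI[of _ "\<lambda>k. R \<cdot> \<eta> k"] conjI ballI)
    fix P assume P: "P \<in> L"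
    have fP: "f P \<in> projections" using P cprojD[OF cproj_fL] by auto
    show "(\<Sum>k<n. (norm (f P \<cdot> R \<cdot> \<eta> k))\<^sup>2) \<le> (norm (P \<cdot> \<xi>))\<^sup>2 + e"
      using Rm[OF fP comm[OF P]] all[OF P] by simp
    have "(\<Sum>k<n. (norm ((id_blinfun - f P) \<cdot> R \<cdot> \<eta> k))\<^sup>2) = mass n \<eta> S (id_blinfun - f P)"
      by (rule Rm[OF proj_compl[OF fP]]) (simp add: blinfun.bilinear_simps comm[OF P])
    then show "(\<Sum>k<n. (norm (R \<cdot> \<eta> k - f P \<cdot> R \<cdot> \<eta> k))\<^sup>2) \<le> (norm (\<xi> - P \<cdot> \<xi>))\<^sup>2 + e"
      using all[OF P] by (simp add: blinfun.bilinear_simps)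
  next
    have "(\<Sum>k<n. (norm (id_blinfun \<cdot> R \<cdot> \<eta> k))\<^sup>2) = mass n \<eta> S id_blinfun"
      by (rule Rm[OF id_proj]) simp
    then show "(norm \<xi>)\<^sup>2 - e \<le> (\<Sum>k<n. (norm (R \<cdot> \<eta> k))\<^sup>2)"
      using S(1) by (simp add: C_def feasible_def)
  qed
qed

end

section \<open>Modular functionals on complete lattices\<close>

text \<open>Convergence of the net that is indexed by the directed set itself. Nets are needed
  because the lattices may have uncountable directed families without a cofinal sequence.\<close>

definition tail_filter :: "('d \<Rightarrow> 'd \<Rightarrow> bool) \<Rightarrow> 'd set \<Rightarrow> 'd filter" where
  "tail_filter le D = (INF d\<in>D. principal {d' \<in> D. le d d'})"

definition directed :: "('d \<Rightarrow> 'd \<Rightarrow> bool) \<Rightarrow> 'd set \<Rightarrow> bool" where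
  "directed le D \<longleftrightarrow> D \<noteq> {} \<and> (\<forall>x\<in>D. \<forall>y\<in>D. \<exists>z\<in>D. le x z \<and> le y z)"

lemma eventually_tail:
  assumes "directed le D" "\<And>x y z. le x y \<Longrightarrow> le y z \<Longrightarrow> le x z"
  shows "eventually Q (tail_filter le D) \<longleftrightarrow> (\<exists>d\<in>D. \<forall>d'\<in>D. le d d' \<longrightarrow> Q d')"
proof -
  have "eventually Q (tail_filter le D) \<longleftrightarrow> (\<exists>d\<in>D. eventually Q (principal {d' \<in> D. le d d'}))"
    unfolding tail_filter_def
  proof (rule eventually_INF_base)
    show "D \<noteq> {}" using assms(1) by (simp add: directed_def)
    fix a b assume "a \<in> D" "b \<in> D"
    then obtain x where "x \<in> D" "le a x" "le b x" using assms(1) unfolding directed_def by blast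
    then show "\<exists>x\<in>D. principal {d' \<in> D. le x d'} \<le> inf (principal {d' \<in> D. le a d'}) (principal {d' \<in> D. le b d'})"
      using assms(2) by (intro bexI[of _ x]) auto
  qed
  then show ?thesis by (auto simp: eventually_principal)
qed

lemma tail_limit_close:
  fixes g :: "'d \<Rightarrow> real"
  assumes "directed le D" "\<And>x y z. le x y \<Longrightarrow> le y z \<Longrightarrow> le x z"
    and "(g \<longlongrightarrow> l) (tail_filter le D)" "0 < e"
  shows "\<exists>d\<in>D. \<forall>d'\<in>D. le d d' \<longrightarrow> \<bar>g d' - l\<bar> < e"
  using tendstoD[OF assms(3,4)] eventually_tail[OF assms(1,2)] by (simp add: dist_real_def)

text \<open>For functionals that are modular and order continuous, minimax holds without convexity:
  joins of almost maximisers are almost maximisers.\<close>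

locale modular_functionals =
  fixes X :: "'x set" and le :: "'x \<Rightarrow> 'x \<Rightarrow> bool" and join meet :: "'x \<Rightarrow> 'x \<Rightarrow> 'x"
    and c :: "'n::comm_monoid_add \<Rightarrow> 'x \<Rightarrow> real"
  assumes le_refl: "le x x" and le_trans: "le x y \<Longrightarrow> le y z \<Longrightarrow> le x z"
    and join: "x \<in> X \<Longrightarrow> y \<in> X \<Longrightarrow> join x y \<in> X" "x \<in> X \<Longrightarrow> y \<in> X \<Longrightarrow> le x (join x y)"
      "x \<in> X \<Longrightarrow> y \<in> X \<Longrightarrow> le y (join x y)"
      "x \<in> X \<Longrightarrow> y \<in> X \<Longrightarrow> z \<in> X \<Longrightarrow> le x z \<Longrightarrow> le y z \<Longrightarrow> le (join x y) z"
    and meet: "x \<in> X \<Longrightarrow> y \<in> X \<Longrightarrow> meet x y \<in> X"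
    and modular: "x \<in> X \<Longrightarrow> y \<in> X \<Longrightarrow> c N (join x y) + c N (meet x y) = c N x + c N y"
    and anti: "x \<in> X \<Longrightarrow> c (N + N') x \<le> c N x"
    and dsup: "D \<subseteq> X \<Longrightarrow> directed le D \<Longrightarrow> \<exists>z\<in>X. (\<forall>d\<in>D. le d z) \<and>
      (\<forall>u\<in>X. (\<forall>d\<in>D. le d u) \<longrightarrow> le z u) \<and> (\<forall>N. (c N \<longlongrightarrow> c N z) (tail_filter le D))"
    and dinf: "D \<subseteq> X \<Longrightarrow> directed (\<lambda>x y. le y x) D \<Longrightarrow> \<exists>z\<in>X. (\<forall>d\<in>D. le z d) \<and>
      (\<forall>N. (c N \<longlongrightarrow> c N z) (tail_filter (\<lambda>x y. le y x) D))"
begin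

lemma close_up:
  fixes g :: "'x \<Rightarrow> real"
  assumes "directed le D" "(g \<longlongrightarrow> l) (tail_filter le D)" "0 < e"
  shows "\<exists>d\<in>D. \<forall>d'\<in>D. le d d' \<longrightarrow> \<bar>g d' - l\<bar> < e"
  using assms(1) _ assms(2,3) by (rule tail_limit_close) (rule le_trans)

lemma close_down:
  fixes g :: "'x \<Rightarrow> real"
  assumes "directed (\<lambda>x y. le y x) D" "(g \<longlongrightarrow> l) (tail_filter (\<lambda>x y. le y x) D)" "0 < e"
  shows "\<exists>d\<in>D. \<forall>d'\<in>D. le d' d \<longrightarrow> \<bar>g d' - l\<bar> < e"
  using assms(1) _ assms(2,3) by (rule tail_limit_close) (rule le_trans)

text \<open>By the two hypotheses \<open>s\<close> is the infimum over \<open>N\<close> of the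
  suprema of \<open>c N\<close>. An upper limit of near maximisers attains \<open>s\<close> along
  one countable chain of indices above a given \<open>N\<close>; the greatest such points decrease
  in \<open>N\<close>, and their infimum serves all indices.\<close>

lemma uniform_maximiser:
  assumes sup: "\<And>N e. 0 < e \<Longrightarrow> \<exists>x\<in>X. s - e \<le> c N x"
    and inf: "\<And>e. 0 < e \<Longrightarrow> \<exists>N. \<forall>x\<in>X. c N x \<le> s + e"
  shows "\<exists>w\<in>X. \<forall>N. s \<le> c N w"
proof -
  define r where "r = (\<lambda>n. (1/2::real) ^ n)"
  have r: "0 < r n" "r (Suc n) * 2 = r n" for n by (simp_all add: r_def)
  have r0: "r \<longlonglongrightarrow> 0" unfolding r_def by (rule LIMSEQ_power_zero) simp
  obtain M0 where M0: "\<And>n x. x \<in> X \<Longrightarrow> c (M0 n) x \<le> s + r n"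
    using inf[OF r(1)] by metis
  \<comment> \<open>Accumulated indices: along \<open>M\<close> the functionals decrease, and they
    exceed \<open>s\<close> by at most \<open>r n\<close>, whatever \<open>N\<close> is
    added.\<close>
  define M where "M = (\<lambda>n. \<Sum>i\<le>n. M0 i)"
  have M: "c (N + M n) x \<le> s + r n" if "x \<in> X" for N n x
  proof -
    have "N + M n = M0 n + (N + (\<Sum>i<n. M0 i))"
      by (simp add: M_def lessThan_Suc_atMost[symmetric] ac_simps)
    then show ?thesis using anti[OF that] M0[OF that] order_trans by metis
  qed
  have Manti: "c (N + M n) x \<le> c (N + M k) x" if "x \<in> X" "k \<le> n" for N n k x
    using that(2)
  proof (induction n rule: dec_induct)
    case (step n)
    have "N + M (Suc n) = (N + M n) + M0 (Suc n)" by (simp add: M_def ac_simps)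
    then show ?case using anti[OF that(1)] step order_trans by metis
  qed simp
  \<comment> \<open>Points at which the value never falls below \<open>s\<close> along the chain. As
    meets exceed \<open>s\<close> by at most \<open>r k\<close>, joins of such points lose at most
    \<open>r k\<close> for every \<open>k\<close>, hence nothing.\<close>
  define Z where "Z = (\<lambda>N. {z \<in> X. \<forall>n. s \<le> c (N + M n) z})"
  have ZX: "Z N \<subseteq> X" for N by (auto simp: Z_def)
  have geI: "s \<le> t" if "\<And>k. n \<le> k \<Longrightarrow> s - a * r k \<le> t" for n a t
  proof (rule LIMSEQ_le_const2)
    show "(\<lambda>k. s - a * r k) \<longlonglongrightarrow> s"
      using tendsto_diff[OF tendsto_const tendsto_mult_right_zero[OF r0], of s a] by simp
  qed (use that in blast)
  have ledown: "le x z" if "le x y" "le y z" for x y z using le_trans that by blast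
  have Zjoin: "join x y \<in> Z N" if x: "x \<in> Z N" and y: "y \<in> Z N" for x y N
  proof -
    have X: "x \<in> X" "y \<in> X" using x y ZX by auto
    have "s \<le> c (N + M n) (join x y)" for n
    proof (rule geI)
      fix k assume "n \<le> k"
      then have "c (N + M k) (join x y) \<le> c (N + M n) (join x y)" by (intro Manti join X)
      moreover have "s \<le> c (N + M k) x" "s \<le> c (N + M k) y" using x y by (auto simp: Z_def)
      ultimately show "s - 1 * r k \<le> c (N + M n) (join x y)"
        using modular[OF X, of "N + M k"] M[OF meet[OF X], of N k] by simp
    qed
    then show ?thesis using join(1)[OF X] by (simp add: Z_def)
  qed
  have Zne: "Z N \<noteq> {}" for N
  proof -
    define C where "C = (\<lambda>n. c (N + M n))"
    have Canti: "C n u \<le> C k u" if "u \<in> X" "k \<le> n" for n k u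
      unfolding C_def by (rule Manti[OF that])
    have Cle: "C n u \<le> s + r n" if "u \<in> X" for n u unfolding C_def by (rule M[OF that])
    have "\<forall>n. \<exists>u. u \<in> X \<and> s - r n \<le> C n u"
      using sup[OF r(1)] unfolding C_def by blast
    then obtain x where x: "\<And>n. x n \<in> X" "\<And>n. s - r n \<le> C n (x n)"
      by metis
    \<comment> \<open>\<open>J m k\<close> is the join of
      \<open>x k, ..., x (k + m)\<close>.\<close>
    define J where "J = rec_nat x (\<lambda>m F k. join (x k) (F (Suc k)))"
    have J0: "J 0 k = x k" and JS: "J (Suc m) k = join (x k) (J m (Suc k))" for m k
      by (simp_all add: J_def)
    have JX: "J m k \<in> X" for m k
      by (induction m arbitrary: k) (auto simp: J0 JS x join)
    \<comment> \<open>Joining one more near maximiser costs \<open>2 * r k\<close>, and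
      \<open>4 * r (Suc k)\<close> is another \<open>2 * r k\<close>; the constant 4 reproduces
      itself.\<close>
    have Jge: "s - 4 * r k \<le> C k (J m k)" for m k
    proof (induction m arbitrary: k)
      case 0
      then show ?case using x(2)[of k] r(1)[of k] by (simp add: J0)
    next
      case (Suc m)
      have "C k (x k) + C k (J m (Suc k)) = C k (join (x k) (J m (Suc k))) + C k (meet (x k) (J m (Suc k)))"
        unfolding C_def by (rule modular[symmetric]) (auto simp: x JX)
      moreover have "C k (meet (x k) (J m (Suc k))) \<le> s + r k" by (intro Cle meet x JX)
      moreover have "C (Suc k) (J m (Suc k)) \<le> C k (J m (Suc k))" by (intro Canti JX) simp
      ultimately show ?case using Suc[of "Suc k"] x(2)[of k] r(2)[of k] by (simp add: JS)
    qed
    have Jinc: "le (J m k) (J (Suc m) k)" for m k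
    proof (induction m arbitrary: k)
      case (Suc m)
      have "le (J m (Suc k)) (join (x k) (J (Suc m) (Suc k)))"
        using Suc[of "Suc k"] join(3)[OF x(1) JX] ledown by blast
      then have "le (join (x k) (J m (Suc k))) (join (x k) (J (Suc m) (Suc k)))"
        by (intro join(4) join(2) join(1) x JX)
      then show ?case by (simp add: JS)
    qed (simp add: J0 JS join x JX)
    have Jmono: "le (J m k) (J m' k)" if "m \<le> m'" for m m' k
      using that by (induction m' rule: dec_induct) (auto intro: le_refl Jinc ledown)
    have dirJ: "directed le (range (\<lambda>m. J m k))" for k
      unfolding directed_def using Jmono[OF max.cobounded1] Jmono[OF max.cobounded2] by blast
    have "\<exists>z\<in>X. (\<forall>d\<in>range (\<lambda>m. J m k). le d z) \<and> (\<forall>u\<in>X. (\<forall>d\<in>range (\<lambda>m. J m k). le d u) \<longrightarrow> le z u) \<and>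
        (\<forall>N. (c N \<longlongrightarrow> c N z) (tail_filter le (range (\<lambda>m. J m k))))" for k
      by (rule dsup[OF _ dirJ]) (auto simp: JX)
    \<comment> \<open>\<open>y k\<close> is the join of all \<open>x n\<close> with
      \<open>n \<ge> k\<close>, obtained as a directed supremum. These decrease in \<open>k\<close>,
      and their infimum below is the upper limit of the sequence.\<close>
    then obtain y where y: "\<And>k. y k \<in> X" "\<And>m k. le (J m k) (y k)"
      "\<And>k u. u \<in> X \<Longrightarrow> (\<And>m. le (J m k) u) \<Longrightarrow> le (y k) u"
      "\<And>k N. (c N \<longlongrightarrow> c N (y k)) (tail_filter le (range (\<lambda>m. J m k)))"
      by (metis rangeE rangeI)
    have ydec: "le (y (Suc k)) (y k)" for k
    proof (rule y(3)[OF y(1)])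
      fix m
      have "le (J m (Suc k)) (J (Suc m) k)" unfolding JS by (intro join x JX)
      then show "le (J m (Suc k)) (y k)" using y(2) ledown by blast
    qed
    have ymono: "le (y l) (y k)" if "k \<le> l" for k l
      using that by (induction l rule: dec_induct) (auto intro: le_refl ydec ledown)
    have yge: "s - 4 * r k \<le> C k (y k)" for k
    proof (rule field_le_epsilon)
      fix e :: real assume e: "e > 0"
      obtain d where "d \<in> range (\<lambda>m. J m k)" "\<bar>c (N + M k) d - c (N + M k) (y k)\<bar> < e"
        using close_up[OF dirJ y(4) e] le_refl by blast
      moreover from this have "s - 4 * r k \<le> c (N + M k) d" using Jge unfolding C_def by blast
      ultimately show "s - 4 * r k \<le> C k (y k) + e" unfolding C_def by linarith
    qed
    have diry: "directed (\<lambda>x y. le y x) (range y)"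
      unfolding directed_def using ymono[OF max.cobounded1] ymono[OF max.cobounded2] by blast
    have "range y \<subseteq> X" using y(1) by auto
    then obtain z where z: "z \<in> X" "\<And>N. (c N \<longlongrightarrow> c N z) (tail_filter (\<lambda>x y. le y x) (range y))"
      using dinf[OF _ diry] by blast
    have "s \<le> C n z" for n
    proof (rule geI[of n 4])
      fix l assume l: "n \<le> l"
      show "s - 4 * r l \<le> C n z"
      proof (rule field_le_epsilon)
        fix e :: real assume e: "e > 0"
        obtain l0 where l0: "\<And>d'. d' \<in> range y \<Longrightarrow> le d' (y l0) \<Longrightarrow> \<bar>c (N + M n) d' - c (N + M n) z\<bar> < e"
          using close_down[OF diry z(2) e] by blast
        define k where "k = max l0 l"
        have "\<bar>C n (y k) - C n z\<bar> < e" unfolding C_def by (rule l0) (auto simp: k_def intro: ymono)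
        moreover have "C k (y k) \<le> C n (y k)" by (rule Canti[OF y(1)]) (use l in \<open>simp add: k_def\<close>)
        moreover have "r k \<le> r l" unfolding r_def by (rule power_decreasing) (auto simp: k_def)
        ultimately show "s - 4 * r l \<le> C n z + e" using yge[of k] by linarith
      qed
    qed
    then have "z \<in> Z N" using z(1) by (simp add: Z_def C_def)
    then show ?thesis by blast
  qed
  \<comment> \<open>Directed by joins, the set contains its own supremum by order continuity. A
    canonical greatest element is what makes the choice monotone in \<open>N\<close>.\<close>
  have "\<exists>t\<in>Z N. \<forall>z\<in>Z N. le z t" for N
  proof -
    have dir: "directed le (Z N)"
      unfolding directed_def
    proof (intro conjI ballI)
      fix x y assume "x \<in> Z N" "y \<in> Z N"
      then show "\<exists>z\<in>Z N. le x z \<and> le y z"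
        using Zjoin[of x N y] join(2,3)[of x y] ZX by (intro bexI[of _ "join x y"]) auto
    qed (rule Zne)
    obtain t where t: "t \<in> X" "\<And>z. z \<in> Z N \<Longrightarrow> le z t" "\<And>N'. (c N' \<longlongrightarrow> c N' t) (tail_filter le (Z N))"
      using dsup[OF ZX dir] by blast
    have "s \<le> c (N + M n) t" for n
    proof (rule field_le_epsilon)
      fix e :: real assume e: "e > 0"
      obtain d where "d \<in> Z N" "\<bar>c (N + M n) d - c (N + M n) t\<bar> < e"
        using close_up[OF dir t(3) e] le_refl by blast
      moreover from this have "s \<le> c (N + M n) d" unfolding Z_def by blast
      ultimately show "s \<le> c (N + M n) t + e" by linarith
    qed
    then show ?thesis using t by (auto simp: Z_def)
  qed
  then obtain t where t: "\<And>N. t N \<in> Z N" "\<And>N z. z \<in> Z N \<Longrightarrow> le z (t N)" by metis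
  have Zsub: "Z (N + N') \<subseteq> Z N" for N N'
  proof -
    have "c (N + N' + M n) x \<le> c (N + M n) x" if "x \<in> X" for x n
      using anti[OF that, of "N + M n" N'] by (simp add: ac_simps)
    then show ?thesis unfolding Z_def using order_trans by blast
  qed
  have tle1: "le (t (N + N')) (t N)" for N N'
    by (rule t(2)) (rule subsetD[OF Zsub t(1)])
  have tle2: "le (t (N + N')) (t N')" for N N'
    using tle1[of N' N] by (simp add: add.commute)
  \<comment> \<open>The sum of two indices gives a common lower bound, so infimum and continuity
    apply to this possibly uncountable family.\<close>
  have dirt: "directed (\<lambda>x y. le y x) (range t)"
    unfolding directed_def using tle1 tle2 by blast
  have "range t \<subseteq> X" using t(1) ZX by blast
  then obtain w where w: "w \<in> X" "\<And>N. (c N \<longlongrightarrow> c N w) (tail_filter (\<lambda>x y. le y x) (range t))"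
    using dinf[OF _ dirt] by blast
  have "s \<le> c N w" for N
  proof (rule field_le_epsilon)
    fix e :: real assume e: "e > 0"
    obtain N1 where N1: "\<And>d'. d' \<in> range t \<Longrightarrow> le d' (t N1) \<Longrightarrow> \<bar>c N d' - c N w\<bar> < e"
      using close_down[OF dirt w(2) e] by blast
    have "\<bar>c N (t (N1 + N)) - c N w\<bar> < e" by (rule N1) (auto intro: tle1)
    moreover have "s \<le> c (N1 + N + M 0) (t (N1 + N))" using t(1)[of "N1 + N"] by (simp add: Z_def)
    moreover have "t (N1 + N) \<in> X" using t(1) ZX by blast
    from anti[OF this, of N "N1 + M 0"]
    have "c (N1 + N + M 0) (t (N1 + N)) \<le> c N (t (N1 + N))" by (simp add: ac_simps)
    ultimately show "s \<le> c N w + e" by linarith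
  qed
  then show ?thesis using w(1) by blast
qed

end

section \<open>Suprema and infima of projections\<close>

text \<open>The adjoint form of \<open>Q P = P\<close>.\<close>

lemma proj_le_iff':
  assumes "P \<in> projections" "Q \<in> projections"
  shows "proj_le P Q \<longleftrightarrow> (\<forall>x. P \<cdot> Q \<cdot> x = P \<cdot> x)"
proof -
  have adj: "cinner (P \<cdot> Q \<cdot> x) y = cinner x (Q \<cdot> P \<cdot> y)" for x y
    by (simp add: projectionsD(3)[OF assms(1)] projectionsD(3)[OF assms(2)])
  have "(\<forall>x. P \<cdot> Q \<cdot> x = P \<cdot> x) \<longleftrightarrow> (\<forall>y. Q \<cdot> P \<cdot> y = P \<cdot> y)"
  proof (intro iffI allI)
    fix y assume *: "\<forall>x. P \<cdot> Q \<cdot> x = P \<cdot> x"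
    have "cinner (Q \<cdot> P \<cdot> y - P \<cdot> y) x = 0" for x
      using adj[of x y] * projectionsD(3)[OF assms(1), of x y]
      by (metis cinner.diff_right cinner_eq_zero_commute right_minus_eq)
    then show "Q \<cdot> P \<cdot> y = P \<cdot> y" using eq_zero_if_orthogonal[of "Q \<cdot> P \<cdot> y - P \<cdot> y"] by simp
  next
    fix x assume *: "\<forall>y. Q \<cdot> P \<cdot> y = P \<cdot> y"
    have "cinner (P \<cdot> Q \<cdot> x - P \<cdot> x) y = 0" for y
      using adj[of x y] * projectionsD(3)[OF assms(1), of x y] by (simp add: cinner.diff_left)
    then show "P \<cdot> Q \<cdot> x = P \<cdot> x" using eq_zero_if_orthogonal[of "P \<cdot> Q \<cdot> x - P \<cdot> x"] by simp
  qed
  then show ?thesis using proj_le_iff[OF assms] by simp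
qed

lemma proj_le_compl:
  assumes "P \<in> projections" "Q \<in> projections"
  shows "proj_le (id_blinfun - Q) (id_blinfun - P) \<longleftrightarrow> proj_le P Q"
  unfolding proj_le_iff'[OF proj_compl[OF assms(2)] proj_compl[OF assms(1)]] proj_le_iff[OF assms]
  by (simp add: blinfun.bilinear_simps)

lemma is_proj_sup_unique: "is_proj_sup S P \<Longrightarrow> is_proj_sup S P' \<Longrightarrow> P = P'"
  unfolding is_proj_sup_def using proj_le_antisym by blast

lemma is_proj_inf_unique: "is_proj_inf S P \<Longrightarrow> is_proj_inf S P' \<Longrightarrow> P = P'"
  unfolding is_proj_inf_def using proj_le_antisym by blast

lemma is_proj_inf_compl:
  assumes "is_proj_inf S P" "S \<subseteq> projections"
  shows "is_proj_sup ((\<lambda>Q. id_blinfun - Q) ` S) (id_blinfun - P)"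
  unfolding is_proj_sup_def
proof (intro conjI ballI impI)
  have P: "P \<in> projections" using assms(1) by (simp add: is_proj_inf_def)
  show "id_blinfun - P \<in> projections" by (rule proj_compl[OF P])
  show "proj_le X (id_blinfun - P)" if "X \<in> (\<lambda>Q. id_blinfun - Q) ` S" for X
    using that assms P by (auto simp: is_proj_inf_def proj_le_compl subset_iff)
  fix R assume R: "R \<in> projections" "\<forall>X\<in>(\<lambda>Q. id_blinfun - Q) ` S. proj_le X R"
  have "proj_le (id_blinfun - R) Q" if "Q \<in> S" for Q
  proof -
    have "proj_le (id_blinfun - Q) R" using R(2) that by simp
    moreover have "Q \<in> projections" using that assms(2) by blast
    ultimately show ?thesis
      using proj_le_compl[OF proj_compl[OF R(1)], of Q] by simp
  qed
  then have "proj_le (id_blinfun - R) P"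
    using assms(1) proj_compl[OF R(1)] by (simp add: is_proj_inf_def)
  then show "proj_le (id_blinfun - P) R"
    using proj_le_compl[OF proj_compl[OF R(1)] P] by simp
qed

lemma is_proj_inf_prod:
  assumes "P \<in> projections" "Q \<in> projections" "\<And>x. P \<cdot> Q \<cdot> x = Q \<cdot> P \<cdot> x"
  shows "is_proj_inf {P, Q} (P o\<^sub>L Q)"
  using proj_prod[OF assms] assms projectionsD(2)[OF assms(1)] projectionsD(2)[OF assms(2)]
  by (auto simp: is_proj_inf_def proj_le_iff)

lemma proj_join:
  assumes "P \<in> projections" "Q \<in> projections" "\<And>x. P \<cdot> Q \<cdot> x = Q \<cdot> P \<cdot> x"
  shows "P + Q - (P o\<^sub>L Q) \<in> projections"
proof -
  have "id_blinfun - ((id_blinfun - P) o\<^sub>L (id_blinfun - Q)) \<in> projections"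
    by (intro proj_compl proj_prod assms) (simp add: blinfun.bilinear_simps assms(3))
  moreover have "id_blinfun - ((id_blinfun - P) o\<^sub>L (id_blinfun - Q)) = P + Q - (P o\<^sub>L Q)"
    by (rule blinfun_eqI) (simp add: blinfun.bilinear_simps)
  ultimately show ?thesis by simp
qed

lemma is_proj_sup_join:
  assumes "P \<in> projections" "Q \<in> projections" "\<And>x. P \<cdot> Q \<cdot> x = Q \<cdot> P \<cdot> x"
  shows "is_proj_sup {P, Q} (P + Q - (P o\<^sub>L Q))"
  using proj_join[OF assms] assms projectionsD(2)[OF assms(1)] projectionsD(2)[OF assms(2)]
  by (auto simp: is_proj_sup_def proj_le_iff blinfun.bilinear_simps)

text \<open>Directedness makes the union of the ranges a subspace, whose closure is the range of the
  supremum. For \<open>y\<close> in the range of \<open>Q\<close>, the vector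
  \<open>P x - Q x\<close> is \<open>(1 - Q) (P x - y)\<close>, so it is no longer than
  \<open>P x - y\<close>.\<close>

lemma directed_sup_approx:
  assumes S: "S \<subseteq> projections" "directed proj_le S" "is_proj_sup S P" and e: "0 < e"
  shows "\<exists>Q\<in>S. norm (P \<cdot> x - Q \<cdot> x) < e"
proof -
  define V where "V = (\<Union>Q\<in>S. range (blinfun_apply Q))"
  have ne: "S \<noteq> {}" and dir: "\<And>P Q. P \<in> S \<Longrightarrow> Q \<in> S \<Longrightarrow> \<exists>R\<in>S. proj_le P R \<and> proj_le Q R"
    using S(2) by (auto simp: directed_def)
  have sub: "csubspace (range (blinfun_apply Q))" if "Q \<in> S" for Q
    using closed_proj_range(2) that S(1) by blast
  have V: "csubspace V"
  proof (rule complex_vector.subspaceI)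
    show "0 \<in> V" using ne complex_vector.subspace_0[OF sub] by (auto simp: V_def)
    show "x + y \<in> V" if xy: "x \<in> V" "y \<in> V" for x y
    proof -
      obtain P Q where PQ: "P \<in> S" "x \<in> range (blinfun_apply P)" "Q \<in> S" "y \<in> range (blinfun_apply Q)"
        using xy unfolding V_def by blast
      obtain R where R: "R \<in> S" "proj_le P R" "proj_le Q R" using dir PQ by blast
      then have "x + y \<in> range (blinfun_apply R)"
        using PQ csubspace_add[OF sub[of R], of x y] unfolding proj_le_def by blast
      then show ?thesis using R(1) unfolding V_def by blast
    qed
    show "c *\<^sub>C x \<in> V" if x: "x \<in> V" for c x
    proof -
      obtain Q where "Q \<in> S" "x \<in> range (blinfun_apply Q)" using x unfolding V_def by blast
      moreover from this have "c *\<^sub>C x \<in> range (blinfun_apply Q)"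
        by (intro complex_vector.subspace_scale sub)
      ultimately show ?thesis unfolding V_def by blast
    qed
  qed
  obtain R where R: "R \<in> projections" "range (blinfun_apply R) = closure V"
    using orthogonal_projection_exists[OF csubspace_closure[OF V]] by auto
  have "proj_le Q R" if "Q \<in> S" for Q
    unfolding proj_le_def R(2) using that closure_subset by (fastforce simp: V_def)
  then have "proj_le P R" using S(3) R(1) by (simp add: is_proj_sup_def)
  then have "P \<cdot> x \<in> closure V" using R(2) by (auto simp: proj_le_def)
  then obtain y where y: "y \<in> V" "dist y (P \<cdot> x) < e"
    using e unfolding closure_approachable by blast
  then obtain Q where Q: "Q \<in> S" "y \<in> range (blinfun_apply Q)" by (auto simp: V_def)
  have Qp: "Q \<in> projections" and Pp: "P \<in> projections"
    using Q S by (auto simp: is_proj_sup_def)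
  have "proj_le Q P" using S(3) Q by (simp add: is_proj_sup_def)
  then have QP: "Q \<cdot> P \<cdot> x = Q \<cdot> x" using proj_le_iff'[OF Qp Pp] by simp
  have Qy: "Q \<cdot> y = y" using proj_range_iff[OF Qp] Q by blast
  have "P \<cdot> x - Q \<cdot> x = (id_blinfun - Q) \<cdot> (P \<cdot> x - y)"
    by (simp add: blinfun.bilinear_simps QP Qy)
  then have "norm (P \<cdot> x - Q \<cdot> x) \<le> norm (P \<cdot> x - y)"
    using norm_proj_le[OF proj_compl[OF Qp]] by metis
  then show ?thesis
    using y(2) Q(1) by (intro bexI[of _ Q]) (auto simp: dist_norm norm_minus_commute)
qed

lemma norm_proj_diff:
  assumes "P \<in> projections" "Q \<in> projections" "proj_le Q P"
  shows "(norm (P \<cdot> x))\<^sup>2 - (norm (Q \<cdot> x))\<^sup>2 = (norm (P \<cdot> x - Q \<cdot> x))\<^sup>2"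
proof -
  have "Q \<cdot> P \<cdot> x = Q \<cdot> x" using proj_le_iff'[OF assms(2,1)] assms(3) by simp
  then show ?thesis using norm_proj_pythagoras[OF assms(2), of "P \<cdot> x"] by simp
qed

lemma proj_le_norm:
  assumes "P \<in> projections" "Q \<in> projections" "proj_le Q P"
  shows "(norm (Q \<cdot> x))\<^sup>2 \<le> (norm (P \<cdot> x))\<^sup>2"
  using norm_proj_diff[OF assms, of x] zero_le_power2[of "norm (P \<cdot> x - Q \<cdot> x)"] by linarith

lemma tendsto_sup:
  assumes D: "directed le D" "\<And>x y z. le x y \<Longrightarrow> le y z \<Longrightarrow> le x z"
    and g: "\<And>d. d \<in> D \<Longrightarrow> g d \<in> projections"
      "\<And>d d'. d \<in> D \<Longrightarrow> d' \<in> D \<Longrightarrow> le d d' \<Longrightarrow> proj_le (g d) (g d')"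
    and P: "is_proj_sup (g ` D) P"
  shows "((\<lambda>d. (norm (g d \<cdot> x))\<^sup>2) \<longlongrightarrow> (norm (P \<cdot> x))\<^sup>2) (tail_filter le D)"
proof (rule tendstoI)
  have eventually_tail_iff: "eventually Q (tail_filter le D) \<longleftrightarrow> (\<exists>d\<in>D. \<forall>d'\<in>D. le d d' \<longrightarrow> Q d')" for Q
    using D(1) by (rule eventually_tail) (rule D(2))
  fix e :: real assume e: "0 < e"
  have Pp: "P \<in> projections" using P by (simp add: is_proj_sup_def)
  have "directed proj_le (g ` D)"
    unfolding directed_def
  proof (intro conjI ballI)
    show "g ` D \<noteq> {}" using D(1) by (simp add: directed_def)
    fix X Y assume "X \<in> g ` D" "Y \<in> g ` D"
    then obtain a b where ab: "a \<in> D" "b \<in> D" "X = g a" "Y = g b" by blast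
    obtain z where z: "z \<in> D" "le a z" "le b z" using D(1) ab(1,2) unfolding directed_def by blast
    have "proj_le (g a) (g z)" "proj_le (g b) (g z)" using g(2) ab(1,2) z by blast+
    then show "\<exists>Z\<in>g ` D. proj_le X Z \<and> proj_le Y Z" using z(1) ab(3,4) by blast
  qed
  then obtain d where d: "d \<in> D" "norm (P \<cdot> x - g d \<cdot> x) < sqrt e"
    using directed_sup_approx[of "g ` D" P "sqrt e" x] P e g(1) by auto
  have le: "proj_le (g d) P" if "d \<in> D" for d using P that by (simp add: is_proj_sup_def)
  have "dist ((norm (g d' \<cdot> x))\<^sup>2) ((norm (P \<cdot> x))\<^sup>2) < e" if d': "d' \<in> D" "le d d'" for d'
  proof -
    have "(norm (g d \<cdot> x))\<^sup>2 \<le> (norm (g d' \<cdot> x))\<^sup>2"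
      by (intro proj_le_norm g d' d)
    moreover have "(norm (g d' \<cdot> x))\<^sup>2 \<le> (norm (P \<cdot> x))\<^sup>2"
      by (intro proj_le_norm g d' Pp le)
    moreover have "(norm (P \<cdot> x - g d \<cdot> x))\<^sup>2 < (sqrt e)\<^sup>2"
      by (rule power_strict_mono[OF d(2)]) auto
    then have "(norm (P \<cdot> x))\<^sup>2 - (norm (g d \<cdot> x))\<^sup>2 < e"
      using norm_proj_diff[OF Pp g(1)[OF d(1)] le[OF d(1)]] e by simp
    ultimately show ?thesis unfolding dist_real_def by linarith
  qed
  then show "eventually (\<lambda>d. dist ((norm (g d \<cdot> x))\<^sup>2) ((norm (P \<cdot> x))\<^sup>2) < e) (tail_filter le D)"
    unfolding eventually_tail_iff using d(1) by blast
qed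

lemma tendsto_inf:
  assumes D: "directed le D" "\<And>x y z. le x y \<Longrightarrow> le y z \<Longrightarrow> le x z"
    and g: "\<And>d. d \<in> D \<Longrightarrow> g d \<in> projections"
      "\<And>d d'. d \<in> D \<Longrightarrow> d' \<in> D \<Longrightarrow> le d d' \<Longrightarrow> proj_le (g d') (g d)"
    and P: "is_proj_inf (g ` D) P"
  shows "((\<lambda>d. (norm (g d \<cdot> x))\<^sup>2) \<longlongrightarrow> (norm (P \<cdot> x))\<^sup>2) (tail_filter le D)"
proof -
  have "is_proj_sup ((\<lambda>d. id_blinfun - g d) ` D) (id_blinfun - P)"
    using is_proj_inf_compl[OF P] g(1) by (simp add: image_image image_subset_iff)
  then have "((\<lambda>d. (norm ((id_blinfun - g d) \<cdot> x))\<^sup>2) \<longlongrightarrow> (norm ((id_blinfun - P) \<cdot> x))\<^sup>2) (tail_filter le D)"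
  proof (rule tendsto_sup[OF D(1), rotated -1])
    show "le x z" if "le x y" "le y z" for x y z using that by (rule D(2))
    show "id_blinfun - g d \<in> projections" if "d \<in> D" for d by (rule proj_compl[OF g(1)[OF that]])
    show "proj_le (id_blinfun - g d) (id_blinfun - g d')" if "d \<in> D" "d' \<in> D" "le d d'" for d d'
      using g(2)[OF that] proj_le_compl[OF g(1)[OF that(2)] g(1)[OF that(1)]] by simp
  qed
  then have lim: "((\<lambda>d. (norm x)\<^sup>2 - (norm ((id_blinfun - g d) \<cdot> x))\<^sup>2) \<longlongrightarrow>
      (norm x)\<^sup>2 - (norm ((id_blinfun - P) \<cdot> x))\<^sup>2) (tail_filter le D)"
    by (rule tendsto_diff[OF tendsto_const])
  have compl: "(norm x)\<^sup>2 - (norm ((id_blinfun - Q) \<cdot> x))\<^sup>2 = (norm (Q \<cdot> x))\<^sup>2" if "Q \<in> projections" for Q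
    using norm_proj_pythagoras[OF that, of x] by (simp add: blinfun.bilinear_simps)
  have "eventually (\<lambda>d. d \<in> D) (tail_filter le D)"
  proof (subst eventually_tail[OF D(1)])
    show "le x z" if "le x y" "le y z" for x y z using that by (rule D(2))
    show "\<exists>d\<in>D. \<forall>d'\<in>D. le d d' \<longrightarrow> d' \<in> D" using D(1) by (auto simp: directed_def)
  qed
  then have "eventually (\<lambda>d. (norm x)\<^sup>2 - (norm ((id_blinfun - g d) \<cdot> x))\<^sup>2 = (norm (g d \<cdot> x))\<^sup>2) (tail_filter le D)"
    by (rule eventually_mono) (rule compl[OF g(1)])
  from Lim_transform_eventually[OF lim this] show ?thesis
    using compl[of P] P by (simp add: is_proj_inf_def)
qed

section \<open>Lattice operations inside a commutative subspace lattice\<close>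

lemma csl_cproj: "csl L \<Longrightarrow> cproj L"
  by (auto simp: csl_def projection_lattice_def cproj_def)

lemma csl_sup: "csl L \<Longrightarrow> S \<subseteq> L \<Longrightarrow> \<exists>P\<in>L. is_proj_sup S P"
  and csl_inf: "csl L \<Longrightarrow> S \<subseteq> L \<Longrightarrow> \<exists>P\<in>L. is_proj_inf S P"
  and csl_zero: "csl L \<Longrightarrow> 0 \<in> L" and csl_one: "csl L \<Longrightarrow> id_blinfun \<in> L"
  by (auto simp: csl_def projection_lattice_def)

lemma csl_meet:
  assumes "csl L" "P \<in> L" "Q \<in> L"
  shows "P o\<^sub>L Q \<in> L" "is_proj_inf {P, Q} (P o\<^sub>L Q)"
proof -
  have "P \<in> projections" "Q \<in> projections" "\<And>x. P \<cdot> Q \<cdot> x = Q \<cdot> P \<cdot> x"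
    using cprojD[OF csl_cproj] cproj_commute[OF csl_cproj] assms by blast+
  from is_proj_inf_prod[OF this] show inf: "is_proj_inf {P, Q} (P o\<^sub>L Q)" .
  obtain R where "R \<in> L" "is_proj_inf {P, Q} R" using csl_inf[OF assms(1), of "{P, Q}"] assms by blast
  then show "P o\<^sub>L Q \<in> L" using is_proj_inf_unique[OF inf] by blast
qed

lemma csl_join:
  assumes "csl L" "P \<in> L" "Q \<in> L"
  shows "P + Q - (P o\<^sub>L Q) \<in> L" "is_proj_sup {P, Q} (P + Q - (P o\<^sub>L Q))"
proof -
  have "P \<in> projections" "Q \<in> projections" "\<And>x. P \<cdot> Q \<cdot> x = Q \<cdot> P \<cdot> x"
    using cprojD[OF csl_cproj] cproj_commute[OF csl_cproj] assms by blast+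
  from is_proj_sup_join[OF this] show sup: "is_proj_sup {P, Q} (P + Q - (P o\<^sub>L Q))" .
  obtain R where "R \<in> L" "is_proj_sup {P, Q} R" using csl_sup[OF assms(1), of "{P, Q}"] assms by blast
  then show "P + Q - (P o\<^sub>L Q) \<in> L" using is_proj_sup_unique[OF sup] by blast
qed

section \<open>Isomorphic commutative subspace lattices\<close>

locale csl_iso =
  fixes L :: "('a::complex_hilbert \<Rightarrow>\<^sub>L 'a) set" and M :: "('b::complex_hilbert \<Rightarrow>\<^sub>L 'b) set"
    and f :: "('a \<Rightarrow>\<^sub>L 'a) \<Rightarrow> ('b \<Rightarrow>\<^sub>L 'b)"
  assumes csl_L: "csl L" and csl_M: "csl M" and bij: "bij_betw f L M"
    and order: "\<And>P Q. P \<in> L \<Longrightarrow> Q \<in> L \<Longrightarrow> proj_le P Q \<longleftrightarrow> proj_le (f P) (f Q)"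
begin

lemma proj: "P \<in> L \<Longrightarrow> P \<in> projections" "P \<in> L \<Longrightarrow> f P \<in> projections"
  using cprojD[OF csl_cproj[OF csl_L]] cprojD[OF csl_cproj[OF csl_M]] bij by (auto simp: bij_betw_def)

lemma f_in: "P \<in> L \<Longrightarrow> f P \<in> M"
  using bij by (auto simp: bij_betw_def)

lemma f_surj: "R \<in> M \<Longrightarrow> \<exists>P\<in>L. R = f P"
  using bij by (auto simp: bij_betw_def)

text \<open>The supremum is formed among all projections, beyond the reach of \<open>f\<close>. But
  \<open>M\<close> contains the supremum \<open>R\<close> of the image, \<open>R\<close> is some
  \<open>f Q\<close>, and the comparison of \<open>Q\<close> with \<open>P\<close> takes place in
  \<open>L\<close>.\<close>

lemma sup_preserved:
  assumes S: "S \<subseteq> L" "P \<in> L" "is_proj_sup S P"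
  shows "is_proj_sup (f ` S) (f P)"
proof -
  obtain R where R: "R \<in> M" "is_proj_sup (f ` S) R"
    using csl_sup[OF csl_M, of "f ` S"] S(1) f_in by blast
  obtain Q where Q: "Q \<in> L" "R = f Q" using f_surj[OF R(1)] by blast
  have "proj_le X Q" if "X \<in> S" for X
    using R(2) order[of X Q] that S(1) Q by (auto simp: is_proj_sup_def)
  then have "proj_le P Q" using S(3) proj(1)[OF Q(1)] by (simp add: is_proj_sup_def)
  then have "proj_le (f P) R" using order S(2) Q by blast
  moreover have "proj_le (f X) (f P)" if "X \<in> S" for X
    using S order[of X P] that by (auto simp: is_proj_sup_def)
  then have "proj_le R (f P)" using R(2) proj(2)[OF S(2)] by (auto simp: is_proj_sup_def)
  ultimately have "f P = R"
    using proj_le_antisym proj(2)[OF S(2)] R(2) by (auto simp: is_proj_sup_def)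
  then show ?thesis using R(2) by simp
qed

lemma inf_preserved:
  assumes S: "S \<subseteq> L" "P \<in> L" "is_proj_inf S P"
  shows "is_proj_inf (f ` S) (f P)"
proof -
  obtain R where R: "R \<in> M" "is_proj_inf (f ` S) R"
    using csl_inf[OF csl_M, of "f ` S"] S(1) f_in by blast
  obtain Q where Q: "Q \<in> L" "R = f Q" using f_surj[OF R(1)] by blast
  have "proj_le Q X" if "X \<in> S" for X
    using R(2) order[of Q X] that S(1) Q by (auto simp: is_proj_inf_def)
  then have "proj_le Q P" using S(3) proj(1)[OF Q(1)] by (simp add: is_proj_inf_def)
  then have "proj_le R (f P)" using order S(2) Q by blast
  moreover have "proj_le (f P) (f X)" if "X \<in> S" for X
    using S order[of P X] that by (auto simp: is_proj_inf_def)
  then have "proj_le (f P) R" using R(2) proj(2)[OF S(2)] by (auto simp: is_proj_inf_def)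
  ultimately have "f P = R"
    using proj_le_antisym proj(2)[OF S(2)] R(2) by (auto simp: is_proj_inf_def)
  then show ?thesis using R(2) by simp
qed

sublocale lat_hom L f
proof
  show "cproj L" by (rule csl_cproj[OF csl_L])
  show "cproj (f ` L)" using csl_cproj[OF csl_M] bij by (simp add: bij_betw_def)
  show "0 \<in> L" "id_blinfun \<in> L" using csl_zero[OF csl_L] csl_one[OF csl_L] .
  have "is_proj_sup {} (0 :: 'a \<Rightarrow>\<^sub>L 'a)"
    by (auto simp: is_proj_sup_def zero_proj proj_le_def) (metis closed_proj_range(2) complex_vector.subspace_0)
  from sup_preserved[OF _ csl_zero[OF csl_L] this]
  have "is_proj_sup {} (f 0)" by simp
  moreover have "is_proj_sup {} (0 :: 'b \<Rightarrow>\<^sub>L 'b)"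
    by (auto simp: is_proj_sup_def zero_proj proj_le_def) (metis closed_proj_range(2) complex_vector.subspace_0)
  ultimately show "f 0 = 0" by (rule is_proj_sup_unique)
  have "is_proj_inf {} (id_blinfun :: 'a \<Rightarrow>\<^sub>L 'a)"
    by (auto simp: is_proj_inf_def id_proj proj_le_def)
  from inf_preserved[OF _ csl_one[OF csl_L] this]
  have "is_proj_inf {} (f id_blinfun)" by simp
  moreover have "is_proj_inf {} (id_blinfun :: 'b \<Rightarrow>\<^sub>L 'b)"
    by (auto simp: is_proj_inf_def id_proj proj_le_def)
  ultimately show "f id_blinfun = id_blinfun" by (rule is_proj_inf_unique)
  fix P Q assume PQ: "P \<in> L" "Q \<in> L"
  show mL: "P o\<^sub>L Q \<in> L" and jL: "P + Q - (P o\<^sub>L Q) \<in> L"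
    using csl_meet(1)[OF csl_L PQ] csl_join(1)[OF csl_L PQ] .
  have "is_proj_inf {f P, f Q} (f (P o\<^sub>L Q))"
    using inf_preserved[OF _ mL csl_meet(2)[OF csl_L PQ]] PQ by simp
  then show "f (P o\<^sub>L Q) = f P o\<^sub>L f Q"
    using csl_meet(2)[OF csl_M f_in[OF PQ(1)] f_in[OF PQ(2)]] by (rule is_proj_inf_unique)
  have "is_proj_sup {f P, f Q} (f (P + Q - (P o\<^sub>L Q)))"
    using sup_preserved[OF _ jL csl_join(2)[OF csl_L PQ]] PQ by simp
  then show "f (P + Q - (P o\<^sub>L Q)) = f P + f Q - (f P o\<^sub>L f Q)"
    using csl_join(2)[OF csl_M f_in[OF PQ(1)] f_in[OF PQ(2)]] by (rule is_proj_sup_unique)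
qed

text \<open>The measure of \<xi> minus what the vectors in \<open>N\<close> supply through
  \<open>f\<close>. Multisets allow a vector to be repeated, which strengthens the domination, and
  their sum makes the index a monoid in which the excess decreases.\<close>

definition excess :: "'a \<Rightarrow> 'b multiset \<Rightarrow> ('a \<Rightarrow>\<^sub>L 'a) \<Rightarrow> real" where
  "excess \<xi> N P = (norm (P \<cdot> \<xi>))\<^sup>2 - (\<Sum>\<eta>\<in>#N. (norm (f P \<cdot> \<eta>))\<^sup>2)"

text \<open>\<open>|P x|^2 = <P x, x>\<close> is linear in \<open>P\<close>, and join and meet add
  up to \<open>P + Q\<close>.\<close>

lemma norm_meet_join:
  assumes "cproj S" "P \<in> S" "Q \<in> S"
  shows "(norm ((P + Q - (P o\<^sub>L Q)) \<cdot> x))\<^sup>2 + (norm ((P o\<^sub>L Q) \<cdot> x))\<^sup>2 = (norm (P \<cdot> x))\<^sup>2 + (norm (Q \<cdot> x))\<^sup>2"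
proof -
  have p: "P \<in> projections" "Q \<in> projections" "\<And>x. P \<cdot> Q \<cdot> x = Q \<cdot> P \<cdot> x"
    using cprojD[OF assms(1)] cproj_commute[OF assms(1)] assms by blast+
  show ?thesis
    by (simp only: norm_proj_sq[OF p(1)] norm_proj_sq[OF p(2)] norm_proj_sq[OF proj_join[OF p]]
        norm_proj_sq[OF proj_prod[OF p]])
      (simp add: blinfun.bilinear_simps cinner_add_left cinner.diff_left)
qed

lemma excess_modular:
  assumes "P \<in> L" "Q \<in> L"
  shows "excess \<xi> N (P + Q - (P o\<^sub>L Q)) + excess \<xi> N (P o\<^sub>L Q) = excess \<xi> N P + excess \<xi> N Q"
proof -
  have "(\<Sum>\<eta>\<in>#N. (norm (f (P + Q - (P o\<^sub>L Q)) \<cdot> \<eta>))\<^sup>2) + (\<Sum>\<eta>\<in>#N. (norm (f (P o\<^sub>L Q) \<cdot> \<eta>))\<^sup>2) =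
      (\<Sum>\<eta>\<in>#N. (norm (f P \<cdot> \<eta>))\<^sup>2) + (\<Sum>\<eta>\<in>#N. (norm (f Q \<cdot> \<eta>))\<^sup>2)"
    unfolding sum_mset.distrib[symmetric] join(2)[OF assms] meet(2)[OF assms]
    using norm_meet_join[OF cproj_fL imageI[OF assms(1)] imageI[OF assms(2)]] by simp
  then show ?thesis
    using norm_meet_join[OF cproj_L assms, of \<xi>] by (simp add: excess_def)
qed

lemma tendsto_sum_mset:
  fixes g :: "'c \<Rightarrow> 'd \<Rightarrow> real"
  assumes "\<And>\<eta>. \<eta> \<in># N \<Longrightarrow> (g \<eta> \<longlongrightarrow> l \<eta>) F"
  shows "((\<lambda>d. \<Sum>\<eta>\<in>#N. g \<eta> d) \<longlongrightarrow> (\<Sum>\<eta>\<in>#N. l \<eta>)) F"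
  using assms by (induction N) (auto intro!: tendsto_add)

abbreviation pairs :: "(('a \<Rightarrow>\<^sub>L 'a) \<times> ('a \<Rightarrow>\<^sub>L 'a)) set" where
  "pairs \<equiv> {x. fst x \<in> L \<and> snd x \<in> L \<and> proj_le (snd x) (fst x)}"

abbreviation pair_le :: "('a \<Rightarrow>\<^sub>L 'a) \<times> ('a \<Rightarrow>\<^sub>L 'a) \<Rightarrow> ('a \<Rightarrow>\<^sub>L 'a) \<times> ('a \<Rightarrow>\<^sub>L 'a) \<Rightarrow> bool" where
  "pair_le \<equiv> \<lambda>x y. proj_le (fst x) (fst y) \<and> proj_le (snd x) (snd y)"

lemma excess_tendsto_sup:
  assumes D: "directed pair_le D" "D \<subseteq> pairs" and h: "h = fst \<or> h = snd"
    and P: "P \<in> L" "is_proj_sup (h ` D) P"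
  shows "((\<lambda>d. excess \<xi> N (h d)) \<longlongrightarrow> excess \<xi> N P) (tail_filter pair_le D)"
proof -
  have hL: "h d \<in> L" if "d \<in> D" for d using D(2) h that by auto
  have mono: "proj_le (h d) (h d')" if "pair_le d d'" for d d' using h that by auto
  have "((\<lambda>d. (norm (h d \<cdot> \<xi>))\<^sup>2) \<longlongrightarrow> (norm (P \<cdot> \<xi>))\<^sup>2) (tail_filter pair_le D)"
  proof (rule tendsto_sup[OF D(1) _ _ _ P(2)])
    show "pair_le x z" if "pair_le x y" "pair_le y z" for x y z
      using that proj_le_trans by blast
  qed (use hL proj mono in auto)
  moreover have "((\<lambda>d. (norm (f (h d) \<cdot> \<eta>))\<^sup>2) \<longlongrightarrow> (norm (f P \<cdot> \<eta>))\<^sup>2) (tail_filter pair_le D)" for \<eta>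
  proof (rule tendsto_sup[OF D(1)])
    show "pair_le x z" if "pair_le x y" "pair_le y z" for x y z
      using that proj_le_trans by blast
    have "is_proj_sup (f ` h ` D) (f P)" by (rule sup_preserved[OF _ P]) (use hL in auto)
    then show "is_proj_sup ((\<lambda>d. f (h d)) ` D) (f P)" by (simp add: image_image)
    show "proj_le (f (h d)) (f (h d'))" if "d \<in> D" "d' \<in> D" "pair_le d d'" for d d'
      using order[OF hL[OF that(1)] hL[OF that(2)]] mono[OF that(3)] by simp
  qed (use hL proj in auto)
  ultimately show ?thesis
    unfolding excess_def by (intro tendsto_diff tendsto_sum_mset)
qed

lemma excess_tendsto_inf:
  assumes D: "directed (\<lambda>x y. pair_le y x) D" "D \<subseteq> pairs" and h: "h = fst \<or> h = snd"
    and P: "P \<in> L" "is_proj_inf (h ` D) P"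
  shows "((\<lambda>d. excess \<xi> N (h d)) \<longlongrightarrow> excess \<xi> N P) (tail_filter (\<lambda>x y. pair_le y x) D)"
proof -
  have hL: "h d \<in> L" if "d \<in> D" for d using D(2) h that by auto
  have mono: "proj_le (h d) (h d')" if "pair_le d d'" for d d' using h that by auto
  have "((\<lambda>d. (norm (h d \<cdot> \<xi>))\<^sup>2) \<longlongrightarrow> (norm (P \<cdot> \<xi>))\<^sup>2) (tail_filter (\<lambda>x y. pair_le y x) D)"
  proof (rule tendsto_inf[OF D(1) _ _ _ P(2)])
    show "pair_le z x" if "pair_le y x" "pair_le z y" for x y z
      using that proj_le_trans by blast
  qed (use hL proj mono in auto)
  moreover have "((\<lambda>d. (norm (f (h d) \<cdot> \<eta>))\<^sup>2) \<longlongrightarrow> (norm (f P \<cdot> \<eta>))\<^sup>2) (tail_filter (\<lambda>x y. pair_le y x) D)" for \<eta>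
  proof (rule tendsto_inf[OF D(1)])
    show "pair_le z x" if "pair_le y x" "pair_le z y" for x y z
      using that proj_le_trans by blast
    have "is_proj_inf (f ` h ` D) (f P)" by (rule inf_preserved[OF _ P]) (use hL in auto)
    then show "is_proj_inf ((\<lambda>d. f (h d)) ` D) (f P)" by (simp add: image_image)
    show "proj_le (f (h d')) (f (h d))" if "d \<in> D" "d' \<in> D" "pair_le d' d" for d d'
      using order[OF hL[OF that(2)] hL[OF that(1)]] mono[OF that(3)] by simp
  qed (use hL proj in auto)
  ultimately show ?thesis
    unfolding excess_def by (intro tendsto_diff tendsto_sum_mset)
qed

text \<open>Nested pairs are stable under the componentwise operations and limits. Nestedness makes
  the difference decrease in \<open>N\<close>: as \<open>f\<close> is increasing, each further
  vector contributes at least as much at the larger projection.\<close>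

lemma modular_excess:
  "modular_functionals pairs pair_le
     (\<lambda>x y. (fst x + fst y - (fst x o\<^sub>L fst y), snd x + snd y - (snd x o\<^sub>L snd y)))
     (\<lambda>x y. (fst x o\<^sub>L fst y, snd x o\<^sub>L snd y))
     (\<lambda>N x. excess \<xi> N (fst x) - excess \<xi> N (snd x))"
proof
  show "pair_le x x" for x by (simp add: proj_le_refl)
  show "pair_le x z" if "pair_le x y" "pair_le y z" for x y z using that proj_le_trans by blast
next
  fix x y assume "x \<in> pairs" "y \<in> pairs"
  then have x: "fst x \<in> L" "snd x \<in> L" "proj_le (snd x) (fst x)"
    and y: "fst y \<in> L" "snd y \<in> L" "proj_le (snd y) (fst y)" by auto
  note j1 = csl_join(2)[OF csl_L x(1) y(1)] and j2 = csl_join(2)[OF csl_L x(2) y(2)]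
  note m1 = csl_meet(2)[OF csl_L x(1) y(1)] and m2 = csl_meet(2)[OF csl_L x(2) y(2)]
  let ?j = "(fst x + fst y - (fst x o\<^sub>L fst y), snd x + snd y - (snd x o\<^sub>L snd y))"
  have le1: "proj_le (fst x) (fst ?j)" "proj_le (fst y) (fst ?j)" "fst ?j \<in> projections"
    and le2: "proj_le (snd x) (snd ?j)" "proj_le (snd y) (snd ?j)"
    using j1 j2 by (simp_all add: is_proj_sup_def)
  have "proj_le (snd ?j) (fst ?j)"
    using j2 le1 proj_le_trans[OF x(3) le1(1)] proj_le_trans[OF y(3) le1(2)] by (simp add: is_proj_sup_def)
  then show "?j \<in> pairs" using join(1) x y by simp
  show "pair_le x ?j" "pair_le y ?j" using le1 le2 by simp_all
  show "pair_le ?j z" if "z \<in> pairs" "pair_le x z" "pair_le y z" for z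
    using that j1 j2 proj by (simp add: is_proj_sup_def)
  have "proj_le (snd x o\<^sub>L snd y) (fst x o\<^sub>L fst y)"
    using m1 m2 x(3) y(3) proj_le_trans unfolding is_proj_inf_def by blast
  then show "(fst x o\<^sub>L fst y, snd x o\<^sub>L snd y) \<in> pairs" using meet(1) x y by simp
  show "excess \<xi> N (fst ?j) - excess \<xi> N (snd ?j) +
      (excess \<xi> N (fst (fst x o\<^sub>L fst y, snd x o\<^sub>L snd y)) - excess \<xi> N (snd (fst x o\<^sub>L fst y, snd x o\<^sub>L snd y))) =
      excess \<xi> N (fst x) - excess \<xi> N (snd x) + (excess \<xi> N (fst y) - excess \<xi> N (snd y))" for N
    using excess_modular[OF x(1) y(1), of \<xi> N] excess_modular[OF x(2) y(2), of \<xi> N] by simp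
next
  fix x N N' assume "x \<in> pairs"
  then have x: "fst x \<in> L" "snd x \<in> L" "proj_le (f (snd x)) (f (fst x))" using order by auto
  have "(\<Sum>\<eta>\<in>#N'. (norm (f (snd x) \<cdot> \<eta>))\<^sup>2) \<le> (\<Sum>\<eta>\<in>#N'. (norm (f (fst x) \<cdot> \<eta>))\<^sup>2)"
    by (intro sum_mset_mono proj_le_norm proj x)
  then show "excess \<xi> (N + N') (fst x) - excess \<xi> (N + N') (snd x) \<le> excess \<xi> N (fst x) - excess \<xi> N (snd x)"
    by (simp add: excess_def)
next
  fix D assume D: "D \<subseteq> pairs" "directed pair_le D"
  have sub: "fst ` D \<subseteq> L" "snd ` D \<subseteq> L" using D(1) by auto
  obtain P Q where P: "P \<in> L" "is_proj_sup (fst ` D) P" and Q: "Q \<in> L" "is_proj_sup (snd ` D) Q"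
    using csl_sup[OF csl_L sub(1)] csl_sup[OF csl_L sub(2)] by blast
  have "proj_le (snd d) P" if "d \<in> D" for d
    using P(2) D(1) that proj_le_trans unfolding is_proj_sup_def by blast
  then have "proj_le Q P" using Q(2) proj(1)[OF P(1)] by (auto simp: is_proj_sup_def)
  then have "(P, Q) \<in> pairs" using P Q by simp
  moreover have "pair_le d (P, Q)" if "d \<in> D" for d using P Q that by (auto simp: is_proj_sup_def)
  moreover have "pair_le (P, Q) u" if "u \<in> pairs" "\<forall>d\<in>D. pair_le d u" for u
    using P(2) Q(2) that proj by (auto simp: is_proj_sup_def)
  moreover have "((\<lambda>x. excess \<xi> N (fst x) - excess \<xi> N (snd x)) \<longlongrightarrow> excess \<xi> N P - excess \<xi> N Q) (tail_filter pair_le D)" for N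
    by (intro tendsto_diff excess_tendsto_sup D P Q) auto
  ultimately show "\<exists>z\<in>pairs. (\<forall>d\<in>D. pair_le d z) \<and> (\<forall>u\<in>pairs. (\<forall>d\<in>D. pair_le d u) \<longrightarrow> pair_le z u) \<and>
      (\<forall>N. ((\<lambda>x. excess \<xi> N (fst x) - excess \<xi> N (snd x)) \<longlongrightarrow> excess \<xi> N (fst z) - excess \<xi> N (snd z)) (tail_filter pair_le D))"
    by (intro bexI[of _ "(P, Q)"] conjI) auto
next
  fix D assume D: "D \<subseteq> pairs" "directed (\<lambda>x y. pair_le y x) D"
  have sub: "fst ` D \<subseteq> L" "snd ` D \<subseteq> L" using D(1) by auto
  obtain P Q where P: "P \<in> L" "is_proj_inf (fst ` D) P" and Q: "Q \<in> L" "is_proj_inf (snd ` D) Q"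
    using csl_inf[OF csl_L sub(1)] csl_inf[OF csl_L sub(2)] by blast
  have "proj_le Q (fst d)" if "d \<in> D" for d
    using Q(2) D(1) that proj_le_trans unfolding is_proj_inf_def by blast
  then have "proj_le Q P" using P(2) proj(1)[OF Q(1)] by (auto simp: is_proj_inf_def)
  then have "(P, Q) \<in> pairs" using P Q by simp
  moreover have "pair_le (P, Q) d" if "d \<in> D" for d using P Q that by (auto simp: is_proj_inf_def)
  moreover have "((\<lambda>x. excess \<xi> N (fst x) - excess \<xi> N (snd x)) \<longlongrightarrow> excess \<xi> N P - excess \<xi> N Q) (tail_filter (\<lambda>x y. pair_le y x) D)" for N
    by (intro tendsto_diff excess_tendsto_inf D P Q) auto
  ultimately show "\<exists>z\<in>pairs. (\<forall>d\<in>D. pair_le z d) \<and>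
      (\<forall>N. ((\<lambda>x. excess \<xi> N (fst x) - excess \<xi> N (snd x)) \<longlongrightarrow> excess \<xi> N (fst z) - excess \<xi> N (snd z)) (tail_filter (\<lambda>x y. pair_le y x) D))"
    by (intro bexI[of _ "(P, Q)"] conjI) auto
qed

text \<open>The order isomorphism need not extend to a normal isomorphism of the generated von Neumann
  algebras; this is the amount of absolute continuity that survives.\<close>

theorem absolute_continuity:
  assumes e: "0 < e"
  shows "\<exists>N. \<forall>P\<in>L. \<forall>Q\<in>L. proj_le Q P \<longrightarrow> excess \<xi> N P - excess \<xi> N Q \<le> e"
proof (rule ccontr)
  assume "\<not> ?thesis"
  then have neg: "\<exists>x\<in>pairs. e < excess \<xi> N (fst x) - excess \<xi> N (snd x)" for N
    by (force simp: not_le)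
  define c where "c = (\<lambda>N x. excess \<xi> N (fst x) - excess \<xi> N (snd x))"
  interpret m: modular_functionals pairs pair_le
     "\<lambda>x y. (fst x + fst y - (fst x o\<^sub>L fst y), snd x + snd y - (snd x o\<^sub>L snd y))"
     "\<lambda>x y. (fst x o\<^sub>L fst y, snd x o\<^sub>L snd y)"
     c
    unfolding c_def by (rule modular_excess)
  define S where "S = (\<lambda>N. Sup (c N ` pairs))"
  \<comment> \<open>The best bound on the violation that any multiset achieves. If domination fails
    it is at least \<open>e\<close>, and minimax turns it into one pair that violates domination for
    all multisets.\<close>
  define s where "s = Inf (range S)"
  have bd: "c N x \<le> (norm \<xi>)\<^sup>2" if "x \<in> pairs" for N x
  proof -
    have "c N x \<le> c {#} x" using m.anti[OF that, of "{#}" N] by simp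
    also have "\<dots> \<le> (norm (fst x \<cdot> \<xi>))\<^sup>2" by (simp add: c_def excess_def)
    also have "\<dots> \<le> (norm \<xi>)\<^sup>2" using that proj by (intro power_mono norm_proj_le) auto
    finally show ?thesis .
  qed
  then have bdd: "bdd_above (c N ` pairs)" for N by (auto intro!: bdd_aboveI)
  have cS: "c N x \<le> S N" if "x \<in> pairs" for N x
    unfolding S_def using that bdd by (intro cSup_upper) auto
  have eS: "e < S N" for N using neg[of N] cS[of _ N] by (force simp: c_def)
  have bddS: "bdd_below (range S)" using eS by (auto intro!: bdd_belowI[of _ e] less_imp_le)
  have sS: "s \<le> S N" for N unfolding s_def using bddS by (intro cInf_lower) auto
  have es: "e \<le> s" unfolding s_def using eS by (intro cInf_greatest) (auto intro: less_imp_le)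
  have "\<exists>w\<in>pairs. \<forall>N. s \<le> c N w"
  proof (rule m.uniform_maximiser)
    fix N and d :: real assume "0 < d"
    then have "s - d < S N" using sS[of N] by simp
    moreover have "c N ` pairs \<noteq> {}" using neg by blast
    ultimately have "\<exists>y\<in>c N ` pairs. s - d < y"
      unfolding S_def by (intro less_cSupD)
    then show "\<exists>x\<in>pairs. s - d \<le> c N x"
      unfolding bex_simps image_iff by (meson less_imp_le)
  next
    fix d :: real assume "0 < d"
    then have "Inf (range S) < s + d" by (simp add: s_def)
    then have "\<exists>y\<in>range S. y < s + d" by (intro cInf_lessD) auto
    then obtain N where "S N < s + d" by blast
    then show "\<exists>N. \<forall>x\<in>pairs. c N x \<le> s + d" using cS by (meson less_imp_le order_trans)
  qed
  then obtain P Q where w: "P \<in> L" "Q \<in> L" "proj_le Q P" "\<And>N. s \<le> c N (P, Q)" by auto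
  have "(norm (f P \<cdot> \<eta>))\<^sup>2 \<le> (norm (f Q \<cdot> \<eta>))\<^sup>2" for \<eta>
  proof (rule ccontr)
    assume "\<not> ?thesis"
    then have pos: "(norm (f P \<cdot> \<eta>))\<^sup>2 - (norm (f Q \<cdot> \<eta>))\<^sup>2 > 0" by linarith
    \<comment> \<open>Enough copies of a vector with a positive increment would outweigh all of
      \<open>|\<xi>|^2\<close>.\<close>
    obtain m where "(norm \<xi>)\<^sup>2 < real m * ((norm (f P \<cdot> \<eta>))\<^sup>2 - (norm (f Q \<cdot> \<eta>))\<^sup>2)"
      using reals_Archimedean3[OF pos] by blast
    moreover have "c (replicate_mset m \<eta>) (P, Q) =
        c {#} (P, Q) - real m * ((norm (f P \<cdot> \<eta>))\<^sup>2 - (norm (f Q \<cdot> \<eta>))\<^sup>2)"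
      by (simp add: c_def excess_def right_diff_distrib)
    moreover have "c {#} (P, Q) \<le> (norm \<xi>)\<^sup>2" using bd w by simp
    ultimately show False using w(4)[of "replicate_mset m \<eta>"] es e by linarith
  qed
  note le = this
  have "f P \<cdot> f Q \<cdot> x = f P \<cdot> x" for x
  proof -
    \<comment> \<open>On vectors orthogonal to the range of \<open>f Q\<close> the comparison forces
      \<open>f P\<close> to vanish, so \<open>f P\<close> lies below \<open>f Q\<close>.\<close>
    have "(norm (f P \<cdot> (x - f Q \<cdot> x)))\<^sup>2 \<le> (norm (f Q \<cdot> (x - f Q \<cdot> x)))\<^sup>2" by (rule le)
    also have "f Q \<cdot> (x - f Q \<cdot> x) = 0"
      using projectionsD(2)[OF proj(2)[OF w(2)]] by (simp add: blinfun.bilinear_simps)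
    finally show ?thesis by (simp add: blinfun.bilinear_simps)
  qed
  then have "proj_le (f P) (f Q)" using proj_le_iff' proj(2) w by blast
  then have "proj_le P Q" using order w by blast
  then have "P = Q" using proj_le_antisym proj(1) w by blast
  then show False using w(4)[of "{#}"] es e by (simp add: c_def)
qed

end

section \<open>Approximate units\<close>

text \<open>The relation \<open>Q P Q = P Q\<close> is compared with its adjoint
  \<open>Q P Q = Q P\<close>.\<close>

lemma invariant_commute:
  assumes Q: "Q \<in> projections" and P: "P \<in> projections"
    and inv: "\<And>x. Q \<cdot> P \<cdot> Q \<cdot> x = P \<cdot> Q \<cdot> x"
  shows "Q \<cdot> P \<cdot> x = P \<cdot> Q \<cdot> x"
proof -
  have "cinner (Q \<cdot> P \<cdot> x - P \<cdot> Q \<cdot> x) y = 0" for y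
  proof -
    have "cinner (Q \<cdot> P \<cdot> x) y = cinner x (Q \<cdot> P \<cdot> Q \<cdot> y)"
      by (simp add: projectionsD(3)[OF P] projectionsD(3)[OF Q] inv)
    also have "\<dots> = cinner (Q \<cdot> P \<cdot> Q \<cdot> x) y"
      by (simp add: projectionsD(3)[OF P] projectionsD(3)[OF Q])
    finally show ?thesis by (simp add: cinner.diff_left inv)
  qed
  then show ?thesis using eq_zero_if_orthogonal[of "Q \<cdot> P \<cdot> x - P \<cdot> Q \<cdot> x"] by simp
qed

lemma compose_scaleC_left: "(c *\<^sub>C S) o\<^sub>L T = c *\<^sub>C (S o\<^sub>L T)"
  by (rule blinfun_eqI) (simp add: scaleC_blinfun.rep_eq)

lemma compose_scaleC_right: "T \<in> bounded_ops \<Longrightarrow> T o\<^sub>L (c *\<^sub>C S) = c *\<^sub>C (T o\<^sub>L S)"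
  by (rule blinfun_eqI) (simp add: scaleC_blinfun.rep_eq bounded_opsD)

lemma compose_assoc: "(R o\<^sub>L S) o\<^sub>L T = R o\<^sub>L (S o\<^sub>L T)"
  by (rule blinfun_eqI) simp

lemma compose_add: "(S + S') o\<^sub>L T = (S o\<^sub>L T) + (S' o\<^sub>L T)" "T o\<^sub>L (S + S') = (T o\<^sub>L S) + (T o\<^sub>L S')"
  by (rule blinfun_eqI; simp add: blinfun.bilinear_simps)+

lemma invariant_iff:
  "(id_blinfun - P) o\<^sub>L T o\<^sub>L P = 0 \<longleftrightarrow> (\<forall>x. P \<cdot> T \<cdot> P \<cdot> x = T \<cdot> P \<cdot> x)"
proof -
  have "(id_blinfun - P) o\<^sub>L T o\<^sub>L P = 0 \<longleftrightarrow> (\<forall>x. ((id_blinfun - P) o\<^sub>L T o\<^sub>L P) \<cdot> x = 0)"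
    by (metis blinfun_eqI zero_blinfun.rep_eq)
  then show ?thesis by (auto simp: blinfun.bilinear_simps)
qed

lemma Alg_iff:
  "T \<in> Alg L \<longleftrightarrow> T \<in> bounded_ops \<and> (\<forall>P\<in>L. \<forall>x. P \<cdot> T \<cdot> P \<cdot> x = T \<cdot> P \<cdot> x)"
  by (simp add: Alg_def invariant_iff)

lemma cspan_image_sum:
  assumes "finite W" "y \<in> cspan (v ` W)"
  shows "\<exists>a. y = (\<Sum>s\<in>W. a s *\<^sub>C v s)"
proof (rule complex_vector.span_induct[OF assms(2)])
  show "csubspace {y. \<exists>a. y = (\<Sum>s\<in>W. a s *\<^sub>C v s)}"
  proof (rule complex_vector.subspaceI)
    show "0 \<in> {y. \<exists>a. y = (\<Sum>s\<in>W. a s *\<^sub>C v s)}"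
      by (auto intro!: exI[of _ "\<lambda>_. 0"] simp: scaleC_0_left)
  next
    fix x y assume "x \<in> {y. \<exists>a. y = (\<Sum>s\<in>W. a s *\<^sub>C v s)}" "y \<in> {y. \<exists>a. y = (\<Sum>s\<in>W. a s *\<^sub>C v s)}"
    then obtain a b where "x = (\<Sum>s\<in>W. a s *\<^sub>C v s)" "y = (\<Sum>s\<in>W. b s *\<^sub>C v s)" by blast
    then show "x + y \<in> {y. \<exists>a. y = (\<Sum>s\<in>W. a s *\<^sub>C v s)}"
      by (auto intro!: exI[of _ "\<lambda>s. a s + b s"] simp: scaleC_add_left sum.distrib)
  next
    fix c x assume "x \<in> {y. \<exists>a. y = (\<Sum>s\<in>W. a s *\<^sub>C v s)}"
    then obtain a where "x = (\<Sum>s\<in>W. a s *\<^sub>C v s)" by blast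
    then show "c *\<^sub>C x \<in> {y. \<exists>a. y = (\<Sum>s\<in>W. a s *\<^sub>C v s)}"
      by (auto intro!: exI[of _ "\<lambda>s. c * a s"] simp: scaleC_scaleC complex_vector.scale_sum_right)
  qed
  fix x assume "x \<in> v ` W"
  then obtain t where t: "t \<in> W" "x = v t" by blast
  have "(\<Sum>s\<in>W. (if s = t then 1 else 0) *\<^sub>C v s) = (\<Sum>s\<in>W. if s = t then v s else 0)"
    by (intro sum.cong) (auto simp: scaleC_0_left scaleC_one)
  then show "\<exists>a. x = (\<Sum>s\<in>W. a s *\<^sub>C v s)"
    using t assms(1) by (intro exI[of _ "\<lambda>s. if s = t then 1 else 0"]) simp
qed

lemma cspan_image_finite_subset:
  assumes "y \<in> cspan (v ` L)"
  shows "\<exists>t. finite t \<and> t \<subseteq> L \<and> y \<in> cspan (v ` t)"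
proof (rule complex_vector.span_induct[OF assms])
  show "csubspace {y. \<exists>t. finite t \<and> t \<subseteq> L \<and> y \<in> cspan (v ` t)}"
  proof (rule complex_vector.subspaceI)
    show "0 \<in> {y. \<exists>t. finite t \<and> t \<subseteq> L \<and> y \<in> cspan (v ` t)}"
      by (auto intro!: exI[of _ "{}"] complex_vector.span_zero)
  next
    fix x y assume "x \<in> {y. \<exists>t. finite t \<and> t \<subseteq> L \<and> y \<in> cspan (v ` t)}"
      "y \<in> {y. \<exists>t. finite t \<and> t \<subseteq> L \<and> y \<in> cspan (v ` t)}"
    then obtain s t where st: "finite s" "s \<subseteq> L" "x \<in> cspan (v ` s)" "finite t" "t \<subseteq> L" "y \<in> cspan (v ` t)"
      by blast
    have "cspan (v ` s) \<subseteq> cspan (v ` (s \<union> t))" "cspan (v ` t) \<subseteq> cspan (v ` (s \<union> t))"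
      by (intro complex_vector.span_mono; blast)+
    then have "x + y \<in> cspan (v ` (s \<union> t))" using st complex_vector.span_add by blast
    then show "x + y \<in> {y. \<exists>t. finite t \<and> t \<subseteq> L \<and> y \<in> cspan (v ` t)}"
      using st by (intro CollectI exI[of _ "s \<union> t"]) simp
  next
    fix c x assume "x \<in> {y. \<exists>t. finite t \<and> t \<subseteq> L \<and> y \<in> cspan (v ` t)}"
    then show "c *\<^sub>C x \<in> {y. \<exists>t. finite t \<and> t \<subseteq> L \<and> y \<in> cspan (v ` t)}"
      using complex_vector.span_scale by blast
  qed
  fix x assume "x \<in> v ` L"
  then obtain t where "t \<in> L" "x = v t" by blast
  then show "\<exists>t. finite t \<and> t \<subseteq> L \<and> x \<in> cspan (v ` t)"
    by (intro exI[of _ "{t}"]) (auto intro: complex_vector.span_base)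
qed

section \<open>The ideal spanned by the products of \<open>V\<close> and \<open>U\<close>\<close>

context csl_iso
begin

definition U :: "('a \<Rightarrow>\<^sub>L 'b) set" where
  "U = {T \<in> bounded_ops. \<forall>P\<in>L. \<forall>x. f P \<cdot> T \<cdot> P \<cdot> x = T \<cdot> P \<cdot> x}"

definition V :: "('b \<Rightarrow>\<^sub>L 'a) set" where
  "V = {T \<in> bounded_ops. \<forall>P\<in>L. \<forall>x. P \<cdot> T \<cdot> f P \<cdot> x = T \<cdot> f P \<cdot> x}"

definition J :: "('a \<Rightarrow>\<^sub>L 'a) set" where
  "J = cspan (op_prod V U)"

lemma J_subset_Alg: "J \<subseteq> Alg L"
proof -
  have "csubspace (Alg L)"
    by (rule complex_vector.subspaceI)
      (auto simp: Alg_iff bounded_ops_closed blinfun.bilinear_simps scaleC_blinfun.rep_eq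
        bounded_opsD[OF projectionsD(1)[OF proj(1)]])
  moreover have "op_prod V U \<subseteq> Alg L"
  proof
    fix X assume "X \<in> op_prod V U"
    then obtain S T where X: "X = S o\<^sub>L T" and S: "S \<in> V" and T: "T \<in> U"
      by (auto simp: op_prod_def)
    have "P \<cdot> S \<cdot> T \<cdot> P \<cdot> x = S \<cdot> T \<cdot> P \<cdot> x" if "P \<in> L" for P x
    proof -
      have a: "f P \<cdot> T \<cdot> P \<cdot> x = T \<cdot> P \<cdot> x" using T that by (simp add: U_def)
      have "P \<cdot> S \<cdot> f P \<cdot> T \<cdot> P \<cdot> x = S \<cdot> f P \<cdot> T \<cdot> P \<cdot> x" using S that by (simp add: V_def)
      then show ?thesis by (simp only: a)
    qed
    then show "X \<in> Alg L"
      using S T by (auto simp: Alg_iff X U_def V_def intro!: bounded_ops_closed)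
  qed
  ultimately show ?thesis
    unfolding J_def by (simp add: complex_vector.span_minimal)
qed

lemma J_subspace: "csubspace J"
  unfolding J_def by (rule complex_vector.subspace_span)

text \<open>\<open>U\<close> absorbs \<open>Alg L\<close> on the right and \<open>V\<close> on the
  left. This permits cutting by atoms, which lie in \<open>Alg L\<close>, and multiplying an
  approximate unit onto any element of \<open>Alg L\<close>.\<close>

lemma J_ideal:
  assumes S: "S \<in> J" and T: "T \<in> Alg L"
  shows "S o\<^sub>L T \<in> J" "T o\<^sub>L S \<in> J"
proof -
  have TB: "T \<in> bounded_ops" and TP: "P \<in> L \<Longrightarrow> P \<cdot> T \<cdot> P \<cdot> x = T \<cdot> P \<cdot> x" for P x
    using T by (auto simp: Alg_iff)
  have z: "(0 o\<^sub>L T) = 0" "(T o\<^sub>L 0) = 0" by (rule blinfun_eqI; simp)+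
  have r: "csubspace {S. S o\<^sub>L T \<in> J}" and l: "csubspace {S. T o\<^sub>L S \<in> J}"
    by (rule complex_vector.subspaceI; simp add: z compose_add compose_scaleC_left compose_scaleC_right[OF TB]
        complex_vector.subspace_0[OF J_subspace] complex_vector.subspace_add[OF J_subspace]
        complex_vector.subspace_scale[OF J_subspace])+
  have b: "X o\<^sub>L T \<in> J \<and> T o\<^sub>L X \<in> J" if X: "X \<in> op_prod V U" for X
  proof -
    obtain v u where vu: "X = v o\<^sub>L u" "v \<in> V" "u \<in> U"
      using X by (auto simp: op_prod_def)
    have "f P \<cdot> u \<cdot> T \<cdot> P \<cdot> x = u \<cdot> T \<cdot> P \<cdot> x" if "P \<in> L" for P x
    proof -
      have "f P \<cdot> u \<cdot> P \<cdot> T \<cdot> P \<cdot> x = u \<cdot> P \<cdot> T \<cdot> P \<cdot> x" using vu(3) that by (auto simp: U_def)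
      then show ?thesis by (simp add: TP that)
    qed
    then have "u o\<^sub>L T \<in> U" using vu(3) TB by (auto simp: U_def intro!: bounded_ops_closed)
    moreover have "P \<cdot> T \<cdot> v \<cdot> f P \<cdot> y = T \<cdot> v \<cdot> f P \<cdot> y" if P: "P \<in> L" for P y
    proof -
      have "P \<cdot> v \<cdot> f P \<cdot> y = v \<cdot> f P \<cdot> y" using vu(2) P by (auto simp: V_def)
      then show ?thesis using TP[OF P, of "v \<cdot> f P \<cdot> y"] by simp
    qed
    then have "T o\<^sub>L v \<in> V" using vu(2) TB by (auto simp: V_def intro!: bounded_ops_closed)
    ultimately have "v o\<^sub>L (u o\<^sub>L T) \<in> op_prod V U" "(T o\<^sub>L v) o\<^sub>L u \<in> op_prod V U"
      using vu by (auto simp: op_prod_def)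
    then show ?thesis
      unfolding vu(1) J_def by (simp add: compose_assoc complex_vector.span_base)
  qed
  show "S o\<^sub>L T \<in> J"
    using complex_vector.span_induct[OF S[unfolded J_def] r] b by simp
  show "T o\<^sub>L S \<in> J"
    using complex_vector.span_induct[OF S[unfolded J_def] l] b by simp
qed

lemma commutant_Alg:
  assumes "T \<in> bounded_ops" "\<And>P x. P \<in> L \<Longrightarrow> T \<cdot> P \<cdot> x = P \<cdot> T \<cdot> x"
  shows "T \<in> Alg L"
  using assms proj(1) by (auto simp: Alg_iff projectionsD(2))

lemma approximate_unit_vector:
  assumes e: "0 < e"
  shows "\<exists>T\<in>J. (\<forall>x. norm (T \<cdot> x) \<le> norm x) \<and> norm (T \<cdot> \<xi> - \<xi>) \<le> e"
proof -
  \<comment> \<open>A contraction \<open>T\<close> with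
    \<open>Re <T \<xi>, \<xi>> \<ge> |\<xi>|^2 - 9 d\<close> moves \<xi> by at most the square root
    of \<open>18 d\<close>, which is \<open>e\<close>.\<close>
  define d where "d = e\<^sup>2 / 18"
  have d: "d > 0" using e by (simp add: d_def)
  obtain N where N: "\<And>P Q. P \<in> L \<Longrightarrow> Q \<in> L \<Longrightarrow> proj_le Q P \<Longrightarrow> excess \<xi> N P - excess \<xi> N Q \<le> d"
    using absolute_continuity[OF d] by blast
  obtain xs where xs: "mset xs = N" using ex_mset by blast
  define n where "n = length xs"
  have sums: "(\<Sum>\<eta>\<in>#N. g \<eta>) = (\<Sum>k<n. g (xs ! k))" for g :: "'b \<Rightarrow> real"
    by (simp add: xs[symmetric] n_def sum_mset_sum_list sum_list_sum_nth atLeast0LessThan flip: mset_map)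
  have "\<exists>\<zeta>. (\<forall>P\<in>L. (\<Sum>k<n. (norm (\<zeta> k - f P \<cdot> \<zeta> k))\<^sup>2) \<le> (norm (\<xi> - P \<cdot> \<xi>))\<^sup>2 + d \<and>
      (\<Sum>k<n. (norm (f P \<cdot> \<zeta> k))\<^sup>2) \<le> (norm (P \<cdot> \<xi>))\<^sup>2 + d) \<and>
    (norm \<xi>)\<^sup>2 - d \<le> (\<Sum>k<n. (norm (\<zeta> k))\<^sup>2)"
  proof (rule approximate_transport[OF d])
    fix P Q assume PQ: "P \<in> L" "Q \<in> L" "\<And>x. P \<cdot> Q \<cdot> x = Q \<cdot> x"
    then have "proj_le Q P" using proj_le_iff proj(1) by blast
    from N[OF PQ(1,2) this]
    show "(norm (P \<cdot> \<xi>))\<^sup>2 - (norm (Q \<cdot> \<xi>))\<^sup>2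
        \<le> (\<Sum>k<n. (norm (f P \<cdot> xs ! k))\<^sup>2) - (\<Sum>k<n. (norm (f Q \<cdot> xs ! k))\<^sup>2) + d"
      by (simp add: excess_def sums)
  qed
  then obtain \<zeta> where \<zeta>: "\<And>P. P \<in> L \<Longrightarrow> (\<Sum>k<n. (norm (\<zeta> k - f P \<cdot> \<zeta> k))\<^sup>2) \<le> (norm (\<xi> - P \<cdot> \<xi>))\<^sup>2 + d"
      "\<And>P. P \<in> L \<Longrightarrow> (\<Sum>k<n. (norm (f P \<cdot> \<zeta> k))\<^sup>2) \<le> (norm (P \<cdot> \<xi>))\<^sup>2 + d"
      "(norm \<xi>)\<^sup>2 - d \<le> (\<Sum>k<n. (norm (\<zeta> k))\<^sup>2)"
    by blast
  obtain u v where uv: "\<And>k. u k \<in> bounded_ops" "\<And>k. v k \<in> bounded_ops"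
    "\<And>k P x. P \<in> L \<Longrightarrow> f P \<cdot> u k \<cdot> P \<cdot> x = u k \<cdot> P \<cdot> x"
    "\<And>k P y. P \<in> L \<Longrightarrow> P \<cdot> v k \<cdot> f P \<cdot> y = v k \<cdot> f P \<cdot> y"
    "\<And>x. norm (\<Sum>k<n. v k \<cdot> u k \<cdot> x) \<le> norm x"
    "(norm \<xi>)\<^sup>2 - 9 * d \<le> Re (cinner (\<Sum>k<n. v k \<cdot> u k \<cdot> \<xi>) \<xi>)"
    using factorization[OF less_imp_le[OF d] \<zeta>] by blast
  define T where "T = (\<Sum>k<n. v k o\<^sub>L u k)"
  have Tx: "T \<cdot> x = (\<Sum>k<n. v k \<cdot> u k \<cdot> x)" for x by (simp add: T_def sum_blinfun_apply)
  have "v k o\<^sub>L u k \<in> op_prod V U" for k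
    unfolding op_prod_def by (intro CollectI exI[of _ "v k"] exI[of _ "u k"]) (simp add: U_def V_def uv)
  then have "T \<in> J" unfolding T_def J_def by (intro complex_vector.span_sum complex_vector.span_base)
  moreover have nT: "norm (T \<cdot> x) \<le> norm x" for x by (simp add: Tx uv(5))
  moreover have "norm (T \<cdot> \<xi> - \<xi>) \<le> e"
  proof (rule power2_le_imp_le)
    have "(norm (T \<cdot> \<xi>))\<^sup>2 \<le> (norm \<xi>)\<^sup>2" by (rule power_mono[OF nT]) simp
    moreover have "18 * d = e\<^sup>2" by (simp add: d_def)
    ultimately show "(norm (T \<cdot> \<xi> - \<xi>))\<^sup>2 \<le> e\<^sup>2"
      using uv(6) unfolding norm_diff_sq Tx by linarith
  qed (use e in simp)
  ultimately show ?thesis by blast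
qed

text \<open>Projections commuting with \<open>L\<close> on whose range \<open>J\<close> has an
  approximate unit of contractions. These are confined to the corner cut out by \<open>E\<close>, so
  that solutions in orthogonal corners add up to a contraction.\<close>

definition approximable :: "('a \<Rightarrow>\<^sub>L 'a) \<Rightarrow> bool" where
  "approximable E \<longleftrightarrow> E \<in> projections \<and> (\<forall>P\<in>L. \<forall>x. E \<cdot> P \<cdot> x = P \<cdot> E \<cdot> x) \<and>
     (\<forall>X e. finite X \<longrightarrow> X \<subseteq> range (blinfun_apply E) \<longrightarrow> 0 < e \<longrightarrow>
       (\<exists>T\<in>J. (\<forall>x. norm (T \<cdot> x) \<le> norm x) \<and> (\<forall>x. T \<cdot> E \<cdot> x = T \<cdot> x \<and> E \<cdot> T \<cdot> x = T \<cdot> x) \<and>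
         (\<forall>x\<in>X. norm (T \<cdot> x - x) \<le> e)))"

lemma approximableD:
  assumes "approximable E"
  shows "E \<in> projections" "P \<in> L \<Longrightarrow> E \<cdot> P \<cdot> x = P \<cdot> E \<cdot> x"
    "finite X \<Longrightarrow> X \<subseteq> range (blinfun_apply E) \<Longrightarrow> 0 < e \<Longrightarrow>
      \<exists>T\<in>J. (\<forall>x. norm (T \<cdot> x) \<le> norm x) \<and> (\<forall>x. T \<cdot> E \<cdot> x = T \<cdot> x \<and> E \<cdot> T \<cdot> x = T \<cdot> x) \<and>
         (\<forall>x\<in>X. norm (T \<cdot> x - x) \<le> e)"
  using assms unfolding approximable_def by blast+

text \<open>Both the inputs and the outputs of \<open>S\<close> and \<open>T\<close> are orthogonal,
  so squared norms add; each summand contributes half of the error.\<close>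

lemma approximable_sum:
  assumes E: "approximable E" and F: "approximable F" and orth: "\<And>x. E \<cdot> F \<cdot> x = 0" "\<And>x. F \<cdot> E \<cdot> x = 0"
  shows "approximable (E + F)"
  unfolding approximable_def
proof (intro conjI allI impI ballI)
  note Ep = approximableD(1)[OF E] and Fp = approximableD(1)[OF F]
  have cE: "cinner (E \<cdot> x) (F \<cdot> y) = 0" for x y
    by (simp add: projectionsD(3)[OF Ep] orth cinner.zero_right)
  have "E + F - (E o\<^sub>L F) = E + F" by (rule blinfun_eqI) (simp add: blinfun.bilinear_simps orth)
  then show EF: "E + F \<in> projections" using proj_join[OF Ep Fp] orth by simp
  show "(E + F) \<cdot> P \<cdot> x = P \<cdot> (E + F) \<cdot> x" if "P \<in> L" for P x
    using approximableD(2)[OF E that] approximableD(2)[OF F that] by (simp add: blinfun.bilinear_simps)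
  fix X and e :: real assume X: "finite X" "X \<subseteq> range (blinfun_apply (E + F))" and e: "0 < e"
  obtain S where S: "S \<in> J" "\<And>x. norm (S \<cdot> x) \<le> norm x" "\<And>x. S \<cdot> E \<cdot> x = S \<cdot> x" "\<And>x. E \<cdot> S \<cdot> x = S \<cdot> x"
    "\<And>z. z \<in> blinfun_apply E ` X \<Longrightarrow> norm (S \<cdot> z - z) \<le> e / 2"
    using approximableD(3)[OF E finite_imageI[OF X(1)] image_mono[OF subset_UNIV] half_gt_zero[OF e]] by blast
  obtain T where T: "T \<in> J" "\<And>x. norm (T \<cdot> x) \<le> norm x" "\<And>x. T \<cdot> F \<cdot> x = T \<cdot> x" "\<And>x. F \<cdot> T \<cdot> x = T \<cdot> x"
    "\<And>z. z \<in> blinfun_apply F ` X \<Longrightarrow> norm (T \<cdot> z - z) \<le> e / 2"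
    using approximableD(3)[OF F finite_imageI[OF X(1)] image_mono[OF subset_UNIV] half_gt_zero[OF e]] by blast
  show "\<exists>T\<in>J. (\<forall>x. norm (T \<cdot> x) \<le> norm x) \<and> (\<forall>x. T \<cdot> (E + F) \<cdot> x = T \<cdot> x \<and> (E + F) \<cdot> T \<cdot> x = T \<cdot> x) \<and>
         (\<forall>x\<in>X. norm (T \<cdot> x - x) \<le> e)"
  proof (intro bexI[of _ "S + T"] conjI allI ballI)
    fix x
    show "norm ((S + T) \<cdot> x) \<le> norm x"
    proof (rule power2_le_imp_le)
      have "cinner (S \<cdot> x) (T \<cdot> x) = 0" by (metis S(4) T(4) cE)
      then have "(norm ((S + T) \<cdot> x))\<^sup>2 = (norm (S \<cdot> E \<cdot> x))\<^sup>2 + (norm (T \<cdot> F \<cdot> x))\<^sup>2"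
        by (simp add: blinfun.bilinear_simps norm_add_orthogonal S(3) T(3))
      also have "\<dots> \<le> (norm (E \<cdot> x))\<^sup>2 + (norm (F \<cdot> x))\<^sup>2"
        by (intro add_mono power_mono S T) auto
      also have "\<dots> = (norm ((E + F) \<cdot> x))\<^sup>2"
        using norm_add_orthogonal[OF cE[of x x]] by (simp add: blinfun.bilinear_simps)
      also have "\<dots> \<le> (norm x)\<^sup>2" by (intro power_mono norm_proj_le EF) simp
      finally show "(norm ((S + T) \<cdot> x))\<^sup>2 \<le> (norm x)\<^sup>2" .
    qed simp
    have SF: "S \<cdot> F \<cdot> x = 0" and TE: "T \<cdot> E \<cdot> x = 0" for x
      using S(3)[of "F \<cdot> x"] T(3)[of "E \<cdot> x"] by (simp_all add: orth)
    have FS: "F \<cdot> S \<cdot> x = 0" and ET: "E \<cdot> T \<cdot> x = 0" for x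
      using orth(2)[of "S \<cdot> x"] orth(1)[of "T \<cdot> x"] by (simp_all add: S(4) T(4))
    show "(S + T) \<cdot> (E + F) \<cdot> x = (S + T) \<cdot> x" "(E + F) \<cdot> (S + T) \<cdot> x = (S + T) \<cdot> x"
      by (simp_all add: blinfun.bilinear_simps S(3,4) T(3,4) SF TE FS ET)
  next
    fix x assume x: "x \<in> X"
    then have "(E + F) \<cdot> x = x" using X(2) proj_range_iff[OF EF] by blast
    then have "(S + T) \<cdot> x - x = (S \<cdot> E \<cdot> x - E \<cdot> x) + (T \<cdot> F \<cdot> x - F \<cdot> x)"
      by (simp add: blinfun.bilinear_simps S(3) T(3) algebra_simps)
    also have "norm \<dots> \<le> e / 2 + e / 2"
      by (intro norm_triangle_le add_mono S(5) T(5) imageI x)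
    finally show "norm ((S + T) \<cdot> x - x) \<le> e" by simp
  qed (intro complex_vector.subspace_add J_subspace S T)
qed

text \<open>Finitely many vectors of the cyclic subspace are close to combinations of the vectors
  \<open>A s \<cdot> \<xi>\<close>, for the atoms of one common list. Solutions for these single
  vectors fit together as a block diagonal operator, which stays a contraction.\<close>

lemma approximable_cyclic: "\<exists>E. approximable E \<and> E \<cdot> \<xi> = \<xi> \<and> range (blinfun_apply E) = closure (cspan ((\<lambda>P. P \<cdot> \<xi>) ` L))"
proof -
  define C where "C = cspan ((\<lambda>P. P \<cdot> \<xi>) ` L)"
  have C: "csubspace C" unfolding C_def by (rule complex_vector.subspace_span)
  obtain E where Ep: "E \<in> projections" and rE: "range (blinfun_apply E) = closure C"
    using orthogonal_projection_exists[OF csubspace_closure[OF C]] by auto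
  have "id_blinfun \<cdot> \<xi> \<in> (\<lambda>P. P \<cdot> \<xi>) ` L" using one(1) by (rule imageI)
  then have "\<xi> \<in> C" unfolding C_def by (auto intro: complex_vector.span_base)
  then have E\<xi>: "E \<cdot> \<xi> = \<xi>" using closure_subset rE proj_range_iff[OF Ep] by blast
  have inv: "Q \<cdot> x \<in> C" if Q: "Q \<in> L" and x: "x \<in> C" for Q x
    using x unfolding C_def
  proof (rule complex_vector.span_induct)
    have "Q \<in> bounded_ops" using projectionsD(1) proj(1) Q by blast
    then show "csubspace {x. Q \<cdot> x \<in> cspan ((\<lambda>P. P \<cdot> \<xi>) ` L)}"
      using C unfolding C_def
      by (intro complex_vector.subspaceI)
        (auto simp: blinfun.bilinear_simps bounded_opsD complex_vector.subspace_0
          intro: complex_vector.subspace_add complex_vector.subspace_scale)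
    show "Q \<cdot> x \<in> cspan ((\<lambda>P. P \<cdot> \<xi>) ` L)" if x: "x \<in> (\<lambda>P. P \<cdot> \<xi>) ` L" for x
    proof -
      obtain P where P: "P \<in> L" "x = P \<cdot> \<xi>" using x by blast
      have "Q \<cdot> x = (Q o\<^sub>L P) \<cdot> \<xi>" by (simp add: P)
      moreover have "(Q o\<^sub>L P) \<cdot> \<xi> \<in> (\<lambda>P. P \<cdot> \<xi>) ` L" using meet(1)[OF Q P(1)] by (rule imageI)
      ultimately show ?thesis by (auto intro: complex_vector.span_base)
    qed
  qed
  have inv': "Q \<cdot> x \<in> closure C" if Q: "Q \<in> L" and x: "x \<in> closure C" for Q x
  proof -
    have "blinfun_apply Q ` closure C \<subseteq> closure C"
      by (rule image_closure_subset)
        (use inv[OF Q] closure_subset in \<open>auto intro!: continuous_intros\<close>)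
    then show ?thesis using x by blast
  qed
  have comm: "E \<cdot> P \<cdot> x = P \<cdot> E \<cdot> x" if P: "P \<in> L" for P x
  proof (rule invariant_commute[OF Ep proj(1)[OF P]])
    fix x
    have "P \<cdot> E \<cdot> x \<in> range (blinfun_apply E)" using inv'[OF P, of "E \<cdot> x"] rE by blast
    then show "E \<cdot> P \<cdot> E \<cdot> x = P \<cdot> E \<cdot> x" using proj_range_iff[OF Ep] by blast
  qed
  have "approximable E"
    unfolding approximable_def
  proof (intro conjI allI impI ballI)
    show "E \<in> projections" by (rule Ep)
    show "E \<cdot> P \<cdot> x = P \<cdot> E \<cdot> x" if "P \<in> L" for P x by (rule comm[OF that])
    fix X and e :: real assume X: "finite X" "X \<subseteq> range (blinfun_apply E)" and e: "0 < e"
    have "\<exists>y\<in>C. norm (x - y) < e / 3" if "x \<in> X" for x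
    proof -
      have "x \<in> closure C" using that X(2) unfolding rE by blast
      moreover have "e / 3 > 0" using e by simp
      ultimately have "\<exists>y\<in>C. dist y x < e / 3" unfolding closure_approachable by blast
      then show ?thesis by (simp add: dist_norm norm_minus_commute)
    qed
    then obtain y where y: "\<And>x. x \<in> X \<Longrightarrow> y x \<in> C" "\<And>x. x \<in> X \<Longrightarrow> norm (x - y x) < e / 3"
      by metis
    have "\<exists>t. finite t \<and> t \<subseteq> L \<and> y x \<in> cspan ((\<lambda>P. P \<cdot> \<xi>) ` t)" if "x \<in> X" for x
      using y(1)[OF that] unfolding C_def by (rule cspan_image_finite_subset)
    then obtain t where t: "\<And>x. x \<in> X \<Longrightarrow> finite (t x)" "\<And>x. x \<in> X \<Longrightarrow> t x \<subseteq> L"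
      "\<And>x. x \<in> X \<Longrightarrow> y x \<in> cspan ((\<lambda>P. P \<cdot> \<xi>) ` t x)"
      by metis
    obtain Ps where Ps: "set Ps = (\<Union>x\<in>X. t x)" using finite_list[of "\<Union>x\<in>X. t x"] X(1) t(1) by auto
    have PsL: "set Ps \<subseteq> L" using Ps t(2) by auto
    note cps = lists_cproj(1)[OF PsL]
    define W where "W = bits (length Ps)"
    define A where "A = (\<lambda>s. atom Ps s)"
    have fin: "finite W" by (simp add: W_def)
    have Ap: "A s \<in> projections" for s using atom_proj[OF cps] by (simp add: A_def)
    have AL: "A s \<cdot> P \<cdot> x = P \<cdot> A s \<cdot> x" if "P \<in> L" for P s x
      unfolding A_def by (rule atom_commute[symmetric]) (use cproj_commute[OF cproj_L] that PsL in auto)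
    have AAlg: "A s \<in> Alg L" for s by (rule commutant_Alg[OF projectionsD(1)[OF Ap] AL])
    have "y x \<in> cspan ((\<lambda>s. A s \<cdot> \<xi>) ` W)" if x: "x \<in> X" for x
    proof -
      have "P \<cdot> \<xi> \<in> cspan ((\<lambda>s. A s \<cdot> \<xi>) ` W)" if P: "P \<in> t x" for P
      proof -
        have PPs: "P \<in> set Ps" using P x Ps by blast
        have "P \<cdot> \<xi> = (\<Sum>s\<in>W. P \<cdot> A s \<cdot> \<xi>)"
          by (simp add: W_def A_def sum_atoms flip: blinfun.sum_right)
        also have "\<dots> \<in> cspan ((\<lambda>s. A s \<cdot> \<xi>) ` W)"
        proof (rule complex_vector.span_sum)
          fix s assume s: "s \<in> W"
          then have "P \<cdot> A s \<cdot> \<xi> = A s \<cdot> \<xi> \<or> P \<cdot> A s \<cdot> \<xi> = 0"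
            using atom_mem[OF cps PPs] by (simp add: W_def A_def)
          then show "P \<cdot> A s \<cdot> \<xi> \<in> cspan ((\<lambda>s. A s \<cdot> \<xi>) ` W)"
            using s by (auto intro: complex_vector.span_base complex_vector.span_zero)
        qed
        finally show ?thesis .
      qed
      then have "cspan ((\<lambda>P. P \<cdot> \<xi>) ` t x) \<subseteq> cspan ((\<lambda>s. A s \<cdot> \<xi>) ` W)"
        by (intro complex_vector.span_minimal complex_vector.subspace_span) auto
      then show ?thesis using t(3)[OF x] by blast
    qed
    then have "\<exists>a. y x = (\<Sum>s\<in>W. a s *\<^sub>C A s \<cdot> \<xi>)" if "x \<in> X" for x
      using cspan_image_sum[OF fin] that by blast
    then obtain a where a: "\<And>x. x \<in> X \<Longrightarrow> y x = (\<Sum>s\<in>W. a x s *\<^sub>C A s \<cdot> \<xi>)" by metis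
    define B where "B = 1 + (\<Sum>x\<in>X. \<Sum>s\<in>W. cmod (a x s))"
    have B: "B > 0" unfolding B_def by (intro add_pos_nonneg sum_nonneg) auto
    have aB: "(\<Sum>s\<in>W. cmod (a x s)) \<le> B" if "x \<in> X" for x
    proof -
      have "(\<Sum>s\<in>W. cmod (a x s)) \<le> (\<Sum>x\<in>X. \<Sum>s\<in>W. cmod (a x s))"
        using that X(1) by (intro member_le_sum[where f = "\<lambda>x. \<Sum>s\<in>W. cmod (a x s)"] sum_nonneg) auto
      then show ?thesis by (simp add: B_def)
    qed
    \<comment> \<open>\<open>B\<close> bounds all coefficient sums, so the error on each
      \<open>y x\<close> is at most \<open>e / 3\<close>; replacing \<open>x\<close> by
      \<open>y x\<close> before and after applying the operator costs the other two thirds.\<close>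
    define d where "d = e / (3 * B)"
    have d: "d > 0" "B * d = e / 3" using B e by (simp_all add: d_def)
    have "\<exists>T\<in>J. (\<forall>x. norm (T \<cdot> x) \<le> norm x) \<and> norm (T \<cdot> A s \<cdot> \<xi> - A s \<cdot> \<xi>) \<le> d" for s
      by (rule approximate_unit_vector[OF d(1)])
    then obtain T where T: "\<And>s. T s \<in> J" "\<And>s x. norm (T s \<cdot> x) \<le> norm x"
      "\<And>s. norm (T s \<cdot> A s \<cdot> \<xi> - A s \<cdot> \<xi>) \<le> d"
      by metis
    \<comment> \<open>Cutting by atoms on both sides keeps the blocks orthogonal, and the ideal
      property keeps the sum in \<open>J\<close>.\<close>
    define T0 where "T0 = (\<Sum>s\<in>W. A s o\<^sub>L (T s o\<^sub>L A s))"
    have T0x: "T0 \<cdot> x = (\<Sum>s\<in>W. A s \<cdot> T s \<cdot> A s \<cdot> x)" for x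
      by (simp add: T0_def sum_blinfun_apply)
    have T0J: "T0 \<in> J"
      unfolding T0_def by (intro complex_vector.subspace_sum[OF J_subspace] J_ideal T AAlg)
    have nT0: "norm (T0 \<cdot> x) \<le> norm x" for x
    proof (rule power2_le_imp_le)
      have "(norm (T0 \<cdot> x))\<^sup>2 = (\<Sum>s\<in>W. (norm (A s \<cdot> T s \<cdot> A s \<cdot> x))\<^sup>2)"
        unfolding T0x using cinner_atoms[OF cps] fin
        by (intro norm_sum_orthogonal) (auto simp: A_def W_def)
      also have "\<dots> \<le> (\<Sum>s\<in>W. (norm (A s \<cdot> x))\<^sup>2)"
        by (intro sum_mono power_mono order_trans[OF norm_proj_le[OF Ap] T(2)]) simp
      also have "\<dots> = (norm x)\<^sup>2" unfolding A_def W_def by (rule norm_atoms[OF cps])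
      finally show "(norm (T0 \<cdot> x))\<^sup>2 \<le> (norm x)\<^sup>2" .
    qed simp
    have T0y: "norm (T0 \<cdot> y x - y x) \<le> e / 3" if x: "x \<in> X" for x
    proof -
      have T0A: "T0 \<cdot> A s \<cdot> \<xi> = A s \<cdot> T s \<cdot> A s \<cdot> \<xi>" if s: "s \<in> W" for s
      proof -
        have "T0 \<cdot> A s \<cdot> \<xi> = (\<Sum>t\<in>{s}. A t \<cdot> T t \<cdot> A t \<cdot> A s \<cdot> \<xi>)"
          unfolding T0x using fin s atom_orthogonal[OF cps]
          by (intro sum.mono_neutral_right) (auto simp: A_def W_def)
        then show ?thesis by (simp add: projectionsD(2)[OF Ap])
      qed
      have T0b: "T0 \<in> bounded_ops" and Ab: "A s \<in> bounded_ops" for s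
        using T0J J_subset_Alg AAlg by (auto simp: Alg_iff)
      have "T0 \<cdot> y x - y x = (\<Sum>s\<in>W. a x s *\<^sub>C (A s \<cdot> (T s \<cdot> A s \<cdot> \<xi> - A s \<cdot> \<xi>)))"
        by (simp add: a[OF x] blinfun.sum_right bounded_opsD[OF T0b] T0A blinfun.diff_right
            projectionsD(2)[OF Ap] complex_vector.scale_right_diff_distrib sum_subtractf)
      also have "norm \<dots> \<le> (\<Sum>s\<in>W. cmod (a x s) * d)"
      proof (rule sum_norm_le)
        fix s
        have "norm (A s \<cdot> (T s \<cdot> A s \<cdot> \<xi> - A s \<cdot> \<xi>)) \<le> d"
          by (rule order_trans[OF norm_proj_le[OF Ap] T(3)])
        then show "norm (a x s *\<^sub>C (A s \<cdot> (T s \<cdot> A s \<cdot> \<xi> - A s \<cdot> \<xi>))) \<le> cmod (a x s) * d"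
          by (simp add: norm_scaleC mult_left_mono)
      qed
      also have "\<dots> = (\<Sum>s\<in>W. cmod (a x s)) * d" by (simp add: sum_distrib_right)
      also have "\<dots> \<le> B * d" using aB[OF x] d(1) by (intro mult_right_mono) auto
      finally show ?thesis by (simp add: d(2))
    qed
    have EAlg: "E \<in> Alg L" by (rule commutant_Alg[OF projectionsD(1)[OF Ep] comm])
    have Ey: "E \<cdot> y x = y x" if "x \<in> X" for x
    proof -
      have "y x \<in> range (blinfun_apply E)" using y(1)[OF that] closure_subset rE by blast
      then show ?thesis using proj_range_iff[OF Ep] by blast
    qed
    show "\<exists>T\<in>J. (\<forall>x. norm (T \<cdot> x) \<le> norm x) \<and> (\<forall>x. T \<cdot> E \<cdot> x = T \<cdot> x \<and> E \<cdot> T \<cdot> x = T \<cdot> x) \<and>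
         (\<forall>x\<in>X. norm (T \<cdot> x - x) \<le> e)"
    proof (intro bexI[of _ "E o\<^sub>L (T0 o\<^sub>L E)"] conjI allI ballI)
      show nE: "norm ((E o\<^sub>L (T0 o\<^sub>L E)) \<cdot> x) \<le> norm x" for x
        using norm_proj_le[OF Ep, of "T0 \<cdot> E \<cdot> x"] nT0[of "E \<cdot> x"] norm_proj_le[OF Ep, of x] by simp
      fix x assume x: "x \<in> X"
      define S where "S = E o\<^sub>L (T0 o\<^sub>L E)"
      have "S \<cdot> y x - y x = E \<cdot> (T0 \<cdot> y x - y x)" by (simp add: S_def blinfun.bilinear_simps Ey[OF x])
      then have "norm (S \<cdot> y x - y x) \<le> e / 3"
        using order_trans[OF norm_proj_le[OF Ep] T0y[OF x]] by simp
      moreover have "norm (S \<cdot> (x - y x)) \<le> norm (x - y x)" unfolding S_def by (rule nE)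
      moreover have "S \<cdot> x - x = S \<cdot> (x - y x) + (S \<cdot> y x - y x) + (y x - x)"
        by (simp add: blinfun.bilinear_simps)
      then have "norm (S \<cdot> x - x) \<le> norm (S \<cdot> (x - y x)) + norm (S \<cdot> y x - y x) + norm (y x - x)"
        using norm_triangle_ineq[of "S \<cdot> (x - y x) + (S \<cdot> y x - y x)" "y x - x"]
          norm_triangle_ineq[of "S \<cdot> (x - y x)" "S \<cdot> y x - y x"] by simp
      ultimately show "norm ((E o\<^sub>L (T0 o\<^sub>L E)) \<cdot> x - x) \<le> e"
        using y(2)[OF x] norm_minus_commute[of x "y x"] unfolding S_def[symmetric] by argo
    qed (auto simp: projectionsD(2)[OF Ep] intro: J_ideal T0J EAlg)
  qed
  then show ?thesis using E\<xi> rE unfolding C_def by blast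
qed

text \<open>Gram-Schmidt with cyclic subspaces: \<open>E\<close> commutes with \<open>L\<close>, so
  the component of \<open>x\<close> orthogonal to the range of \<open>E\<close> generates a cyclic
  subspace that is entirely orthogonal to it.\<close>

lemma approximable_contains:
  assumes "finite X"
  shows "\<exists>E. approximable E \<and> X \<subseteq> range (blinfun_apply E)"
  using assms
proof induction
  case empty
  have "approximable 0"
    unfolding approximable_def using zero_proj complex_vector.subspace_0[OF J_subspace]
    by (auto simp: blinfun.bilinear_simps intro!: bexI[of _ 0])
  then show ?case by blast
next
  case (insert x X)
  then obtain E where E: "approximable E" "X \<subseteq> range (blinfun_apply E)" by blast
  note Ep = approximableD(1)[OF E(1)]
  define \<xi> where "\<xi> = x - E \<cdot> x"
  obtain F where F: "approximable F" "F \<cdot> \<xi> = \<xi>" "range (blinfun_apply F) = closure (cspan ((\<lambda>P. P \<cdot> \<xi>) ` L))"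
    using approximable_cyclic by blast
  note Fp = approximableD(1)[OF F(1)]
  have E\<xi>: "E \<cdot> \<xi> = 0" by (simp add: \<xi>_def blinfun.bilinear_simps projectionsD(2)[OF Ep])
  have "csubspace {y. E \<cdot> y = 0}"
    using bounded_opsD[OF projectionsD(1)[OF Ep]]
    by (intro complex_vector.subspaceI) (auto simp: blinfun.bilinear_simps)
  moreover have "(\<lambda>P. P \<cdot> \<xi>) ` L \<subseteq> {y. E \<cdot> y = 0}"
    using approximableD(2)[OF E(1)] E\<xi> by (auto simp: blinfun.bilinear_simps)
  ultimately have "cspan ((\<lambda>P. P \<cdot> \<xi>) ` L) \<subseteq> {y. E \<cdot> y = 0}"
    by (rule complex_vector.span_minimal[rotated])
  moreover have "closed {y. E \<cdot> y = 0}" by (intro closed_Collect_eq continuous_intros)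
  ultimately have "closure (cspan ((\<lambda>P. P \<cdot> \<xi>) ` L)) \<subseteq> {y. E \<cdot> y = 0}"
    by (rule closure_minimal)
  then have EF: "E \<cdot> F \<cdot> y = 0" for y using F(3) by blast
  have FE: "F \<cdot> E \<cdot> y = 0" for y
  proof -
    have "cinner (F \<cdot> E \<cdot> y) z = 0" for z
      using projectionsD(3)[OF Fp] projectionsD(3)[OF Ep] EF by (simp add: cinner.zero_right)
    then show ?thesis by (rule eq_zero_if_orthogonal)
  qed
  have g: "approximable (E + F)" by (rule approximable_sum[OF E(1) F(1) EF FE])
  have "(E + F) \<cdot> y = y" if "y \<in> X" for y
  proof -
    have "E \<cdot> y = y" using E(2) that proj_range_iff[OF Ep] by blast
    then show ?thesis using FE[of y] by (simp add: blinfun.bilinear_simps)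
  qed
  moreover have "(E + F) \<cdot> x = x"
  proof -
    have "F \<cdot> x = F \<cdot> \<xi>" by (simp add: \<xi>_def blinfun.bilinear_simps FE)
    then show ?thesis by (simp add: blinfun.bilinear_simps F(2)) (simp add: \<xi>_def)
  qed
  ultimately have "insert x X \<subseteq> range (blinfun_apply (E + F))" by (metis insert_iff rangeI subsetI)
  then show ?case using g by blast
qed

theorem approximate_unit:
  assumes "finite X" "0 < e"
  shows "\<exists>T\<in>J. (\<forall>x. norm (T \<cdot> x) \<le> norm x) \<and> (\<forall>x\<in>X. norm (T \<cdot> x - x) \<le> e)"
proof -
  obtain E where "approximable E" "X \<subseteq> range (blinfun_apply E)" using approximable_contains[OF assms(1)] by blast
  then show ?thesis using approximableD(3)[OF _ assms(1) _ assms(2)] by blast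
qed

end

section \<open>The weak-* topology\<close>

lemma topspace_weak_star: "topspace weak_star_topology = (bounded_ops :: ('a::complex_hilbert \<Rightarrow>\<^sub>L 'b::complex_hilbert) set)"
proof -
  have "(\<lambda>T. \<Sum>n. cinner (blinfun_apply T ((\<lambda>_. 0) n)) ((\<lambda>_. 0) n)) \<in>
      (weak_star_functionals :: (('a \<Rightarrow>\<^sub>L 'b) \<Rightarrow> complex) set)"
    unfolding weak_star_functionals_def
    by (intro CollectI exI[of _ "\<lambda>_. 0 :: 'a"] exI[of _ "\<lambda>_. 0 :: 'b"]) simp
  then obtain \<phi> :: "('a \<Rightarrow>\<^sub>L 'b) \<Rightarrow> complex" where \<phi>: "\<phi> \<in> weak_star_functionals" by blast
  have "bounded_ops = {T \<in> bounded_ops. \<phi> T \<in> UNIV}" by simp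
  then have "bounded_ops \<in> {{T \<in> bounded_ops. \<phi> T \<in> W} | \<phi> W. \<phi> \<in> (weak_star_functionals :: (('a \<Rightarrow>\<^sub>L 'b) \<Rightarrow> complex) set) \<and> open W}"
    using \<phi> by blast
  then show ?thesis unfolding weak_star_topology_def by auto
qed

text \<open>By induction on the generation of open sets, every open set around \<open>T0\<close>
  contains a neighbourhood described by finitely many functionals and one radius.\<close>

lemma weak_star_closureI:
  fixes T0 :: "'a::complex_hilbert \<Rightarrow>\<^sub>L 'b::complex_hilbert"
  assumes T0: "T0 \<in> bounded_ops" and S: "S \<subseteq> bounded_ops"
    and approx: "\<And>\<Phi> e. finite \<Phi> \<Longrightarrow> \<Phi> \<subseteq> weak_star_functionals \<Longrightarrow> 0 < e \<Longrightarrow>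
      \<exists>T\<in>S. \<forall>\<phi>\<in>\<Phi>. cmod (\<phi> T - \<phi> T0) < e"
  shows "T0 \<in> weak_star_topology closure_of S"
proof -
  define G where "G = {{T \<in> bounded_ops. \<phi> T \<in> W} | \<phi> W. \<phi> \<in> (weak_star_functionals :: (('a \<Rightarrow>\<^sub>L 'b) \<Rightarrow> complex) set) \<and> open W}"
  have nbhd: "\<exists>\<Phi> e. finite \<Phi> \<and> \<Phi> \<subseteq> weak_star_functionals \<and> 0 < e \<and>
      (\<forall>T\<in>bounded_ops. (\<forall>\<phi>\<in>\<Phi>. cmod (\<phi> T - \<phi> T0) < e) \<longrightarrow> T \<in> O')"
    if "generate_topology_on G O'" "T0 \<in> O'" for O'
    using that
  proof induction
    case (Int a b)
    then obtain \<Phi> e \<Psi> d where *: "finite \<Phi>" "\<Phi> \<subseteq> weak_star_functionals" "0 < e"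
      "\<And>T. T \<in> bounded_ops \<Longrightarrow> (\<forall>\<phi>\<in>\<Phi>. cmod (\<phi> T - \<phi> T0) < e) \<Longrightarrow> T \<in> a"
      "finite \<Psi>" "\<Psi> \<subseteq> weak_star_functionals" "0 < d"
      "\<And>T. T \<in> bounded_ops \<Longrightarrow> (\<forall>\<phi>\<in>\<Psi>. cmod (\<phi> T - \<phi> T0) < d) \<Longrightarrow> T \<in> b"
      by auto
    show ?case
    proof (intro exI conjI ballI impI)
      show "finite (\<Phi> \<union> \<Psi>)" "\<Phi> \<union> \<Psi> \<subseteq> weak_star_functionals" "0 < min e d" using * by auto
      fix T assume T: "T \<in> bounded_ops" "\<forall>\<phi>\<in>\<Phi> \<union> \<Psi>. cmod (\<phi> T - \<phi> T0) < min e d"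
      then show "T \<in> a \<inter> b" using *(4,8) by simp
    qed
  next
    case (UN K)
    then obtain k where k: "k \<in> K" "T0 \<in> k" by blast
    from UN.IH[OF this] show ?case using k(1) by (meson UnionI)
  next
    case (Basis s)
    then obtain \<phi> W where s: "s = {T \<in> bounded_ops. \<phi> T \<in> W}" "\<phi> \<in> weak_star_functionals" "open W"
      unfolding G_def by blast
    then have "\<phi> T0 \<in> W" using Basis by simp
    then obtain e where "0 < e" "\<And>z. dist z (\<phi> T0) < e \<Longrightarrow> z \<in> W"
      using s(3) unfolding open_dist by blast
    then show ?case using s by (intro exI[of _ "{\<phi>}"] exI[of _ e]) (auto simp: dist_norm)
  qed simp
  show ?thesis
    unfolding in_closure_of
  proof (intro conjI allI impI)
    show "T0 \<in> topspace weak_star_topology" using T0 by (simp add: topspace_weak_star)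
    fix O' assume O': "T0 \<in> O' \<and> openin weak_star_topology O'"
    then have "generate_topology_on G O'"
      unfolding weak_star_topology_def G_def by (simp add: openin_topology_generated_by_iff)
    then obtain \<Phi> e where "finite \<Phi>" "\<Phi> \<subseteq> weak_star_functionals" "0 < e"
      and *: "\<And>T. T \<in> bounded_ops \<Longrightarrow> (\<forall>\<phi>\<in>\<Phi>. cmod (\<phi> T - \<phi> T0) < e) \<Longrightarrow> T \<in> O'"
      using nbhd[of O'] O' by blast
    then obtain T where "T \<in> S" "\<forall>\<phi>\<in>\<Phi>. cmod (\<phi> T - \<phi> T0) < e" using approx by blast
    then show "\<exists>y. y \<in> S \<and> y \<in> O'" using * S by blast
  qed
qed

lemma weak_star_closure_vanish:
  assumes \<phi>: "\<phi> \<in> weak_star_functionals" "\<And>T. T \<in> S \<Longrightarrow> \<phi> T = 0"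
    and T: "T \<in> weak_star_topology closure_of S"
  shows "\<phi> T = 0"
proof (rule ccontr)
  assume "\<phi> T \<noteq> 0"
  have op: "openin weak_star_topology {T \<in> bounded_ops. \<phi> T \<in> - {0}}"
    unfolding weak_star_topology_def
    by (rule topology_generated_by_Basis) (use \<phi>(1) in \<open>blast intro: open_Compl closed_singleton\<close>)
  have "T \<in> bounded_ops" using T in_closure_of topspace_weak_star by metis
  then have in_op: "T \<in> {T \<in> bounded_ops. \<phi> T \<in> - {0}}" using \<open>\<phi> T \<noteq> 0\<close> by simp
  have "\<forall>O'. T \<in> O' \<and> openin weak_star_topology O' \<longrightarrow> (\<exists>y. y \<in> S \<and> y \<in> O')"
    by (rule conjunct2[OF T[unfolded in_closure_of]])
  from this[rule_format, OF conjI[OF in_op op]] show False using \<phi>(2) by auto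
qed

lemma vector_functional: "(\<lambda>T. cinner (T \<cdot> x) y) \<in> weak_star_functionals"
proof -
  define X where "X = (\<lambda>n :: nat. if n = 0 then x else 0)"
  define Y where "Y = (\<lambda>n :: nat. if n = 0 then y else 0)"
  have sX: "summable (\<lambda>n. (norm (X n))\<^sup>2)" and sY: "summable (\<lambda>n. (norm (Y n))\<^sup>2)"
    by (rule summable_finite[of "{0}"]; simp add: X_def Y_def)+
  have "(\<Sum>n. cinner (T \<cdot> X n) (Y n)) = cinner (T \<cdot> x) y" for T
  proof -
    have "(\<Sum>n. cinner (T \<cdot> X n) (Y n)) = (\<Sum>n\<in>{0}. cinner (T \<cdot> X n) (Y n))"
      by (rule suminf_finite) (auto simp: X_def cinner.zero_left)
    then show ?thesis by (simp add: X_def Y_def)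
  qed
  then have "(\<lambda>T. cinner (T \<cdot> x) y) = (\<lambda>T. \<Sum>n. cinner (T \<cdot> X n) (Y n))" by simp
  then show ?thesis unfolding weak_star_functionals_def using sX sY by blast
qed

text \<open>Invariance of the range of \<open>P\<close> under \<open>T\<close> means that all
  \<open><T P x, (1 - P) y>\<close> vanish, and these are weak-* continuous in
  \<open>T\<close>.\<close>

lemma Alg_weak_star_closed:
  assumes "L \<subseteq> projections" "S \<subseteq> Alg L"
  shows "weak_star_topology closure_of S \<subseteq> Alg L"
proof
  fix T assume T: "T \<in> weak_star_topology closure_of S"
  have "T \<in> bounded_ops" using T in_closure_of topspace_weak_star by metis
  moreover have "P \<cdot> T \<cdot> P \<cdot> x = T \<cdot> P \<cdot> x" if P: "P \<in> L" for P x
  proof -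
    have Pp: "P \<in> projections" using P assms(1) by blast
    have eq: "cinner (R \<cdot> P \<cdot> x) (y - P \<cdot> y) = cinner (R \<cdot> P \<cdot> x - P \<cdot> R \<cdot> P \<cdot> x) y" for R y
      by (simp add: cinner.diff_left cinner.diff_right projectionsD(3)[OF Pp])
    have "cinner (T \<cdot> P \<cdot> x) (y - P \<cdot> y) = 0" for y
    proof (rule weak_star_closure_vanish[OF vector_functional _ T])
      fix R assume "R \<in> S"
      then have "P \<cdot> R \<cdot> P \<cdot> x = R \<cdot> P \<cdot> x" using assms(2) P by (auto simp: Alg_iff)
      then show "cinner (R \<cdot> P \<cdot> x) (y - P \<cdot> y) = 0" by (simp add: eq cinner.zero_left)
    qed
    then show ?thesis
      using eq_zero_if_orthogonal[of "T \<cdot> P \<cdot> x - P \<cdot> T \<cdot> P \<cdot> x"] by (simp add: eq)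
  qed
  ultimately show "T \<in> Alg L" by (simp add: Alg_iff)
qed

text \<open>For contractions \<open>S\<close> the tail of the series is dominated by twice a
  summable sequence, uniformly in \<open>S\<close>. What remains involves only the finitely many
  vectors \<open>T0 \<cdot> x n\<close> with \<open>n < N\<close>.\<close>

lemma functional_approx:
  fixes T0 :: "'a::complex_hilbert \<Rightarrow>\<^sub>L 'b::complex_hilbert"
  assumes \<phi>: "\<phi> \<in> weak_star_functionals" and e: "0 < e"
  shows "\<exists>X d. finite X \<and> 0 < d \<and> (\<forall>S. (\<forall>z. norm (S \<cdot> z) \<le> norm z) \<longrightarrow> (\<forall>z\<in>X. norm (S \<cdot> z - z) \<le> d) \<longrightarrow>
    cmod (\<phi> (S o\<^sub>L T0) - \<phi> T0) < e)"
proof -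
  obtain x y where \<phi>_eq: "\<phi> = (\<lambda>T. \<Sum>n. cinner (T \<cdot> x n) (y n))"
    and sx: "summable (\<lambda>n. (norm (x n))\<^sup>2)" and sy: "summable (\<lambda>n. (norm (y n))\<^sup>2)"
    using \<phi> unfolding weak_star_functionals_def by blast
  define a where "a = (\<lambda>n. norm (T0 \<cdot> x n) * norm (y n))"
  have sa: "summable a"
  proof (rule summable_comparison_test')
    show "summable (\<lambda>n. ((norm T0)\<^sup>2 * (norm (x n))\<^sup>2 + (norm (y n))\<^sup>2) / 2)"
      by (intro summable_divide summable_add summable_mult sx sy)
    fix n
    have "a n \<le> ((norm (T0 \<cdot> x n))\<^sup>2 + (norm (y n))\<^sup>2) / 2"
      unfolding a_def by (rule mult_le_mean_squares)
    also have "(norm (T0 \<cdot> x n))\<^sup>2 \<le> (norm T0 * norm (x n))\<^sup>2"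
      by (intro power_mono norm_blinfun) simp
    finally show "norm (a n) \<le> ((norm T0)\<^sup>2 * (norm (x n))\<^sup>2 + (norm (y n))\<^sup>2) / 2"
      by (simp add: a_def power_mult_distrib)
  qed
  have "summable (\<lambda>n. 2 * a n)" by (intro summable_mult sa)
  moreover have "e / 2 > 0" using e by simp
  ultimately obtain N where N: "norm (\<Sum>i. 2 * a (i + N)) < e / 2"
    using suminf_exist_split[of "e / 2" "\<lambda>n. 2 * a n"] by blast
  define B where "B = 1 + (\<Sum>n<N. norm (y n))"
  have B: "B > 0" unfolding B_def by (intro add_pos_nonneg sum_nonneg) auto
  \<comment> \<open>Tail and head of the series each receive \<open>e / 2\<close>.\<close>
  define d where "d = e / (2 * B)"
  have d: "d > 0" "d * B = e / 2" using B e by (simp_all add: d_def)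
  show ?thesis
  proof (intro exI conjI allI impI)
    show "finite ((\<lambda>n. T0 \<cdot> x n) ` {..<N})" "0 < d" using d by auto
    fix S :: "'b \<Rightarrow>\<^sub>L 'b" assume S: "\<forall>z. norm (S \<cdot> z) \<le> norm z"
      "\<forall>z\<in>(\<lambda>n. T0 \<cdot> x n) ` {..<N}. norm (S \<cdot> z - z) \<le> d"
    define g where "g = (\<lambda>n. cinner (S \<cdot> T0 \<cdot> x n - T0 \<cdot> x n) (y n))"
    have bd: "cmod (cinner u (y n)) \<le> norm u * norm (y n)" for u n by (rule cauchy_schwarz)
    have s1: "summable (\<lambda>n. cinner (S \<cdot> T0 \<cdot> x n) (y n))"
    proof (rule summable_comparison_test'[OF sa])
      fix n
      have "cmod (cinner (S \<cdot> T0 \<cdot> x n) (y n)) \<le> norm (S \<cdot> T0 \<cdot> x n) * norm (y n)" by (rule bd)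
      also have "\<dots> \<le> a n" unfolding a_def using S(1) by (intro mult_right_mono) auto
      finally show "cmod (cinner (S \<cdot> T0 \<cdot> x n) (y n)) \<le> a n" .
    qed
    have s2: "summable (\<lambda>n. cinner (T0 \<cdot> x n) (y n))"
      by (rule summable_comparison_test'[OF sa]) (simp add: a_def bd)
    have sg: "summable g"
      unfolding g_def cinner.diff_left by (rule summable_diff[OF s1 s2])
    have "\<phi> (S o\<^sub>L T0) - \<phi> T0 = (\<Sum>n. g n)"
      unfolding \<phi>_eq g_def cinner.diff_left using suminf_diff[OF s1 s2] by simp
    also have "\<dots> = (\<Sum>i. g (i + N)) + (\<Sum>i<N. g i)"
      by (rule suminf_split_initial_segment[OF sg])
    finally have eq: "\<phi> (S o\<^sub>L T0) - \<phi> T0 = (\<Sum>i. g (i + N)) + (\<Sum>i<N. g i)" .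
    have "norm (\<Sum>i. g (i + N)) \<le> (\<Sum>i. 2 * a (i + N))"
    proof (rule norm_suminf_le)
      show "summable (\<lambda>i. 2 * a (i + N))" by (intro summable_mult summable_ignore_initial_segment sa)
      fix i
      have "norm (S \<cdot> T0 \<cdot> x (i + N) - T0 \<cdot> x (i + N)) \<le> 2 * norm (T0 \<cdot> x (i + N))"
        using norm_triangle_ineq4[of "S \<cdot> T0 \<cdot> x (i + N)" "T0 \<cdot> x (i + N)"] S(1)[rule_format, of "T0 \<cdot> x (i + N)"]
        by linarith
      then show "norm (g (i + N)) \<le> 2 * a (i + N)"
        unfolding g_def a_def mult.assoc[symmetric] by (intro order_trans[OF bd mult_right_mono]) auto
    qed
    also have "\<dots> < e / 2" using N by (simp add: abs_less_iff)
    finally have 1: "norm (\<Sum>i. g (i + N)) < e / 2" .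
    have "norm (\<Sum>i<N. g i) \<le> (\<Sum>i<N. d * norm (y i))"
    proof (rule sum_norm_le)
      fix i assume "i \<in> {..<N}"
      then have "norm (S \<cdot> T0 \<cdot> x i - T0 \<cdot> x i) \<le> d" using S(2) by blast
      then show "norm (g i) \<le> d * norm (y i)"
        unfolding g_def by (intro order_trans[OF bd mult_right_mono]) auto
    qed
    also have "\<dots> = d * (\<Sum>i<N. norm (y i))" by (simp add: sum_distrib_left)
    also have "\<dots> \<le> d * B" using d(1) by (intro mult_left_mono) (auto simp: B_def)
    finally have 2: "norm (\<Sum>i<N. g i) \<le> e / 2" by (simp add: d(2))
    show "cmod (\<phi> (S o\<^sub>L T0) - \<phi> T0) < e"
      unfolding eq using norm_triangle_ineq[of "\<Sum>i. g (i + N)" "\<Sum>i<N. g i"] 1 2 by argo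
  qed
qed

lemma functionals_approx:
  fixes T0 :: "'a::complex_hilbert \<Rightarrow>\<^sub>L 'b::complex_hilbert"
  assumes "finite \<Phi>" "\<Phi> \<subseteq> weak_star_functionals" and e: "0 < e"
  shows "\<exists>X d. finite X \<and> 0 < d \<and> (\<forall>S. (\<forall>z. norm (S \<cdot> z) \<le> norm z) \<longrightarrow> (\<forall>z\<in>X. norm (S \<cdot> z - z) \<le> d) \<longrightarrow>
    (\<forall>\<phi>\<in>\<Phi>. cmod (\<phi> (S o\<^sub>L T0) - \<phi> T0) < e))"
  using assms(1,2)
proof induction
  case empty
  then show ?case by (intro exI[of _ "{}"] exI[of _ 1]) simp
next
  case (insert \<phi> \<Phi>)
  then obtain X d where X: "finite X" "0 < d" "\<And>S. (\<forall>z. norm (S \<cdot> z) \<le> norm z) \<Longrightarrow>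
      (\<forall>z\<in>X. norm (S \<cdot> z - z) \<le> d) \<Longrightarrow> (\<forall>\<phi>\<in>\<Phi>. cmod (\<phi> (S o\<^sub>L T0) - \<phi> T0) < e)"
    by auto
  obtain Y c where Y: "finite Y" "0 < c" "\<And>S. (\<forall>z. norm (S \<cdot> z) \<le> norm z) \<Longrightarrow>
      (\<forall>z\<in>Y. norm (S \<cdot> z - z) \<le> c) \<Longrightarrow> cmod (\<phi> (S o\<^sub>L T0) - \<phi> T0) < e"
    using functional_approx[of \<phi> e T0] insert.prems e by auto
  show ?case
  proof (intro exI[of _ "X \<union> Y"] exI[of _ "min d c"] conjI allI impI)
    fix S :: "'b \<Rightarrow>\<^sub>L 'b" assume S: "\<forall>z. norm (S \<cdot> z) \<le> norm z" "\<forall>z\<in>X \<union> Y. norm (S \<cdot> z - z) \<le> min d c"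
    then show "\<forall>\<phi>\<in>insert \<phi> \<Phi>. cmod (\<phi> (S o\<^sub>L T0) - \<phi> T0) < e"
      using X(3)[OF S(1)] Y(3)[OF S(1)] by auto
  qed (use X Y in auto)
qed

section \<open>Isomorphic lattices give equivalent algebras\<close>

context csl_iso
begin

text \<open>An approximate unit times \<open>T0\<close> stays in \<open>J\<close> and agrees with
  \<open>T0\<close> up to \<open>e\<close> on any finite set of functionals.\<close>

lemma J_closure: "weak_star_topology closure_of J = Alg L"
proof
  show "weak_star_topology closure_of J \<subseteq> Alg L"
    using proj(1) by (intro Alg_weak_star_closed J_subset_Alg) auto
  show "Alg L \<subseteq> weak_star_topology closure_of J"
  proof
    fix T0 assume T0: "T0 \<in> Alg L"
    show "T0 \<in> weak_star_topology closure_of J"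
    proof (rule weak_star_closureI)
      show "T0 \<in> bounded_ops" using T0 by (simp add: Alg_iff)
      show "J \<subseteq> bounded_ops" using J_subset_Alg by (auto simp: Alg_iff)
      fix \<Phi> :: "(('a \<Rightarrow>\<^sub>L 'a) \<Rightarrow> complex) set" and e :: real
      assume "finite \<Phi>" "\<Phi> \<subseteq> weak_star_functionals" "0 < e"
      then obtain X d where X: "finite X" "0 < d" "\<And>S. (\<forall>z. norm (S \<cdot> z) \<le> norm z) \<Longrightarrow>
          (\<forall>z\<in>X. norm (S \<cdot> z - z) \<le> d) \<Longrightarrow> (\<forall>\<phi>\<in>\<Phi>. cmod (\<phi> (S o\<^sub>L T0) - \<phi> T0) < e)"
        using functionals_approx[of \<Phi> e T0] by blast
      obtain S where "S \<in> J" "\<forall>z. norm (S \<cdot> z) \<le> norm z" "\<forall>z\<in>X. norm (S \<cdot> z - z) \<le> d"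
        using approximate_unit[OF X(1,2)] by blast
      then show "\<exists>T\<in>J. \<forall>\<phi>\<in>\<Phi>. cmod (\<phi> T - \<phi> T0) < e"
        using X(3) J_ideal(1)[OF _ T0] by blast
    qed
  qed
qed

text \<open>Exchanging the lattices exchanges \<open>U\<close> and \<open>V\<close>, so the closure
  condition for the second algebra is that for the first applied to the inverse.\<close>

lemma inverse_iso: "csl_iso M L (inv_into L f)"
proof
  have inj: "inj_on f L" and im: "f ` L = M" using bij by (auto simp: bij_betw_def)
  show "csl M" "csl L" by (rule csl_M csl_L)+
  show "bij_betw (inv_into L f) M L" by (rule bij_betw_inv_into[OF bij])
  fix P Q assume "P \<in> M" "Q \<in> M"
  then show "proj_le P Q \<longleftrightarrow> proj_le (inv_into L f P) (inv_into L f Q)"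
    using order[of "inv_into L f P" "inv_into L f Q"] im
    by (metis f_inv_into_f inv_into_into)
qed

lemma U_bimodule: "op_prod (Alg M) (op_prod U (Alg L)) \<subseteq> U"
proof
  fix X assume "X \<in> op_prod (Alg M) (op_prod U (Alg L))"
  then obtain R S T where X: "X = R o\<^sub>L (S o\<^sub>L T)" and R: "R \<in> Alg M" and S: "S \<in> U" and T: "T \<in> Alg L"
    unfolding op_prod_def by blast
  have "f P \<cdot> R \<cdot> S \<cdot> T \<cdot> P \<cdot> x = R \<cdot> S \<cdot> T \<cdot> P \<cdot> x" if P: "P \<in> L" for P x
  proof -
    have 1: "P \<cdot> T \<cdot> P \<cdot> x = T \<cdot> P \<cdot> x" using T P by (simp add: Alg_iff)
    have "f P \<cdot> S \<cdot> P \<cdot> T \<cdot> P \<cdot> x = S \<cdot> P \<cdot> T \<cdot> P \<cdot> x" using S P by (simp add: U_def)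
    then have 2: "f P \<cdot> S \<cdot> T \<cdot> P \<cdot> x = S \<cdot> T \<cdot> P \<cdot> x" by (simp only: 1)
    have "f P \<cdot> R \<cdot> f P \<cdot> S \<cdot> T \<cdot> P \<cdot> x = R \<cdot> f P \<cdot> S \<cdot> T \<cdot> P \<cdot> x" using R f_in[OF P] by (simp add: Alg_iff)
    then show ?thesis by (simp only: 2)
  qed
  then show "X \<in> U" using R S T by (auto simp: X U_def Alg_iff intro!: bounded_ops_closed)
qed

lemma U_subspace: "csubspace U" "U \<subseteq> bounded_ops"
proof -
  show "csubspace U"
    unfolding U_def
    by (rule complex_vector.subspaceI)
      (auto simp: bounded_ops_closed blinfun.bilinear_simps scaleC_blinfun.rep_eq
        bounded_opsD[OF projectionsD(1)[OF proj(2)]])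
qed (auto simp: U_def)

lemma morita: "spatially_morita_equivalent (Alg L) (Alg M)"
proof -
  interpret i: csl_iso M L "inv_into L f" by (rule inverse_iso)
  have inv: "inv_into L f (f P) = P" if "P \<in> L" for P
    using bij that by (simp add: bij_betw_def)
  have M: "M = f ` L" using bij by (simp add: bij_betw_def)
  have UV: "i.U = V" "i.V = U"
    unfolding i.U_def i.V_def U_def V_def by (auto simp: M inv)
  have "csubspace U" "csubspace V" "U \<subseteq> bounded_ops" "V \<subseteq> bounded_ops"
    using U_subspace i.U_subspace by (simp_all add: UV)
  moreover have "op_prod (Alg M) (op_prod U (Alg L)) \<subseteq> U" "op_prod (Alg L) (op_prod V (Alg M)) \<subseteq> V"
    using U_bimodule i.U_bimodule by (simp_all add: UV)
  moreover have "weak_star_topology closure_of (cspan (op_prod V U)) = Alg L"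
    using J_closure by (simp add: J_def)
  moreover have "weak_star_topology closure_of (cspan (op_prod U V)) = Alg M"
    using i.J_closure by (simp add: i.J_def UV)
  ultimately show ?thesis
    unfolding spatially_morita_equivalent_def by blast
qed

end

section \<open>The lattice of a CSL algebra\<close>

lemma Lat_iff:
  "P \<in> Lat A \<longleftrightarrow> P \<in> projections \<and> (\<forall>T\<in>A. \<forall>x. P \<cdot> T \<cdot> P \<cdot> x = T \<cdot> P \<cdot> x)"
  by (simp add: Lat_def invariant_iff)

lemma Lat_range_iff:
  "P \<in> Lat A \<longleftrightarrow> P \<in> projections \<and> (\<forall>T\<in>A. \<forall>x\<in>range (blinfun_apply P). T \<cdot> x \<in> range (blinfun_apply P))"
proof (cases "P \<in> projections")
  case True
  have "(\<forall>x\<in>range (blinfun_apply P). T \<cdot> x \<in> range (blinfun_apply P)) \<longleftrightarrow> (\<forall>x. P \<cdot> T \<cdot> P \<cdot> x = T \<cdot> P \<cdot> x)" for T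
    unfolding proj_range_iff[OF True, of "T \<cdot> x" for x] by blast
  then show ?thesis using True by (simp add: Lat_iff)
qed (simp add: Lat_iff)

lemma maps_closed_span:
  assumes T: "T \<in> bounded_ops" and Z: "csubspace Z" "closed Z" and X: "\<And>x. x \<in> X \<Longrightarrow> T \<cdot> x \<in> Z"
    and x: "x \<in> closure (cspan X)"
  shows "T \<cdot> x \<in> Z"
proof -
  have "csubspace {x. T \<cdot> x \<in> Z}"
    using Z(1) by (intro complex_vector.subspaceI)
      (auto simp: blinfun.bilinear_simps bounded_opsD[OF T] complex_vector.subspace_0
        intro: complex_vector.subspace_add complex_vector.subspace_scale)
  then have "cspan X \<subseteq> {x. T \<cdot> x \<in> Z}"
    using X by (intro complex_vector.span_minimal) auto
  then have "blinfun_apply T ` cspan X \<subseteq> Z" by blast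
  then have "blinfun_apply T ` closure (cspan X) \<subseteq> Z"
    by (intro image_closure_subset Z(2) continuous_intros)
  then show ?thesis using x by blast
qed

lemma proj_sup_exists:
  fixes S :: "('a::complex_hilbert \<Rightarrow>\<^sub>L 'a) set"
  shows "\<exists>P. is_proj_sup S P \<and> range (blinfun_apply P) = closure (cspan (\<Union>Q\<in>S. range (blinfun_apply Q)))"
proof -
  define X where "X = (\<Union>Q\<in>S. range (blinfun_apply Q))"
  obtain P where P: "P \<in> projections" "range (blinfun_apply P) = closure (cspan X)"
    using orthogonal_projection_exists[OF csubspace_closure[OF complex_vector.subspace_span] closed_closure, of X] by blast
  have "X \<subseteq> closure (cspan X)" using complex_vector.span_superset closure_subset by blast
  then have "\<forall>Q\<in>S. proj_le Q P" unfolding proj_le_def P(2) X_def by blast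
  moreover have "proj_le P R" if R: "R \<in> projections" "\<forall>Q\<in>S. proj_le Q R" for R
  proof -
    have "X \<subseteq> range (blinfun_apply R)" using R(2) by (auto simp: X_def proj_le_def)
    then have "cspan X \<subseteq> range (blinfun_apply R)"
      by (intro complex_vector.span_minimal closed_proj_range R)
    then show ?thesis unfolding proj_le_def P(2) by (intro closure_minimal closed_proj_range R)
  qed
  ultimately show ?thesis using P unfolding is_proj_sup_def X_def by blast
qed

lemma proj_inf_exists:
  fixes S :: "('a::complex_hilbert \<Rightarrow>\<^sub>L 'a) set"
  assumes S: "S \<subseteq> projections"
  shows "\<exists>P. is_proj_inf S P \<and> range (blinfun_apply P) = (\<Inter>Q\<in>S. range (blinfun_apply Q))"
proof -
  have "csubspace (\<Inter>Q\<in>S. range (blinfun_apply Q))"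
    using S closed_proj_range(2) by (intro complex_vector.subspace_Inter) auto
  moreover have "closed (\<Inter>Q\<in>S. range (blinfun_apply Q))"
    using S closed_proj_range(1) by (intro closed_INT) auto
  ultimately obtain P where P: "P \<in> projections" "range (blinfun_apply P) = (\<Inter>Q\<in>S. range (blinfun_apply Q))"
    using orthogonal_projection_exists by blast
  have "is_proj_inf S P"
    unfolding is_proj_inf_def proj_le_def P(2) using P(1) by (auto simp: le_INF_iff)
  then show ?thesis using P by blast
qed

text \<open>The Galois connection between \<open>Alg\<close> and \<open>Lat\<close>. It identifies
  the algebra of the lattice to which an isomorphism of \<open>Lat\<close> refers with the given
  one.\<close>

lemma Alg_Lat_Alg: "L \<subseteq> projections \<Longrightarrow> Alg (Lat (Alg L)) = Alg L"
proof -
  assume "L \<subseteq> projections"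
  then have "L \<subseteq> Lat (Alg L)" by (auto simp: Lat_iff Alg_iff)
  then have "Alg (Lat (Alg L)) \<subseteq> Alg L" by (auto simp: Alg_def)
  moreover have "Alg L \<subseteq> Alg (Lat (Alg L))" by (auto simp: Lat_def Alg_def)
  ultimately show ?thesis by blast
qed

lemma id_in_Alg: "L \<subseteq> projections \<Longrightarrow> id_blinfun \<in> Alg L"
  by (auto simp: Alg_iff bounded_ops_closed projectionsD(2))

text \<open>Both the lattice and its commutant lie in the algebra, so that \<open>Lat (Alg L)\<close> is contained in
  the bicommutant; reflexivity of \<open>L\<close> is not needed.\<close>

lemma csl_Lat:
  assumes "csl L"
  shows "csl (Lat (Alg L))"
proof -
  define A where "A = Alg L"
  note cL = csl_cproj[OF assms]
  have Lp: "L \<subseteq> projections" using cL by (simp add: cproj_def)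
  have comm: "T \<in> A" if "T \<in> bounded_ops" "\<And>R x. R \<in> L \<Longrightarrow> T \<cdot> R \<cdot> x = R \<cdot> T \<cdot> x" for T
    unfolding A_def Alg_iff using that Lp projectionsD(2) by (metis subsetD)
  have LA: "L \<subseteq> A"
    using comm projectionsD(1) Lp cproj_commute[OF cL] by blast
  \<comment> \<open>\<open>R\<close> belongs to \<open>A\<close> and leaves the range of
    \<open>P\<close> invariant, hence commutes with \<open>P\<close>. So \<open>P\<close> commutes
    with \<open>L\<close> and belongs to \<open>A\<close> itself, and the argument repeats for two
    elements of \<open>Lat A\<close>.\<close>
  have LatL: "P \<cdot> R \<cdot> x = R \<cdot> P \<cdot> x" if "P \<in> Lat A" "R \<in> L" for P R x
    using that LA Lp by (intro invariant_commute) (auto simp: Lat_iff)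
  have LatA: "P \<in> A" if "P \<in> Lat A" for P
    using that LatL by (intro comm) (auto simp: Lat_iff projectionsD(1))
  have commute: "P o\<^sub>L Q = Q o\<^sub>L P" if "P \<in> Lat A" "Q \<in> Lat A" for P Q
  proof (rule blinfun_eqI)
    fix x
    have "P \<cdot> Q \<cdot> x = Q \<cdot> P \<cdot> x"
      using that LatA[OF that(2)] by (intro invariant_commute) (auto simp: Lat_iff)
    then show "(P o\<^sub>L Q) \<cdot> x = (Q o\<^sub>L P) \<cdot> x" by simp
  qed
  have sup: "\<exists>P\<in>Lat A. is_proj_sup S P" if S: "S \<subseteq> Lat A" for S
  proof -
    obtain P where P: "is_proj_sup S P" "range (blinfun_apply P) = closure (cspan (\<Union>Q\<in>S. range (blinfun_apply Q)))"
      using proj_sup_exists by blast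
    have Pp: "P \<in> projections" using P(1) by (simp add: is_proj_sup_def)
    have "T \<cdot> x \<in> range (blinfun_apply P)" if T: "T \<in> A" and x: "x \<in> range (blinfun_apply P)" for T x
    proof (rule maps_closed_span[OF _ closed_proj_range(2,1)[OF Pp] _ x[unfolded P(2)]])
      show "T \<in> bounded_ops" using T by (simp add: A_def Alg_iff)
      fix z assume "z \<in> (\<Union>Q\<in>S. range (blinfun_apply Q))"
      then obtain Q where Q: "Q \<in> S" "z \<in> range (blinfun_apply Q)" by blast
      then have "T \<cdot> z \<in> range (blinfun_apply Q)" using S T Lat_range_iff[of Q A] by blast
      then show "T \<cdot> z \<in> range (blinfun_apply P)" using P(1) Q(1) by (auto simp: is_proj_sup_def proj_le_def)
    qed
    then show ?thesis using Pp P(1) by (auto simp: Lat_range_iff)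
  qed
  have inf: "\<exists>P\<in>Lat A. is_proj_inf S P" if S: "S \<subseteq> Lat A" for S
  proof -
    have "S \<subseteq> projections" using S by (auto simp: Lat_iff)
    then obtain P where P: "is_proj_inf S P" "range (blinfun_apply P) = (\<Inter>Q\<in>S. range (blinfun_apply Q))"
      using proj_inf_exists by blast
    have "\<forall>T\<in>A. \<forall>x\<in>range (blinfun_apply P). T \<cdot> x \<in> range (blinfun_apply P)"
      unfolding P(2) using S Lat_range_iff[of _ A] by blast
    then show ?thesis using P(1) by (auto simp: Lat_range_iff is_proj_inf_def)
  qed
  show ?thesis
    unfolding csl_def projection_lattice_def A_def[symmetric]
    using sup inf commute by (auto simp: Lat_iff zero_proj id_proj)
qed

section \<open>Equivalent algebras have isomorphic lattices\<close>

definition image_proj :: "('a::complex_hilbert \<Rightarrow>\<^sub>L 'b::complex_hilbert) set \<Rightarrow> ('a \<Rightarrow>\<^sub>L 'a) \<Rightarrow> ('b \<Rightarrow>\<^sub>L 'b)" where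
  "image_proj U P = (SOME Q. Q \<in> projections \<and>
     range (blinfun_apply Q) = closure (cspan {u \<cdot> P \<cdot> x | u x. u \<in> U}))"

lemma image_proj:
  "image_proj U P \<in> projections"
  "range (blinfun_apply (image_proj U P)) = closure (cspan {u \<cdot> P \<cdot> x | u x. u \<in> U})"
proof -
  have "\<exists>Q. Q \<in> projections \<and> range (blinfun_apply Q) = closure (cspan {u \<cdot> P \<cdot> x | u x. u \<in> U})"
    using orthogonal_projection_exists[OF csubspace_closure[OF complex_vector.subspace_span] closed_closure] by blast
  from someI_ex[OF this]
  show "image_proj U P \<in> projections"
    "range (blinfun_apply (image_proj U P)) = closure (cspan {u \<cdot> P \<cdot> x | u x. u \<in> U})"
    by (auto simp: image_proj_def)
qed

lemma image_proj_in: "u \<in> U \<Longrightarrow> u \<cdot> P \<cdot> x \<in> range (blinfun_apply (image_proj U P))"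
  unfolding image_proj(2) by (rule subsetD[OF closure_subset], rule complex_vector.span_base) blast

lemma image_proj_mono:
  assumes "proj_le P Q"
  shows "proj_le (image_proj U P) (image_proj U Q)"
  unfolding proj_le_def image_proj(2)
proof (intro closure_mono complex_vector.span_mono)
  show "{u \<cdot> P \<cdot> x | u x. u \<in> U} \<subseteq> {u \<cdot> Q \<cdot> x | u x. u \<in> U}"
    using assms unfolding proj_le_def by (auto simp: image_subset_iff image_iff) metis
qed

text \<open>With the identity in \<open>A\<close>, the bimodule condition contains
  \<open>B U \<subseteq> U\<close>.\<close>

lemma image_proj_Lat:
  assumes "op_prod B (op_prod U A) \<subseteq> U" "id_blinfun \<in> A" "B \<subseteq> bounded_ops"
  shows "image_proj U P \<in> Lat B"
proof -
  have "T \<cdot> x \<in> range (blinfun_apply (image_proj U P))"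
    if T: "T \<in> B" and x: "x \<in> range (blinfun_apply (image_proj U P))" for T x
  proof (rule maps_closed_span[OF _ closed_proj_range(2,1)[OF image_proj(1)] _ x[unfolded image_proj(2)]])
    show "T \<in> bounded_ops" using T assms(3) by blast
    fix z assume "z \<in> {u \<cdot> P \<cdot> x | u x. u \<in> U}"
    then obtain u w where u: "u \<in> U" "z = u \<cdot> P \<cdot> w" by blast
    have "u o\<^sub>L id_blinfun \<in> op_prod U A" using u(1) assms(2) unfolding op_prod_def by blast
    then have "T o\<^sub>L (u o\<^sub>L id_blinfun) \<in> U" using T assms(1) unfolding op_prod_def by blast
    moreover have "T \<cdot> z = (T o\<^sub>L (u o\<^sub>L id_blinfun)) \<cdot> P \<cdot> w" by (simp add: u)
    ultimately show "T \<cdot> z \<in> range (blinfun_apply (image_proj U P))"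
      using image_proj_in by metis
  qed
  then show ?thesis by (simp add: Lat_range_iff image_proj(1))
qed

text \<open>\<open>R \<le> P\<close> because the products \<open>v u\<close> lie in \<open>A\<close>
  and \<open>P\<close> is invariant under \<open>A\<close>. Conversely \<open>P x - R P x\<close> is
  orthogonal to every \<open>v u P x\<close>; this orthogonality survives in the weak-* closure and
  so holds for the identity.\<close>

lemma image_proj_inverse:
  assumes cl: "weak_star_topology closure_of (cspan (op_prod V U)) = A" and id: "id_blinfun \<in> A"
    and UV: "U \<subseteq> bounded_ops" "V \<subseteq> bounded_ops" and P: "P \<in> Lat A"
  shows "image_proj V (image_proj U P) = P"
proof -
  define R where "R = image_proj V (image_proj U P)"
  have Rp: "R \<in> projections" by (simp add: R_def image_proj(1))
  have Pp: "P \<in> projections" using P by (simp add: Lat_iff)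
  have "op_prod V U \<subseteq> bounded_ops"
    using UV by (auto simp: op_prod_def intro!: bounded_ops_closed)
  then have "cspan (op_prod V U) \<subseteq> bounded_ops"
    by (intro complex_vector.span_minimal csubspace_bounded_ops)
  then have "cspan (op_prod V U) \<subseteq> A"
    unfolding cl[symmetric] by (intro closure_of_subset) (simp add: topspace_weak_star)
  then have VUA: "v o\<^sub>L u \<in> A" if "v \<in> V" "u \<in> U" for u v
    using that complex_vector.span_base[of "v o\<^sub>L u" "op_prod V U"] by (auto simp: op_prod_def)
  have "proj_le R P"
    unfolding proj_le_def R_def image_proj(2)
  proof (intro closure_minimal complex_vector.span_minimal closed_proj_range Pp subsetI)
    fix z assume "z \<in> {v \<cdot> image_proj U P \<cdot> x | v x. v \<in> V}"
    then obtain v x where v: "v \<in> V" "z = v \<cdot> image_proj U P \<cdot> x" by blast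
    have x: "image_proj U P \<cdot> x \<in> closure (cspan {u \<cdot> P \<cdot> x | u x. u \<in> U})"
      unfolding image_proj(2)[symmetric] by blast
    show "z \<in> range (blinfun_apply P)"
      unfolding v(2)
    proof (rule maps_closed_span[OF _ closed_proj_range(2,1)[OF Pp] _ x])
      show "v \<in> bounded_ops" using v UV by blast
      fix y assume "y \<in> {u \<cdot> P \<cdot> x | u x. u \<in> U}"
      then obtain u w where u: "u \<in> U" "y = u \<cdot> P \<cdot> w" by blast
      have "(v o\<^sub>L u) \<cdot> P \<cdot> w \<in> range (blinfun_apply P)"
        using P VUA[OF v(1) u(1)] unfolding Lat_range_iff by blast
      then show "v \<cdot> y \<in> range (blinfun_apply P)" by (simp add: u)
    qed
  qed
  moreover have "proj_le P R"
    unfolding proj_le_iff[OF Pp Rp]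
  proof
    fix x
    define z where "z = P \<cdot> x - R \<cdot> P \<cdot> x"
    have Rz: "R \<cdot> z = 0" by (simp add: z_def blinfun.bilinear_simps projectionsD(2)[OF Rp])
    have "cinner (T \<cdot> P \<cdot> x) z = 0" if T: "T \<in> cspan (op_prod V U)" for T
      using T
    proof (rule complex_vector.span_induct)
      show "csubspace {T. cinner (T \<cdot> P \<cdot> x) z = 0}"
        by (rule complex_vector.subspaceI)
          (auto simp: blinfun.bilinear_simps scaleC_blinfun.rep_eq cinner_scaleC_left cinner_add_left cinner.zero_left)
      fix T assume "T \<in> op_prod V U"
      then obtain v u where vu: "v \<in> V" "u \<in> U" "T = v o\<^sub>L u" unfolding op_prod_def by blast
      have "u \<cdot> P \<cdot> x \<in> range (blinfun_apply (image_proj U P))"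
        using vu(2) by (rule image_proj_in)
      then have "image_proj U P \<cdot> u \<cdot> P \<cdot> x = u \<cdot> P \<cdot> x" using proj_range_iff[OF image_proj(1)] by blast
      then have "T \<cdot> P \<cdot> x = v \<cdot> image_proj U P \<cdot> u \<cdot> P \<cdot> x" by (simp add: vu)
      then have "T \<cdot> P \<cdot> x \<in> range (blinfun_apply R)"
        unfolding R_def using image_proj_in[OF vu(1)] by simp
      then have "R \<cdot> T \<cdot> P \<cdot> x = T \<cdot> P \<cdot> x" using proj_range_iff[OF Rp] by blast
      then show "cinner (T \<cdot> P \<cdot> x) z = 0"
        using projectionsD(3)[OF Rp, of "T \<cdot> P \<cdot> x" z] by (simp add: Rz cinner.zero_right)
    qed
    from weak_star_closure_vanish[OF vector_functional this]
    have "cinner (id_blinfun \<cdot> P \<cdot> x) z = 0" using id cl by blast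
    moreover have "cinner (R \<cdot> P \<cdot> x) z = 0"
      by (simp add: projectionsD(3)[OF Rp] Rz cinner.zero_right)
    ultimately have "cinner z z = 0" by (simp add: z_def cinner.diff_left)
    then show "R \<cdot> P \<cdot> x = P \<cdot> x" by (simp add: cinner_self_eq_zero z_def)
  qed
  ultimately show ?thesis unfolding R_def[symmetric] using proj_le_antisym Pp Rp by blast
qed

lemma morita_imp_isomorphic:
  assumes "spatially_morita_equivalent A B"
    and A: "id_blinfun \<in> A" "A \<subseteq> bounded_ops" and B: "id_blinfun \<in> B" "B \<subseteq> bounded_ops"
  shows "lattice_isomorphic (Lat A) (Lat B)"
proof -
  obtain U V where UV: "U \<subseteq> bounded_ops" "V \<subseteq> bounded_ops"
    and inU: "op_prod B (op_prod U A) \<subseteq> U" and inV: "op_prod A (op_prod V B) \<subseteq> V"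
    and clA: "weak_star_topology closure_of (cspan (op_prod V U)) = A"
    and clB: "weak_star_topology closure_of (cspan (op_prod U V)) = B"
    using assms(1) unfolding spatially_morita_equivalent_def by blast
  note VU = image_proj_inverse[OF clA A(1) UV] and UV' = image_proj_inverse[OF clB B(1) UV(2,1)]
  have "bij_betw (image_proj U) (Lat A) (Lat B)"
    by (rule bij_betw_byWitness[where f' = "image_proj V"])
      (use VU UV' image_proj_Lat[OF inU A(1) B(2)] image_proj_Lat[OF inV B(1) A(2)] in auto)
  moreover have "proj_le P Q \<longleftrightarrow> proj_le (image_proj U P) (image_proj U Q)" if "P \<in> Lat A" "Q \<in> Lat A" for P Q
    using image_proj_mono[of P Q U] image_proj_mono[of "image_proj U P" "image_proj U Q" V] VU that by auto
  ultimately show ?thesis unfolding lattice_isomorphic_def by blast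
qed

theorem theorem4p3:
  fixes \<A> :: "('a::complex_hilbert \<Rightarrow>\<^sub>L 'a) set"
    and \<B> :: "('b::complex_hilbert \<Rightarrow>\<^sub>L 'b) set"
  assumes "csl_algebra \<A>" and "csl_algebra \<B>"
  shows "spatially_morita_equivalent \<A> \<B> \<longleftrightarrow> lattice_isomorphic (Lat \<A>) (Lat \<B>)"
proof -
  obtain L M where L: "csl L" "\<A> = Alg L" and M: "csl M" "\<B> = Alg M"
    using assms unfolding csl_algebra_def by blast
  have Lp: "L \<subseteq> projections" and Mp: "M \<subseteq> projections"
    using csl_cproj[OF L(1)] csl_cproj[OF M(1)] by (auto simp: cproj_def)
  show ?thesis
  proof
    assume "spatially_morita_equivalent \<A> \<B>"
    then show "lattice_isomorphic (Lat \<A>) (Lat \<B>)"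
      using id_in_Alg[OF Lp] id_in_Alg[OF Mp]
      by (intro morita_imp_isomorphic) (auto simp: L(2) M(2) Alg_iff)
  next
    assume "lattice_isomorphic (Lat \<A>) (Lat \<B>)"
    then obtain f where f: "bij_betw f (Lat \<A>) (Lat \<B>)"
      "\<And>P Q. P \<in> Lat \<A> \<Longrightarrow> Q \<in> Lat \<A> \<Longrightarrow> proj_le P Q \<longleftrightarrow> proj_le (f P) (f Q)"
      unfolding lattice_isomorphic_def by blast
    interpret csl_iso "Lat \<A>" "Lat \<B>" f
      using csl_Lat[OF L(1)] csl_Lat[OF M(1)] f by unfold_locales (auto simp: L(2) M(2))
    \<comment> \<open>The construction runs on \<open>Lat \<A>\<close> and \<open>Lat \<B>\<close>,
      whose algebras are the original ones.\<close>
    show "spatially_morita_equivalent \<A> \<B>"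
      using morita by (simp add: L(2) M(2) Alg_Lat_Alg[OF Lp] Alg_Lat_Alg[OF Mp])
  qed
qed

end
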